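(* Let $a_{\ell,j},b_{\ell,j}>0$ for $\ell,j\in\{0,1\}$, let $L,M,N$ be positive integers that are multiples of $2$, and let $$A_0(z)=\begin{pmatrix} b_{0,0} & a_{0,0} \\ {} a_{0,1} z & b_{0,1} \end{pmatrix},\qquad A_1(z)=\begin{pmatrix} b_{1,0} & a_{1,0} \\ {} a_{1,1} z & b_{1,1} \end{pmatrix},\qquad A(z)=A_0(z)A_1(z).$$ Let $K$ be the kernel given in the context. Then for all $\epsilon_1,\epsilon_2\in\{0,1\}$, $y_1,y_2\in\mathbb{Z}$ and integers $x_1,x_2$ with $2x_1+\epsilon_1,\,2x_2-\epsilon_2\in\{1,\dots,L-1\}$, the matrix $[K(2x_1+\epsilon_1,2y_1+j,2x_2-\epsilon_2,2y_2+i)]_{i,j=0}^1$ can be simplified to $$-\frac{\chi_{2x_1+\epsilon_1>2x_2-\epsilon_2}}{2\pi i}\oint_{\gamma_{\mathbb{C}}}\widehat{\lambda}(\varphi(\zeta))^{x_1-x_2}\phi(\zeta)^{y_2-y_1-1}\phi'(\zeta)A_1(\phi(\zeta))^{\epsilon_2}\mathfrak{e}(\varphi(\zeta))\widehat{\mathfrak{e}}(\varphi(\zeta))A_0(\phi(\zeta))^{\epsilon_1}d\zeta$$ $$+\frac{1}{2\pi i}\oint_{\gamma_{\mathbb{C}}}\oint_{\gamma_{\mathbb{C}}}\frac{\mathcal{R}_N^{\mathcal{W}}(\omega,\zeta)}{\widehat{h}(\omega)h(\zeta)}\frac{\widehat{\lambda}(\varphi(\omega))^{\frac{L}{2}-x_2}}{\phi(\omega)^{\frac{M+N}{2}-y_2}}\frac{\widehat{\lambda}(\varphi(\zeta))^{x_1}}{\phi(\zeta)^{y_1+1}}\phi'(\omega)\phi'(\zeta)A_1(\phi(\omega))^{\epsilon_2}\mathfrak{e}(\varphi(\omega))\widehat{\mathfrak{e}}(\varphi(\zeta))A_0(\phi(\zeta))^{\epsilon_1}d\zeta\,d\omega,$$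 where $\mathcal{R}_N^{\mathcal{W}}$ is the scalar Christoffel--Darboux kernel associated to the weight $\mathcal{W}$ on $\gamma_{\mathbb{C}}$, and the various quantities in the integrands depend on $$a_\pm=a_{1,1}a_{0,0}\pm a_{0,1}a_{1,0},\qquad b_\pm=b_{0,1}b_{1,1}\pm b_{0,0}b_{1,0},\qquad d=a_{0,0}b_{1,1}+a_{1,0}b_{0,0},$$ $$c_0=(a_{0,0}b_{1,1}+a_{1,0}b_{0,0})(a_{1,1}b_{0,1}+a_{0,1}b_{1,0}),\qquad c_1=(a_{0,1}b_{1,1}+a_{1,1}b_{0,0})(a_{1,0}b_{0,1}+a_{0,0}b_{1,0}),$$ and are given as follows. (a) If $a_-=0$, then $$\phi(\zeta)=\frac{\zeta^2-b_-^2}{2(c_0+c_1)},\quad h(\zeta)=1,\quad\widehat{h}(\zeta)=\zeta,\quad\mathfrak{e}(\varphi(\zeta))^T=\begin{pmatrix}1&\frac{\zeta+b_-}{2d}\end{pmatrix},\quad\widehat{\mathfrak{e}}(\varphi(\zeta))=\begin{pmatrix}\frac{\zeta-b_-}{2\zeta}&\frac{d}{\zeta}\end{pmatrix},$$ $$\widehat{\lambda}(\varphi(\zeta))=\frac{a_+(\zeta-\zeta_1)(\zeta-\zeta_2)}{4(c_0+c_1)},\quad\zeta_1=-b_+-\frac{2a_{1,0}b_{0,0}b_{0,1}}{a_{0,0}},\quad\zeta_2=-b_+-\frac{2a_{0,0}b_{1,0}b_{1,1}}{a_{1,0}},$$ $$\mathcal{W}(\omega)=\frac{\widehat{\lambda}(\varphi(\omega))^{L}\phi'(\omega)}{\phi(\omega)^{\frac{M+N}{2}}h(\omega)\widehat{h}(\omega)}.$$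 The contour $\gamma_{\mathbb{C}}$ is a circle oriented positively and surrounding both $b_-$ and $-b_-$. (b) If $a_-\ne0$, then define $$z_\pm=\frac{1}{a_-^2}\Big(-(c_0+c_1)\pm\sqrt{(c_0+c_1)^2-a_-^2b_-^2}\Big),\qquad c=\frac{\sqrt{|z_-|}-\sqrt{|z_+|}}{\sqrt{|z_-|}+\sqrt{|z_+|}}.$$ They satisfy $z_-<z_+<0$, $c\in(0,1)$, and we have $$\phi(\zeta)=\frac{z_+-z_-}{4\zeta}(\zeta-c)(\zeta-c^{-1}),\quad h(\zeta)=\zeta^{N},\quad\widehat{h}(\zeta)=\zeta^{N-2}(\zeta-1)(\zeta+1),$$ $$\mathfrak{e}(\varphi(\zeta))^T=\begin{pmatrix}1&\frac{b_--a_-\phi(\zeta)+\eta(\zeta)}{2d}\end{pmatrix},\qquad\widehat{\mathfrak{e}}(\varphi(\zeta))=\begin{pmatrix}\frac{a_-\phi(\zeta)+\eta(\zeta)-b_-}{2\eta(\zeta)}&\frac{d}{\eta(\zeta)}\end{pmatrix},$$ $$\eta(\zeta)=a_-\frac{z_+-z_-}{4}(\zeta-\zeta^{-1}),\qquad\widehat{\lambda}(\varphi(\zeta))=\frac{a_+\phi(\zeta)+b_++\eta(\zeta)}{2},\qquad \mathcal{W}(\omega)=\frac{\widehat{\lambda}(\varphi(\omega))^{L}\phi'(\omega)}{\phi(\omega)^{\frac{M+N}{2}}h(\omega)\widehat{h}(\omega)}.$$ The contour $\gamma_{\mathbb{C}}$ is a closed curve surrounding both $c$ and $c^{-1}$ in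 the positive direction, but not surrounding $0$.
   Context: $\chi_{u>v}=1$ if $u>v$ and $0$ otherwise. In the statement, $\mathfrak{e}(\varphi(\zeta))$, $\widehat{\mathfrak{e}}(\varphi(\zeta))$, $\widehat{\lambda}(\varphi(\zeta))$ may be regarded simply as names for the functions of $\zeta$ given by the displayed formulas ($\mathfrak{e}$ is a $2\times1$ column, $\widehat{\mathfrak{e}}$ a $1\times2$ row). **CD kernels.** For a contour $\Gamma$, an $m\times m$ matrix weight $V$ on $\Gamma$ and $n\in\mathbb{N}_{>0}$, the Christoffel--Darboux (CD) kernel $\mathcal{R}_n^V(w,z)$ is the unique bivariate $m\times m$ matrix polynomial of degree $\le n-1$ in both $w$ and $z$ such that $\int_\Gamma P(w)V(w)\mathcal{R}_n^V(w,z)dw=P(z)$ for every $m\times m$ matrix polynomial $P$ of degree $\le n-1$ and every $z\in\mathbb{C}$. The scalar CD kernel is the case $m=1$. **The kernel $K$.** $K$ is the correlation kernel of the determinantal process of non-intersecting paths associated with lozenge tilings of a hexagon with a $2\times2$ periodic weighting with edge weights $a_{\ell,j},b_{\ell,j}$, given by the (known) Duits--Kuijlaars formula: with $\gamma$ the positively oriented unit circle and $W(z)=z^{-\frac{M+N}{2}}A(z)^{L/2}$ (for which $\mathcal{R}_{N/2}^W$ on $\gamma$ is known to exist), for $\epsilon_1,\epsilon_2\in\{0,1\}$, $y_1,y_2\in\mathbb{Z}$ and integers $x_1,x_2$ with $2x_1+\epsilon_1,2x_2-\epsilon_2\in\{1,\dots,L-1\}$, $$[K(2x_1+\epsilon_1,2y_1+j,2x_2-\epsilon_2,2y_2+i)]_{i,j=0}^{1}=-\frac{\chi_{2x_1+\epsilon_1>2x_2-\epsilon_2}}{2\pi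 i}\oint_\gamma A_1(z)^{\epsilon_2}A(z)^{x_1-x_2}A_0(z)^{\epsilon_1}z^{y_2-y_1-1}dz$$ $$+\frac{1}{2\pi i}\oint_\gamma\oint_\gamma\frac{A_1(w)^{\epsilon_2}}{w^{\frac{M+N}{2}-y_2}}A(w)^{\frac L2-x_2}\mathcal{R}_{N/2}^W(w,z)A(z)^{x_1}\frac{A_0(z)^{\epsilon_1}}{z^{y_1+1}}\,dz\,dw.$$
   Formalization: The weight has λ̂^{L/2} instead of λ̂^L; in (b) h=ζ^{N/2} and ĥ=ζ^{N/2-2}(ζ-1)(ζ+1) instead of exponents N and N-2; z_+<0 and c<1 are claimed only if b_-≠0 (always z_+≤0, 0<c≤1). The printed forms are false. *)

theory Defs
  imports "HOL-Complex_Analysis.Complex_Analysis"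
begin

section \<open>Matrices of functions\<close>

text \<open>On the type \<open>complex^'m^'m\<close> the operations \<open>*\<close> and \<open>^\<close> are componentwise, so scalar
  multiples and powers of matrices are introduced here.\<close>

definition mscale :: "complex \<Rightarrow> complex^'m^'n \<Rightarrow> complex^'m^'n"  (infixr "*\<^sub>m" 71)
  where "c *\<^sub>m A = (\<chi> i j. c * A $ i $ j)"

definition mpowi :: "complex^'m^'m \<Rightarrow> int \<Rightarrow> complex^'m^'m"
  where "mpowi A k =
    (if 0 \<le> k then (((**) A) ^^ nat k) (mat 1) else (((**) (matrix_inv A)) ^^ nat (- k)) (mat 1))"

definition mcontour_integral ::
    "(real \<Rightarrow> complex) \<Rightarrow> (complex \<Rightarrow> complex^'m^'n) \<Rightarrow> complex^'m^'n"
  where "mcontour_integral g F = (\<chi> i j. contour_integral g (\<lambda>z. F z $ i $ j))"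

section \<open>Christoffel--Darboux kernels\<close>

text \<open>Throughout, \<open>k < n\<close> expresses ``degree at most \<open>n - 1\<close>''.\<close>

definition matrix_poly :: "nat \<Rightarrow> (complex \<Rightarrow> complex^'m^'m) \<Rightarrow> bool"
  where "matrix_poly n P \<longleftrightarrow> (\<exists>C. \<forall>z. P z = (\<Sum>k<n. z ^ k *\<^sub>m C k))"

definition bivariate_matrix_poly :: "nat \<Rightarrow> (complex \<Rightarrow> complex \<Rightarrow> complex^'m^'m) \<Rightarrow> bool"
  where "bivariate_matrix_poly n R \<longleftrightarrow>
    (\<exists>C. \<forall>w z. R w z = (\<Sum>k<n. \<Sum>l<n. (w ^ k * z ^ l) *\<^sub>m C k l))"

definition is_CD_kernel ::
    "(real \<Rightarrow> complex) \<Rightarrow> (complex \<Rightarrow> complex^'m^'m) \<Rightarrow> nat \<Rightarrow>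
      (complex \<Rightarrow> complex \<Rightarrow> complex^'m^'m) \<Rightarrow> bool"
  where "is_CD_kernel g V n R \<longleftrightarrow>
    bivariate_matrix_poly n R \<and>
    (\<forall>P z. matrix_poly n P \<longrightarrow>
      (\<forall>i j. ((\<lambda>w. (P w ** V w ** R w z) $ i $ j) has_contour_integral P z $ i $ j) g))"

definition CD_kernel ::
    "(real \<Rightarrow> complex) \<Rightarrow> (complex \<Rightarrow> complex^'m^'m) \<Rightarrow> nat \<Rightarrow>
      (complex \<Rightarrow> complex \<Rightarrow> complex^'m^'m)"
  where "CD_kernel g V n = (THE R. is_CD_kernel g V n R)"

definition is_scalar_CD_kernel ::
    "(real \<Rightarrow> complex) \<Rightarrow> (complex \<Rightarrow> complex) \<Rightarrow> nat \<Rightarrow> (complex \<Rightarrow> complex \<Rightarrow> complex) \<Rightarrow> bool"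
  where "is_scalar_CD_kernel g V n R \<longleftrightarrow>
    is_CD_kernel g (\<lambda>w. mat (V w) :: complex^1^1) n (\<lambda>w z. mat (R w z))"

definition scalar_CD_kernel ::
    "(real \<Rightarrow> complex) \<Rightarrow> (complex \<Rightarrow> complex) \<Rightarrow> nat \<Rightarrow> (complex \<Rightarrow> complex \<Rightarrow> complex)"
  where "scalar_CD_kernel g V n = (THE R. is_scalar_CD_kernel g V n R)"

section \<open>The correlation kernel of the tiling model\<close>

text \<open>The edge weights are \<open>a l j\<close> and \<open>b l j\<close> with \<open>l, j \<in> {0, 1}\<close>.\<close>

type_synonym weights = "nat \<Rightarrow> nat \<Rightarrow> real"

text \<open>\<open>trans_mat a b l\<close> is the matrix \<open>A\<^sub>l\<close>.\<close>

definition trans_mat :: "weights \<Rightarrow> weights \<Rightarrow> nat \<Rightarrow> complex \<Rightarrow> complex^2^2"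
  where "trans_mat a b l z =
    vector [vector [of_real (b l 0), of_real (a l 0)],
            vector [of_real (a l 1) * z, of_real (b l 1)]]"

definition period_mat :: "weights \<Rightarrow> weights \<Rightarrow> complex \<Rightarrow> complex^2^2"
  where "period_mat a b z = trans_mat a b 0 z ** trans_mat a b 1 z"

definition matrix_weight :: "weights \<Rightarrow> weights \<Rightarrow> nat \<Rightarrow> nat \<Rightarrow> nat \<Rightarrow> complex \<Rightarrow> complex^2^2"
  where "matrix_weight a b L M N z =
    z powi (- int ((M + N) div 2)) *\<^sub>m mpowi (period_mat a b z) (int (L div 2))"

abbreviation unit_circle :: "real \<Rightarrow> complex"
  where "unit_circle \<equiv> circlepath 0 1"

definition chi_gt :: "int \<Rightarrow> int \<Rightarrow> complex"
  where "chi_gt u v = (if u > v then 1 else 0)"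

text \<open>The right-hand side of the Duits--Kuijlaars formula.\<close>

definition DK_formula ::
    "weights \<Rightarrow> weights \<Rightarrow> nat \<Rightarrow> nat \<Rightarrow> nat \<Rightarrow> int \<Rightarrow> int \<Rightarrow> int \<Rightarrow> int \<Rightarrow> int \<Rightarrow> int \<Rightarrow> complex^2^2"
  where "DK_formula a b L M N \<epsilon>1 \<epsilon>2 x1 x2 y1 y2 =
    (let A0 = trans_mat a b 0; A1 = trans_mat a b 1; A = period_mat a b;
         R = CD_kernel unit_circle (matrix_weight a b L M N) (N div 2)
     in
      - (chi_gt (2 * x1 + \<epsilon>1) (2 * x2 - \<epsilon>2) / (2 * of_real pi * \<i>)) *\<^sub>m
          mcontour_integral unit_circle (\<lambda>z.
            z powi (y2 - y1 - 1) *\<^sub>m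
              (mpowi (A1 z) \<epsilon>2 ** mpowi (A z) (x1 - x2) ** mpowi (A0 z) \<epsilon>1))
      + (1 / (2 * of_real pi * \<i>)) *\<^sub>m
          mcontour_integral unit_circle (\<lambda>w. mcontour_integral unit_circle (\<lambda>z.
            (1 / (w powi (int ((M + N) div 2) - y2) * z powi (y1 + 1))) *\<^sub>m
              (mpowi (A1 w) \<epsilon>2 ** mpowi (A w) (int (L div 2) - x2) ** R w z **
               mpowi (A z) x1 ** mpowi (A0 z) \<epsilon>1))))"

text \<open>The formula prescribes \<open>K(2 x1 + \<epsilon>1, 2 y1 + j, 2 x2 - \<epsilon>2, 2 y2 + i)\<close> as the entry in row
  \<open>i\<close> and column \<open>j\<close>. The four arguments determine \<open>x1, \<epsilon>1, y1, j, x2, \<epsilon>2, y2, i\<close>; note that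
  \<open>u' = 2 x2 - \<epsilon>2\<close> means \<open>x2 = (u' + 1) div 2\<close>. Indices \<open>0, 1\<close> correspond to the elements
  \<open>1, 2\<close> of the index type.\<close>

definition corr_kernel ::
    "weights \<Rightarrow> weights \<Rightarrow> nat \<Rightarrow> nat \<Rightarrow> nat \<Rightarrow> int \<Rightarrow> int \<Rightarrow> int \<Rightarrow> int \<Rightarrow> complex"
  where "corr_kernel a b L M N u v u' v' =
    DK_formula a b L M N (u mod 2) (u' mod 2) (u div 2) ((u' + 1) div 2) (v div 2) (v' div 2)
      $ (if even v' then 1 else 2) $ (if even v then 1 else 2)"

definition corr_kernel_block ::
    "weights \<Rightarrow> weights \<Rightarrow> nat \<Rightarrow> nat \<Rightarrow> nat \<Rightarrow> int \<Rightarrow> int \<Rightarrow> int \<Rightarrow> int \<Rightarrow> int \<Rightarrow> int \<Rightarrow> complex^2^2"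
  where "corr_kernel_block a b L M N \<epsilon>1 \<epsilon>2 x1 x2 y1 y2 =
    (let K = (\<lambda>i j. corr_kernel a b L M N (2 * x1 + \<epsilon>1) (2 * y1 + j) (2 * x2 - \<epsilon>2) (2 * y2 + i))
     in vector [vector [K 0 0, K 0 1], vector [K 1 0, K 1 1]])"

section \<open>The scalar formula\<close>

text \<open>Since \<open>A\<close> has eigenvalue \<open>lam\<close> and \<open>matrix_weight\<close> contains \<open>A ^ (L/2)\<close>, the scalar weight
  contains \<open>lam ^ (L/2)\<close>. The source prints the exponent \<open>L\<close>, for which the scalar formula below is
  false already for \<open>L = M = N = 2\<close>.\<close>

definition scalar_weight ::
    "nat \<Rightarrow> nat \<Rightarrow> nat \<Rightarrow> (complex \<Rightarrow> complex) \<Rightarrow> (complex \<Rightarrow> complex) \<Rightarrow> (complex \<Rightarrow> complex) \<Rightarrow>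
      (complex \<Rightarrow> complex) \<Rightarrow> complex \<Rightarrow> complex"
  where "scalar_weight L M N \<phi> h hh lam \<omega> =
    lam \<omega> ^ (L div 2) * deriv \<phi> \<omega> / (\<phi> \<omega> ^ ((M + N) div 2) * h \<omega> * hh \<omega>)"

text \<open>The parameters \<open>hh\<close>, \<open>ee\<close>, \<open>eh\<close>, \<open>lam\<close> are, as functions of \<open>\<zeta>\<close>: h-hat, the column of right
  eigenvectors e, the row of left eigenvectors e-hat, and the eigenvalue lambda-hat of
  \<open>A(\<phi>(\<zeta>))\<close>.\<close>

definition scalar_formula ::
    "weights \<Rightarrow> weights \<Rightarrow> nat \<Rightarrow> nat \<Rightarrow> nat \<Rightarrow> (real \<Rightarrow> complex) \<Rightarrow>
      (complex \<Rightarrow> complex) \<Rightarrow> (complex \<Rightarrow> complex) \<Rightarrow> (complex \<Rightarrow> complex) \<Rightarrow>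
      (complex \<Rightarrow> complex^1^2) \<Rightarrow> (complex \<Rightarrow> complex^2^1) \<Rightarrow> (complex \<Rightarrow> complex) \<Rightarrow>
      int \<Rightarrow> int \<Rightarrow> int \<Rightarrow> int \<Rightarrow> int \<Rightarrow> int \<Rightarrow> complex^2^2"
  where "scalar_formula a b L M N g \<phi> h hh ee eh lam \<epsilon>1 \<epsilon>2 x1 x2 y1 y2 =
    (let A0 = trans_mat a b 0; A1 = trans_mat a b 1;
         R = scalar_CD_kernel g (scalar_weight L M N \<phi> h hh lam) N
     in
      - (chi_gt (2 * x1 + \<epsilon>1) (2 * x2 - \<epsilon>2) / (2 * of_real pi * \<i>)) *\<^sub>m
          mcontour_integral g (\<lambda>\<zeta>.
            (lam \<zeta> powi (x1 - x2) * \<phi> \<zeta> powi (y2 - y1 - 1) * deriv \<phi> \<zeta>) *\<^sub>m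
              (mpowi (A1 (\<phi> \<zeta>)) \<epsilon>2 ** ee \<zeta> ** eh \<zeta> ** mpowi (A0 (\<phi> \<zeta>)) \<epsilon>1))
      + (1 / (2 * of_real pi * \<i>)) *\<^sub>m
          mcontour_integral g (\<lambda>\<omega>. mcontour_integral g (\<lambda>\<zeta>.
            (R \<omega> \<zeta> / (hh \<omega> * h \<zeta>) *
             (lam \<omega> powi (int (L div 2) - x2) / \<phi> \<omega> powi (int ((M + N) div 2) - y2)) *
             (lam \<zeta> powi x1 / \<phi> \<zeta> powi (y1 + 1)) *
             deriv \<phi> \<omega> * deriv \<phi> \<zeta>) *\<^sub>m
              (mpowi (A1 (\<phi> \<omega>)) \<epsilon>2 ** ee \<omega> ** eh \<zeta> ** mpowi (A0 (\<phi> \<zeta>)) \<epsilon>1))))"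

section \<open>Constants\<close>

definition a_plus :: "weights \<Rightarrow> real" where "a_plus a = a 1 1 * a 0 0 + a 0 1 * a 1 0"
definition a_minus :: "weights \<Rightarrow> real" where "a_minus a = a 1 1 * a 0 0 - a 0 1 * a 1 0"
definition b_plus :: "weights \<Rightarrow> real" where "b_plus b = b 0 1 * b 1 1 + b 0 0 * b 1 0"
definition b_minus :: "weights \<Rightarrow> real" where "b_minus b = b 0 1 * b 1 1 - b 0 0 * b 1 0"

definition d_const :: "weights \<Rightarrow> weights \<Rightarrow> real"
  where "d_const a b = a 0 0 * b 1 1 + a 1 0 * b 0 0"

definition c0_const :: "weights \<Rightarrow> weights \<Rightarrow> real"
  where "c0_const a b =
    (a 0 0 * b 1 1 + a 1 0 * b 0 0) * (a 1 1 * b 0 1 + a 0 1 * b 1 0)"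

definition c1_const :: "weights \<Rightarrow> weights \<Rightarrow> real"
  where "c1_const a b =
    (a 0 1 * b 1 1 + a 1 1 * b 0 0) * (a 1 0 * b 0 1 + a 0 0 * b 1 0)"

section \<open>Case \<open>a_minus a = 0\<close>\<close>

definition phiA :: "weights \<Rightarrow> weights \<Rightarrow> complex \<Rightarrow> complex"
  where "phiA a b \<zeta> =
    (\<zeta>\<^sup>2 - of_real ((b_minus b)\<^sup>2)) / of_real (2 * (c0_const a b + c1_const a b))"

definition hA :: "complex \<Rightarrow> complex" where "hA \<zeta> = 1"

definition hhatA :: "complex \<Rightarrow> complex" where "hhatA \<zeta> = \<zeta>"

definition eA :: "weights \<Rightarrow> weights \<Rightarrow> complex \<Rightarrow> complex^1^2"
  where "eA a b \<zeta> =
    vector [vector [1], vector [(\<zeta> + of_real (b_minus b)) / of_real (2 * d_const a b)]]"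

definition ehatA :: "weights \<Rightarrow> weights \<Rightarrow> complex \<Rightarrow> complex^2^1"
  where "ehatA a b \<zeta> =
    vector [vector [(\<zeta> - of_real (b_minus b)) / (2 * \<zeta>), of_real (d_const a b) / \<zeta>]]"

definition zeta1 :: "weights \<Rightarrow> weights \<Rightarrow> real"
  where "zeta1 a b = - b_plus b - 2 * a 1 0 * b 0 0 * b 0 1 / a 0 0"

definition zeta2 :: "weights \<Rightarrow> weights \<Rightarrow> real"
  where "zeta2 a b = - b_plus b - 2 * a 0 0 * b 1 0 * b 1 1 / a 1 0"

definition lambdaA :: "weights \<Rightarrow> weights \<Rightarrow> complex \<Rightarrow> complex"
  where "lambdaA a b \<zeta> =
    of_real (a_plus a) * (\<zeta> - of_real (zeta1 a b)) * (\<zeta> - of_real (zeta2 a b)) /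
    of_real (4 * (c0_const a b + c1_const a b))"

section \<open>Case \<open>a_minus a \<noteq> 0\<close>\<close>

definition z_plus :: "weights \<Rightarrow> weights \<Rightarrow> real"
  where "z_plus a b =
    1 / (a_minus a)\<^sup>2 * (- (c0_const a b + c1_const a b)
      + sqrt ((c0_const a b + c1_const a b)\<^sup>2 - (a_minus a)\<^sup>2 * (b_minus b)\<^sup>2))"

definition z_minus :: "weights \<Rightarrow> weights \<Rightarrow> real"
  where "z_minus a b =
    1 / (a_minus a)\<^sup>2 * (- (c0_const a b + c1_const a b)
      - sqrt ((c0_const a b + c1_const a b)\<^sup>2 - (a_minus a)\<^sup>2 * (b_minus b)\<^sup>2))"

text \<open>If \<open>b_minus b = 0\<close>, then \<open>z_plus a b = 0\<close> and \<open>c_const a b = 1\<close>; otherwise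
  \<open>z_plus a b < 0\<close> and \<open>c_const a b < 1\<close>.\<close>

definition c_const :: "weights \<Rightarrow> weights \<Rightarrow> real"
  where "c_const a b =
    (sqrt \<bar>z_minus a b\<bar> - sqrt \<bar>z_plus a b\<bar>) / (sqrt \<bar>z_minus a b\<bar> + sqrt \<bar>z_plus a b\<bar>)"

definition phiB :: "weights \<Rightarrow> weights \<Rightarrow> complex \<Rightarrow> complex"
  where "phiB a b \<zeta> =
    of_real (z_plus a b - z_minus a b) / (4 * \<zeta>) *
    (\<zeta> - of_real (c_const a b)) * (\<zeta> - of_real (inverse (c_const a b)))"

definition etaB :: "weights \<Rightarrow> weights \<Rightarrow> complex \<Rightarrow> complex"
  where "etaB a b \<zeta> =
    of_real (a_minus a * (z_plus a b - z_minus a b) / 4) * (\<zeta> - inverse \<zeta>)"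

text \<open>The matrix kernel has degree at most \<open>N/2 - 1\<close> in each variable, and \<open>phiB\<close>, \<open>etaB\<close> are Laurent
  polynomials with exponents \<open>-1, 0, 1\<close>. Multiplication by \<open>hB\<close> takes the space of functions
  \<open>p(phiB \<zeta>) ** eB \<zeta>\<close>, where \<open>p\<close> is a row of polynomials of degree at most \<open>N/2 - 1\<close>, onto the
  polynomials of degree at most \<open>N - 1\<close>; multiplication by \<open>hhatB\<close> does the same for the
  functions \<open>ehatB \<zeta> ** p(phiB \<zeta>)\<close> with \<open>p\<close> a column. This fixes the exponents \<open>N/2\<close> and
  \<open>N/2 - 2\<close>; the latter is \<open>-1\<close> if \<open>N = 2\<close>. The source prints \<open>N\<close> and \<open>N - 2\<close>, which belong to
  a matrix kernel of index \<open>N\<close>; with them the scalar formula is false already for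
  \<open>L = M = N = 2\<close>.\<close>

definition hB :: "nat \<Rightarrow> complex \<Rightarrow> complex"
  where "hB N \<zeta> = \<zeta> ^ (N div 2)"

definition hhatB :: "nat \<Rightarrow> complex \<Rightarrow> complex"
  where "hhatB N \<zeta> = \<zeta> powi (int (N div 2) - 2) * (\<zeta> - 1) * (\<zeta> + 1)"

definition eB :: "weights \<Rightarrow> weights \<Rightarrow> complex \<Rightarrow> complex^1^2"
  where "eB a b \<zeta> =
    vector [vector [1],
      vector [(of_real (b_minus b) - of_real (a_minus a) * phiB a b \<zeta> + etaB a b \<zeta>) /
              of_real (2 * d_const a b)]]"

definition ehatB :: "weights \<Rightarrow> weights \<Rightarrow> complex \<Rightarrow> complex^2^1"
  where "ehatB a b \<zeta> =
    vector [vector [(of_real (a_minus a) * phiB a b \<zeta> + etaB a b \<zeta> - of_real (b_minus b)) /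
                    (2 * etaB a b \<zeta>),
                    of_real (d_const a b) / etaB a b \<zeta>]]"

definition lambdaB :: "weights \<Rightarrow> weights \<Rightarrow> complex \<Rightarrow> complex"
  where "lambdaB a b \<zeta> =
    (of_real (a_plus a) * phiB a b \<zeta> + of_real (b_plus b) + etaB a b \<zeta>) / 2"

end

theory Submission
  imports Defs
begin

text \<open>The idea is to diagonalise \<open>A\<close>. Its eigenvalues and eigenvectors are not functions of \<open>z\<close> but of a
point on the curve \<open>y\<^sup>2 = tr(A(z))\<^sup>2 - 4 det(A(z))\<close>, a two-sheeted cover of the \<open>z\<close>-plane. This curve
is rational, and \<open>\<zeta> \<mapsto> (\<phi>(\<zeta>), \<eta>(\<zeta>))\<close> parametrises it, with \<open>\<eta>(\<zeta>) = \<zeta>\<close> when \<open>a_minus = 0\<close>. At such a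
point \<open>e\<close> and \<open>ehat\<close> are right and left eigenvectors of \<open>A(\<phi>)\<close> with the same eigenvalue \<open>lam\<close>, and
\<open>e ehat = (1 + (2 A(\<phi>) - tr A(\<phi>)) / \<eta>) / 2\<close> is the spectral projection
(\<open>right_eigenvector2\<close>, \<open>left_eigenvector2\<close>, \<open>eigenprojection2\<close>).

Everything rests on one identity, \<open>transfer_integral\<close>: for matrices \<open>X\<close>, \<open>Y\<close> of Laurent polynomials,
the integral of \<open>X(z) Y(z) dz\<close> over the unit circle equals the integral of
\<open>X(\<phi>) e ehat Y(\<phi>) \<phi>' d\<zeta>\<close> over the new contour. By the formula for \<open>e ehat\<close> and linearity it
reduces to two families of moments: the integral of \<open>\<phi>\<^sup>k \<phi>'\<close> is \<open>4\<pi>\<i>\<close> for \<open>k = -1\<close> and \<open>0\<close> otherwise,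
since the contour surrounds both zeros of \<open>\<phi>\<close> and hence its image winds twice around \<open>0\<close>; and the
integral of \<open>\<phi>\<^sup>k \<phi>' / \<eta>\<close> vanishes for all \<open>k\<close>, because exchanging the two sheets changes the sign
of \<open>\<eta>\<close>.

The single integral of the Duits--Kuijlaars formula is a direct case. For the double integral the
two Christoffel--Darboux kernels have to be compared. Sending a row \<open>p\<close> of polynomials of degree less
than \<open>N/2\<close> to \<open>h p(\<phi>) e\<close>, and a column \<open>q\<close> to \<open>hhat ehat q(\<phi>)\<close>, gives scalar polynomials of degree
less than \<open>N\<close>, and the factors \<open>h\<close>, \<open>hhat\<close> in the scalar weight are such that the transfer identity
turns the pairing of \<open>p\<close> and \<open>q\<close> by the matrix weight into the scalar pairing of their images
(\<open>scalar_reproduction\<close>). As the matrix kernel exists, the first map is injective, so by counting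
dimensions bijective (\<open>row_image_surjective\<close>). Therefore
\<open>hhat(\<omega>) h(\<zeta>) ehat(\<omega>) R(\<phi>(\<omega>), \<phi>(\<zeta>)) e(\<zeta>)\<close>, with \<open>R\<close> the matrix kernel, has the reproducing property
for the scalar weight, and it is the only such kernel. Substituting this expression into the scalar
formula and transferring both integrals gives the double integral (\<open>double_integral_eq\<close>).

What depends on the case is the computation of the moments and the fact that the two maps above have
polynomial values of the right degree. In the second case the contour may pass through \<open>1\<close> or
\<open>-1\<close>, where \<open>\<eta>\<close> vanishes and the integrands have removable singularities at which the totalised
division assigns conventional values; \<open>has_contour_integral_spike_finite\<close> shows that finitely many
such values never influence a contour integral.\<close>

text \<open>Matrix entries are written with \<open>$\<close>, which would otherwise also denote coefficients of formal
  power series.\<close>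

no_notation fps_nth (infixl "$" 75)

section \<open>Contour integrals and finitely many exceptional points\<close>

text \<open>Sort the points by their absolute value and their distance from the rest of the set: each class is
bounded and uniformly discrete, hence finite.\<close>

lemma isolated_points_countable:
  fixes E :: "real set"
  assumes "\<And>t. t \<in> E \<Longrightarrow> \<not> t islimpt E"
  shows "countable E"
proof -
  define F where "F n = {t \<in> E. \<bar>t\<bar> \<le> real n \<and> (\<forall>u\<in>E. dist t u < inverse (real (Suc n)) \<longrightarrow> u = t)}" for n
  have "finite (F n)" for n
  proof -
    have "bounded (F n)"
      by (rule boundedI [of _ "real n"]) (auto simp: F_def)
    moreover have "uniform_discrete (F n)"
      unfolding uniform_discrete_def F_def
      by (rule exI [of _ "inverse (real (Suc n))"]) (simp del: of_nat_Suc, metis dist_commute)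
    ultimately show ?thesis
      using uniform_discrete_finite_iff [of "F n"] by simp
  qed
  moreover have "E \<subseteq> (\<Union>n. F n)"
  proof
    fix t assume t: "t \<in> E"
    obtain e where e: "e > 0" "\<forall>u\<in>E. u \<noteq> t \<longrightarrow> e \<le> dist u t"
      using assms [OF t] unfolding islimpt_approachable by (auto simp: not_less)
    obtain n1 where n1: "inverse (real (Suc n1)) < e"
      using e(1) reals_Archimedean by blast
    obtain n2 where n2: "\<bar>t\<bar> \<le> real n2"
      using real_arch_simple by blast
    have le: "inverse (real (Suc (max n1 n2))) \<le> inverse (real (Suc n1))"
      by (simp add: le_imp_inverse_le)
    have "u = t" if "u \<in> E" "dist t u < inverse (real (Suc (max n1 n2)))" for u
    proof (rule ccontr)
      assume "u \<noteq> t"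
      with that e(2) have "e \<le> dist t u" by (auto simp: dist_commute)
      with that le n1 show False by linarith
    qed
    moreover have "\<bar>t\<bar> \<le> real (max n1 n2)"
      using n2 by simp
    ultimately have "t \<in> F (max n1 n2)"
      unfolding F_def using t by blast
    then show "t \<in> (\<Union>n. F n)" by blast
  qed
  ultimately show ?thesis
    using countable_subset [of E "\<Union>n. F n"] countable_UN [of UNIV F] countable_finite by auto
qed

text \<open>Where the path has a nonzero derivative it leaves the value \<open>s\<close> at once, so such parameters are
isolated in the level set.\<close>

lemma level_set_regular_negligible:
  assumes "valid_path g"
  shows "negligible {t \<in> {0..1}. g t = s \<and> vector_derivative g (at t within {0..1}) \<noteq> 0}"
    (is "negligible ?E")
proof -
  obtain K where K: "finite K" "g C1_differentiable_on ({0..1} - K)"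
    using assms unfolding valid_path_def piecewise_C1_differentiable_on_def by blast
  define E' where "E' = ?E - K - {0,1}"
  have "countable E'"
  proof (rule isolated_points_countable)
    fix t assume t: "t \<in> E'"
    then have t': "0 < t" "t < 1" "g t = s" "t \<in> {0..1} - K"
      "vector_derivative g (at t within {0..1}) \<noteq> 0"
      unfolding E'_def by auto
    obtain D where D: "(g has_vector_derivative D) (at t)"
      using K(2) t'(4) unfolding C1_differentiable_on_def by blast
    have "(g has_vector_derivative D) (at t within {0..1})"
      using D has_vector_derivative_at_within by blast
    then have "vector_derivative g (at t within {0..1}) = D"
      using t' by (intro vector_derivative_within_cbox [of 0 1, simplified]) auto
    with t' have "D \<noteq> 0" by simp
    have "((\<lambda>u. (g u - g t) /\<^sub>R (u - t)) \<longlongrightarrow> D) (at t)"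
    proof -
      have "((\<lambda>u. norm ((g u - g t) - (u - t) *\<^sub>R D) / norm (u - t)) \<longlongrightarrow> 0) (at t)"
        using D unfolding has_vector_derivative_def has_derivative_iff_norm by simp
      then have "((\<lambda>u. norm ((g u - g t) /\<^sub>R (u - t) - D)) \<longlongrightarrow> 0) (at t)"
      proof (rule Lim_transform_eventually)
        show "\<forall>\<^sub>F u in at t. norm ((g u - g t) - (u - t) *\<^sub>R D) / norm (u - t) =
                norm ((g u - g t) /\<^sub>R (u - t) - D)"
          unfolding eventually_at_filter
        proof (rule always_eventually, intro allI impI)
          fix u assume "u \<noteq> t"
          then have "(g u - g t) /\<^sub>R (u - t) - D = ((g u - g t) - (u - t) *\<^sub>R D) /\<^sub>R (u - t)"
            by (simp add: scaleR_right_diff_distrib)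
          then show "norm ((g u - g t) - (u - t) *\<^sub>R D) / norm (u - t) =
                norm ((g u - g t) /\<^sub>R (u - t) - D)"
            by (simp add: divide_inverse mult.commute)
        qed
      qed
      then show ?thesis
        by (subst Lim_null) (rule tendsto_norm_zero_cancel)
    qed
    then have "\<forall>\<^sub>F u in at t. (g u - g t) /\<^sub>R (u - t) \<noteq> 0"
      using \<open>D \<noteq> 0\<close> by (rule tendsto_imp_eventually_ne)
    then have "\<forall>\<^sub>F u in at t. u \<notin> E'"
      by (rule eventually_mono) (use t' in \<open>auto simp: E'_def\<close>)
    then show "\<not> t islimpt E'"
      by (simp add: islimpt_iff_eventually)
  qed
  then have "negligible E'"
    by (simp add: negligible_iff_null_sets countable_imp_null_set_lborel null_sets_completionI)
  moreover have "negligible (K \<union> {0, 1})"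
    using K(1) by (intro negligible_finite) auto
  ultimately have "negligible (E' \<union> (K \<union> {0,1}))"
    by (rule negligible_Un)
  then show ?thesis
    by (rule negligible_subset) (auto simp: E'_def)
qed

text \<open>A path may spend a set of parameters of positive measure in a point of \<open>S\<close>, but almost everywhere
on that set its derivative is zero, so the values of the integrand there are multiplied by zero.\<close>

lemma has_contour_integral_spike_finite:
  assumes f: "(f has_contour_integral I) g" and "valid_path g" "finite S"
    and eq: "\<And>z. z \<in> path_image g \<Longrightarrow> z \<notin> S \<Longrightarrow> f' z = f z"
  shows "(f' has_contour_integral I) g"
proof -
  let ?E = "\<Union>s\<in>S. {t \<in> {0..1}. g t = s \<and> vector_derivative g (at t within {0..1}) \<noteq> 0}"
  have neg: "negligible ?E"
  proof (rule negligible_Union)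
    show "finite ((\<lambda>s. {t \<in> {0..1}. g t = s \<and> vector_derivative g (at t within {0..1}) \<noteq> 0}) ` S)"
      using \<open>finite S\<close> by (rule finite_imageI)
    fix T assume "T \<in> (\<lambda>s. {t \<in> {0..1}. g t = s \<and> vector_derivative g (at t within {0..1}) \<noteq> 0}) ` S"
    then obtain s where "T = {t \<in> {0..1}. g t = s \<and> vector_derivative g (at t within {0..1}) \<noteq> 0}"
      by (rule imageE)
    then show "negligible T"
      using level_set_regular_negligible [OF \<open>valid_path g\<close>, of s] by (rule ssubst)
  qed
  have eq': "f' (g t) * vector_derivative g (at t within {0..1}) =
             f (g t) * vector_derivative g (at t within {0..1})" if "t \<in> {0..1} - ?E" for t
  proof (cases "g t \<in> S")
    case True
    have "vector_derivative g (at t within {0..1}) = 0"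
    proof (rule ccontr)
      assume "vector_derivative g (at t within {0..1}) \<noteq> 0"
      then have "t \<in> ?E" using that True by (intro UN_I [OF True]) simp
      then show False using that by simp
    qed
    then show ?thesis by simp
  next
    case False
    moreover have "g t \<in> path_image g" using that by (simp add: path_image_def)
    ultimately show ?thesis by (simp add: eq)
  qed
  show ?thesis
    unfolding has_contour_integral_def
    by (rule has_integral_spike [OF neg eq' f [unfolded has_contour_integral_def]])
qed

section \<open>Square systems of linear equations\<close>

text \<open>Gaussian elimination: an equation with a nonzero coefficient at \<open>p\<close> expresses the unknown \<open>p\<close> by the
others.\<close>

lemma underdetermined_homogeneous_system:
  fixes H :: "'i \<Rightarrow> 'j \<Rightarrow> 'a::field"
  assumes "finite I" "finite J" "card I < card J"
  shows "\<exists>x. (\<exists>j\<in>J. x j \<noteq> 0) \<and> (\<forall>i\<in>I. (\<Sum>j\<in>J. H i j * x j) = 0)"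
  using assms
proof (induction I arbitrary: J H rule: finite_induct)
  case empty
  then obtain j where "j \<in> J" by fastforce
  then show ?case by (intro exI [of _ "\<lambda>_. 1"]) auto
next
  case (insert i I)
  show ?case
  proof (cases "\<forall>j\<in>J. H i j = 0")
    case True
    have "card I < card J" using insert by simp
    from insert.IH [OF insert.prems(1) this, of H] True show ?thesis by auto
  next
    case False
    then obtain p where p: "p \<in> J" "H i p \<noteq> 0" by blast
    let ?J = "J - {p}"
    have "card I < card ?J" using insert p by simp
    from insert.IH [OF _ this, of "\<lambda>k j. H k j - H k p * H i j / H i p"] insert.prems(1)
    obtain x where x: "\<exists>j\<in>?J. x j \<noteq> 0"
      "\<And>k. k \<in> I \<Longrightarrow> (\<Sum>j\<in>?J. (H k j - H k p * H i j / H i p) * x j) = 0"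
      by auto
    \<comment> \<open>The value at \<open>p\<close> is forced by equation \<open>i\<close>.\<close>
    define y where "y j = (if j = p then - (\<Sum>j\<in>?J. H i j * x j) / H i p else x j)" for j
    have split: "(\<Sum>j\<in>J. H k j * y j) = H k p * y p + (\<Sum>j\<in>?J. H k j * x j)" for k
      using p insert.prems(1) by (subst sum.remove [of J p]) (auto simp: y_def intro!: sum.cong)
    have "(\<Sum>j\<in>J. H i j * y j) = 0"
      unfolding split using p by (simp add: y_def)
    moreover have "(\<Sum>j\<in>J. H k j * y j) = 0" if "k \<in> I" for k
    proof -
      have "(\<Sum>j\<in>?J. H k j * x j) = H k p * (\<Sum>j\<in>?J. H i j * x j) / H i p"
        using x(2) [OF that]
        unfolding left_diff_distrib sum_subtractf
        by (simp add: sum_distrib_left sum_divide_distrib mult_ac)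
      then show ?thesis unfolding split by (simp add: y_def)
    qed
    moreover have "\<exists>j\<in>J. y j \<noteq> 0" using x(1) by (auto simp: y_def)
    ultimately show ?thesis by blast
  qed
qed

text \<open>Adjoin the right-hand side as one more unknown \<open>None\<close>. A nontrivial solution of the enlarged
homogeneous system exists for reasons of dimension; its component \<open>None\<close> is nonzero because the
original system is injective, and dividing by it solves the given system.\<close>

lemma square_system_solvable:
  fixes H :: "'i \<Rightarrow> 'j \<Rightarrow> 'a::field"
  assumes fin: "finite I" "finite J" and card: "card I = card J"
    and inj: "\<And>x. \<forall>i\<in>I. (\<Sum>j\<in>J. H i j * x j) = 0 \<Longrightarrow> \<forall>j\<in>J. x j = 0"
  shows "\<exists>x. \<forall>i\<in>I. (\<Sum>j\<in>J. H i j * x j) = u i"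
proof -
  let ?J = "insert None (Some ` J)"
  have [simp]: "(\<Sum>j\<in>?J. f j) = f None + (\<Sum>j\<in>J. f (Some j))" for f :: "_ \<Rightarrow> 'a"
    using fin by (subst sum.insert) (auto simp: sum.reindex)
  have "card I < card ?J"
    using fin card by (subst card_insert_disjoint) (auto simp: card_image)
  from underdetermined_homogeneous_system [OF fin(1) _ this, of "\<lambda>i. case_option (- u i) (H i)"] fin
  obtain y where y: "\<exists>j\<in>?J. y j \<noteq> 0"
    "\<And>i. i \<in> I \<Longrightarrow> (\<Sum>j\<in>J. H i j * y (Some j)) = u i * y None"
    by auto
  have "y None \<noteq> 0"
    using inj [of "\<lambda>j. y (Some j)"] y by auto
  then show ?thesis
    using y(2) by (intro exI [of _ "\<lambda>j. y (Some j) / y None"])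
      (auto simp: sum_divide_distrib [symmetric] divide_simps)
qed

text \<open>The transposed matrix is injective, as it has a left inverse, and therefore surjective by
\<open>square_system_solvable\<close>. This yields a left inverse of \<open>H\<close>.\<close>

lemma right_inverse_imp_injective:
  fixes H :: "'i \<Rightarrow> 'i \<Rightarrow> 'a::field"
  assumes fin: "finite I"
    and inv: "\<And>i k. i \<in> I \<Longrightarrow> k \<in> I \<Longrightarrow> (\<Sum>j\<in>I. H i j * C j k) = (if i = k then 1 else 0)"
    and x: "\<And>i. i \<in> I \<Longrightarrow> (\<Sum>j\<in>I. H i j * x j) = 0"
    and "m \<in> I"
  shows "x m = 0"
proof -
  have "\<exists>y. \<forall>j\<in>I. (\<Sum>i\<in>I. H i j * y i) = (if j = m then 1 else 0)"
  proof (rule square_system_solvable [OF fin fin refl, of "\<lambda>j i. H i j"], rule ballI)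
    fix y k assume y: "\<forall>j\<in>I. (\<Sum>i\<in>I. H i j * y i) = 0" and k: "k \<in> I"
    have "y k = (\<Sum>i\<in>I. y i * (if i = k then 1 else 0))"
      using fin k by (simp add: if_distrib cong: if_cong)
    also have "\<dots> = (\<Sum>i\<in>I. y i * (\<Sum>j\<in>I. H i j * C j k))"
      by (intro sum.cong refl) (simp only: inv [OF _ k])
    also have "\<dots> = (\<Sum>j\<in>I. C j k * (\<Sum>i\<in>I. H i j * y i))"
      unfolding sum_distrib_left by (subst sum.swap) (simp add: mult_ac)
    also have "\<dots> = 0" using y by simp
    finally show "y k = 0" .
  qed
  then obtain y where y: "\<And>j. j \<in> I \<Longrightarrow> (\<Sum>i\<in>I. H i j * y i) = (if j = m then 1 else 0)"
    by blast
  have "x m = (\<Sum>j\<in>I. x j * (if j = m then 1 else 0))"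
    using fin \<open>m \<in> I\<close> by (simp add: if_distrib cong: if_cong)
  also have "\<dots> = (\<Sum>j\<in>I. x j * (\<Sum>i\<in>I. H i j * y i))"
    by (intro sum.cong refl) (simp only: y)
  also have "\<dots> = (\<Sum>i\<in>I. y i * (\<Sum>j\<in>I. H i j * x j))"
    unfolding sum_distrib_left by (subst sum.swap) (simp add: mult_ac)
  also have "\<dots> = 0" using x by simp
  finally show ?thesis .
qed

section \<open>Uniqueness of Christoffel--Darboux kernels\<close>

lemma mscale_nth [simp]: "(c *\<^sub>m A) $ i $ j = c * A $ i $ j"
  by (simp add: mscale_def)

lemma matrix_mult_nth: "(A ** B) $ i $ j = (\<Sum>k\<in>UNIV. A $ i $ k * B $ k $ j)"
  by (simp add: matrix_matrix_mult_def)

lemma mscale_mult_left: "(c *\<^sub>m A) ** B = c *\<^sub>m (A ** B)"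
  by (simp add: vec_eq_iff matrix_mult_nth sum_distrib_left mult.assoc)

lemma mscale_mult_right: "A ** (c *\<^sub>m B) = c *\<^sub>m (A ** B)"
  by (simp add: vec_eq_iff matrix_mult_nth sum_distrib_left mult_ac)

lemma matrix_mult_add_left: "(A + B) ** C = A ** C + B ** C"
  by (simp add: vec_eq_iff matrix_mult_nth sum.distrib distrib_right)

lemma mscale_mscale: "c *\<^sub>m (d *\<^sub>m A) = (c * d) *\<^sub>m A"
  by (simp add: vec_eq_iff)

lemma mscale_one [simp]: "1 *\<^sub>m A = A"
  by (simp add: vec_eq_iff)

lemma power_sum_coeffs_unique:
  fixes c d :: "nat \<Rightarrow> complex"
  assumes "\<And>z. (\<Sum>l<n. c l * z ^ l) = (\<Sum>l<n. d l * z ^ l)" "l < n"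
  shows "c l = d l"
proof -
  from \<open>l < n\<close> obtain m where n: "n = Suc m" by (cases n) auto
  with assms show ?thesis
    using polyfun_eq_coeffs [of c m d] by (auto simp: lessThan_Suc_atMost)
qed

text \<open>The reproducing property says that the coefficient matrix of the kernel is a right inverse of the
block Hankel matrix of moments. It is obtained by testing with \<open>P(w) = w\<^sup>k\<close> times the identity and
comparing coefficients of \<open>z\<close>.\<close>

lemma CD_kernel_moment_identity:
  fixes V :: "complex \<Rightarrow> complex^'m^'m"
  assumes CD: "is_CD_kernel g V n R"
    and C: "\<And>w z. R w z = (\<Sum>k<n. \<Sum>l<n. (w ^ k * z ^ l) *\<^sub>m C k l)"
    and int: "\<And>k i j. (\<lambda>w. w ^ k * V w $ i $ j) contour_integrable_on g"
    and k: "k < n" and l: "l < n"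
  shows "(\<Sum>m<n. \<Sum>s\<in>UNIV. contour_integral g (\<lambda>w. w ^ (k + m) * V w $ i $ s) * C m l $ s $ j)
         = (if k = l \<and> i = j then 1 else 0)"
proof -
  define X where "X l = (\<Sum>m<n. \<Sum>s\<in>UNIV. contour_integral g (\<lambda>w. w ^ (k + m) * V w $ i $ s) * C m l $ s $ j)" for l
  define \<delta> :: complex where "\<delta> = (if i = j then 1 else 0)"
  have "(\<Sum>l<n. X l * z ^ l) = (\<Sum>l<n. (if l = k then \<delta> else 0) * z ^ l)" for z
  proof -
    define P where "P w = w ^ k *\<^sub>m (mat 1 :: complex^'m^'m)" for w
    have "matrix_poly n P"
      unfolding matrix_poly_def P_def
    proof (intro exI allI)
      fix w :: complex
      show "w ^ k *\<^sub>m mat 1 = (\<Sum>r<n. w ^ r *\<^sub>m ((if r = k then 1 else 0) *\<^sub>m (mat 1 :: complex^'m^'m)))"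
        using k by (simp add: vec_eq_iff if_distrib if_distribR cong: if_cong)
    qed
    then have "((\<lambda>w. (P w ** V w ** R w z) $ i $ j) has_contour_integral P z $ i $ j) g"
      using CD unfolding is_CD_kernel_def by blast
    moreover have "(P w ** V w ** R w z) $ i $ j =
        (\<Sum>l<n. \<Sum>m<n. \<Sum>s\<in>UNIV. (C m l $ s $ j * z ^ l) * (w ^ (k + m) * V w $ i $ s))" for w
    proof -
      have "(P w ** V w ** R w z) $ i $ j = w ^ k * (\<Sum>s\<in>UNIV. V w $ i $ s * R w z $ s $ j)"
        by (simp add: P_def mscale_mult_left matrix_mult_nth)
      also have "\<dots> = (\<Sum>s\<in>UNIV. \<Sum>m<n. \<Sum>l<n. (C m l $ s $ j * z ^ l) * (w ^ (k + m) * V w $ i $ s))"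
        by (simp add: C sum_distrib_left power_add mult_ac)
      also have "\<dots> = (\<Sum>m<n. \<Sum>l<n. \<Sum>s\<in>UNIV. (C m l $ s $ j * z ^ l) * (w ^ (k + m) * V w $ i $ s))"
        by (subst sum.swap, intro sum.cong refl, rule sum.swap)
      also have "\<dots> = (\<Sum>l<n. \<Sum>m<n. \<Sum>s\<in>UNIV. (C m l $ s $ j * z ^ l) * (w ^ (k + m) * V w $ i $ s))"
        by (rule sum.swap)
      finally show ?thesis .
    qed
    moreover have "((\<lambda>w. \<Sum>l<n. \<Sum>m<n. \<Sum>s\<in>UNIV. (C m l $ s $ j * z ^ l) * (w ^ (k + m) * V w $ i $ s))
        has_contour_integral
        (\<Sum>l<n. \<Sum>m<n. \<Sum>s\<in>UNIV. (C m l $ s $ j * z ^ l) *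
            contour_integral g (\<lambda>w. w ^ (k + m) * V w $ i $ s))) g"
      by (intro has_contour_integral_sum has_contour_integral_lmul has_contour_integral_integral int)
        auto
    ultimately have "P z $ i $ j = (\<Sum>l<n. \<Sum>m<n. \<Sum>s\<in>UNIV. (C m l $ s $ j * z ^ l) *
            contour_integral g (\<lambda>w. w ^ (k + m) * V w $ i $ s))"
      by (simp add: has_contour_integral_unique)
    also have "\<dots> = (\<Sum>l<n. X l * z ^ l)"
      by (simp add: X_def sum_distrib_left sum_distrib_right mult_ac)
    finally have "P z $ i $ j = (\<Sum>l<n. X l * z ^ l)" .
    moreover have "P z $ i $ j = z ^ k * \<delta>"
      by (simp add: P_def \<delta>_def mat_def)
    moreover have "(\<Sum>l<n. (if l = k then \<delta> else 0) * z ^ l) = \<delta> * z ^ k"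
    proof -
      have "(\<Sum>l<n. (if l = k then \<delta> else 0) * z ^ l) = (\<Sum>l<n. if l = k then \<delta> * z ^ k else 0)"
        by (intro sum.cong) auto
      then show ?thesis using k by simp
    qed
    ultimately show ?thesis by (simp only: mult.commute)
  qed
  from power_sum_coeffs_unique [OF this l] have "X l = (if l = k then \<delta> else 0)" .
  then show ?thesis
    unfolding X_def \<delta>_def by (cases "l = k") auto
qed

text \<open>By \<open>CD_kernel_moment_identity\<close> the difference of two coefficient matrices is annihilated by the
moment matrix, which is injective because it has a right inverse.\<close>

lemma CD_kernel_unique:
  fixes V :: "complex \<Rightarrow> complex^'m^'m"
  assumes R: "is_CD_kernel g V n R" and R': "is_CD_kernel g V n R'"
    and int: "\<And>k i j. (\<lambda>w. w ^ k * V w $ i $ j) contour_integrable_on g"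
  shows "R = R'"
proof -
  obtain C where C: "\<And>w z. R w z = (\<Sum>k<n. \<Sum>l<n. (w ^ k * z ^ l) *\<^sub>m C k l)"
    using R unfolding is_CD_kernel_def bivariate_matrix_poly_def by blast
  obtain C' where C': "\<And>w z. R' w z = (\<Sum>k<n. \<Sum>l<n. (w ^ k * z ^ l) *\<^sub>m C' k l)"
    using R' unfolding is_CD_kernel_def bivariate_matrix_poly_def by blast
  let ?I = "{..<n} \<times> (UNIV :: 'm set)"
  define H where "H p q = contour_integral g (\<lambda>w. w ^ (fst p + fst q) * V w $ snd p $ snd q)"
    for p q :: "nat \<times> 'm"
  have eq: "C m l $ s $ j = C' m l $ s $ j" if m: "m < n" and l: "l < n" for m l s j
  proof -
    have inv: "(\<Sum>q\<in>?I. H p q * C (fst q) (fst r) $ snd q $ snd r) = (if p = r then 1 else 0)"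
      if "p \<in> ?I" "r \<in> ?I" for p r
      using CD_kernel_moment_identity [OF R C int, of "fst p" "fst r" "snd p" "snd r"] that
      by (auto simp: H_def sum.cartesian_product case_prod_beta prod_eq_iff)
    have inv': "(\<Sum>q\<in>?I. H p q * C' (fst q) (fst r) $ snd q $ snd r) = (if p = r then 1 else 0)"
      if "p \<in> ?I" "r \<in> ?I" for p r
      using CD_kernel_moment_identity [OF R' C' int, of "fst p" "fst r" "snd p" "snd r"] that
      by (auto simp: H_def sum.cartesian_product case_prod_beta prod_eq_iff)
    have "C (fst (m, s)) l $ snd (m, s) $ j - C' (fst (m, s)) l $ snd (m, s) $ j = 0"
    proof (rule right_inverse_imp_injective [where I = ?I and H = H])
      show "(\<Sum>q\<in>?I. H p q * (C (fst q) l $ snd q $ j - C' (fst q) l $ snd q $ j)) = 0"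
        if "p \<in> ?I" for p
        using inv [OF that, of "(l, j)"] inv' [OF that, of "(l, j)"] l
        by (simp add: right_diff_distrib sum_subtractf)
      show "(\<Sum>q\<in>?I. H p q * C (fst q) (fst r) $ snd q $ snd r) = (if p = r then 1 else 0)"
        if "p \<in> ?I" "r \<in> ?I" for p r
        using inv [OF that] .
    qed (use m in auto)
    then show ?thesis by simp
  qed
  show ?thesis
  proof (intro ext)
    fix w z
    show "R w z = R' w z"
      unfolding C C' by (intro sum.cong refl) (simp add: vec_eq_iff eq)
  qed
qed

text \<open>The reproducing property for a single row of polynomials, read off coefficient by coefficient: the
pairing with the coefficient of \<open>z\<^sup>l\<close> in column \<open>j\<close> of the kernel returns the coefficient of \<open>z\<^sup>l\<close> in
entry \<open>j\<close> of the row. This is the form that survives the passage to the scalar weight.\<close>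

lemma CD_kernel_reproduces_row:
  fixes V :: "complex \<Rightarrow> complex^'m^'m"
  assumes CD: "is_CD_kernel g V n R"
    and C: "\<And>w z. R w z = (\<Sum>k<n. \<Sum>l<n. (w ^ k * z ^ l) *\<^sub>m C k l)"
    and int: "\<And>k i j. (\<lambda>w. w ^ k * V w $ i $ j) contour_integrable_on g"
    and l: "l < n"
  shows "((\<lambda>w. \<Sum>i\<in>UNIV. (\<Sum>k<n. x k i * w ^ k) *
             (\<Sum>s\<in>UNIV. V w $ i $ s * (\<Sum>m<n. w ^ m * C m l $ s $ j)))
         has_contour_integral x l j) g"
proof -
  have "((\<lambda>w. \<Sum>k<n. \<Sum>i\<in>UNIV. x k i * (\<Sum>m<n. \<Sum>s\<in>UNIV. (w ^ (k + m) * V w $ i $ s) * C m l $ s $ j))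
      has_contour_integral
        (\<Sum>k<n. \<Sum>i\<in>UNIV. x k i * (\<Sum>m<n. \<Sum>s\<in>UNIV.
          contour_integral g (\<lambda>w. w ^ (k + m) * V w $ i $ s) * C m l $ s $ j))) g"
    by (intro has_contour_integral_sum has_contour_integral_lmul has_contour_integral_rmul
        has_contour_integral_integral int) auto
  moreover have "(\<Sum>k<n. \<Sum>i\<in>UNIV. x k i * (\<Sum>m<n. \<Sum>s\<in>UNIV.
          contour_integral g (\<lambda>w. w ^ (k + m) * V w $ i $ s) * C m l $ s $ j)) = x l j"
  proof -
    have "(\<Sum>k<n. \<Sum>i\<in>UNIV. x k i * (\<Sum>m<n. \<Sum>s\<in>UNIV.
          contour_integral g (\<lambda>w. w ^ (k + m) * V w $ i $ s) * C m l $ s $ j)) =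
      (\<Sum>k<n. \<Sum>i\<in>UNIV. x k i * (if k = l \<and> i = j then 1 else 0))"
      by (intro sum.cong refl, subst CD_kernel_moment_identity [OF CD C int _ l]) auto
    also have "\<dots> = (\<Sum>k<n. if k = l then x k j else 0)"
      by (intro sum.cong refl) (auto simp: if_distrib cong: if_cong)
    also have "\<dots> = x l j" using l by simp
    finally show ?thesis .
  qed
  moreover have "(\<Sum>k<n. \<Sum>i\<in>UNIV. x k i * (\<Sum>m<n. \<Sum>s\<in>UNIV. (w ^ (k + m) * V w $ i $ s) * C m l $ s $ j))
     = (\<Sum>i\<in>UNIV. (\<Sum>k<n. x k i * w ^ k) *
             (\<Sum>s\<in>UNIV. V w $ i $ s * (\<Sum>m<n. w ^ m * C m l $ s $ j)))" for w
  proof -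
    have "(\<Sum>m<n. \<Sum>s\<in>UNIV. (w ^ (k + m) * V w $ i $ s) * C m l $ s $ j) =
       w ^ k * (\<Sum>s\<in>UNIV. V w $ i $ s * (\<Sum>m<n. w ^ m * C m l $ s $ j))" for k i
      by (subst sum.swap) (simp add: sum_distrib_left power_add mult_ac)
    then show ?thesis
      by (subst sum.swap) (simp add: sum_distrib_right mult.assoc)
  qed
  ultimately show ?thesis by simp
qed

section \<open>Laurent polynomials and their integrals\<close>

text \<open>Only the values away from \<open>0\<close> matter, since \<open>1 / 0 = 0\<close> would otherwise break the closure under
sums: \<open>1 / z + 1\<close> and \<open>(1 + z) / z\<close> differ at \<open>0\<close>.\<close>

definition laurent :: "(complex \<Rightarrow> complex) \<Rightarrow> bool"
  where "laurent F \<longleftrightarrow> (\<exists>m p. \<forall>z. z \<noteq> 0 \<longrightarrow> F z = poly p z / z ^ m)"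

lemma laurent_poly: "laurent (poly p)"
  unfolding laurent_def by (intro exI [of _ 0] exI [of _ p]) simp

lemma laurent_const: "laurent (\<lambda>_. c)"
  using laurent_poly [of "[:c:]"] by (simp add: laurent_def)

lemma laurent_id: "laurent (\<lambda>z. z)"
  using laurent_poly [of "[:0, 1:]"] by (simp add: laurent_def)

lemma laurent_add:
  assumes "laurent F" "laurent G"
  shows "laurent (\<lambda>z. F z + G z)"
proof -
  from assms obtain m p n q where
    "\<forall>z. z \<noteq> 0 \<longrightarrow> F z = poly p z / z ^ m" "\<forall>z. z \<noteq> 0 \<longrightarrow> G z = poly q z / z ^ n"
    unfolding laurent_def by blast
  then show ?thesis unfolding laurent_def
    by (intro exI [of _ "m + n"] exI [of _ "p * monom 1 n + q * monom 1 m"])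
      (auto simp: poly_monom field_simps power_add)
qed

lemma laurent_mult:
  assumes "laurent F" "laurent G"
  shows "laurent (\<lambda>z. F z * G z)"
proof -
  from assms obtain m p n q where
    "\<forall>z. z \<noteq> 0 \<longrightarrow> F z = poly p z / z ^ m" "\<forall>z. z \<noteq> 0 \<longrightarrow> G z = poly q z / z ^ n"
    unfolding laurent_def by blast
  then show ?thesis unfolding laurent_def
    by (intro exI [of _ "m + n"] exI [of _ "p * q"]) (auto simp: power_add)
qed

lemma laurent_sum: "(\<And>i. i \<in> I \<Longrightarrow> laurent (F i)) \<Longrightarrow> laurent (\<lambda>z. \<Sum>i\<in>I. F i z)"
  by (induction I rule: infinite_finite_induct) (auto intro: laurent_const laurent_add)

lemma laurent_powi: "laurent (\<lambda>z. z powi k)"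
proof (cases "k \<ge> 0")
  case True
  then have "(\<lambda>z::complex. z powi k) = poly (monom 1 (nat k))"
    by (auto simp: poly_monom power_int_def)
  then show ?thesis using laurent_poly by simp
next
  case False
  then show ?thesis unfolding laurent_def
    by (intro exI [of _ "nat (- k)"] exI [of _ 1]) (auto simp: power_int_def field_simps)
qed

lemma laurent_power: "laurent (\<lambda>z. z ^ k)"
  using laurent_powi [of "int k"] by simp

text \<open>If only the power \<open>-1\<close> contributes to the integrals of \<open>\<phi>\<^sup>k \<psi>\<close>, the integral of \<open>F(\<phi>) \<psi>\<close> is
the residue \<open>r\<close> of \<open>F\<close> at \<open>0\<close> times that contribution. The same \<open>r\<close> serves all contours, which is
what makes integrals over different contours comparable.\<close>

lemma laurent_residue:
  assumes "laurent F"
  obtains r where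
    "\<And>g \<phi> \<psi> c. (\<And>\<zeta>. \<zeta> \<in> path_image g \<Longrightarrow> \<phi> \<zeta> \<noteq> 0) \<Longrightarrow>
       (\<And>k::int. ((\<lambda>\<zeta>. \<phi> \<zeta> powi k * \<psi> \<zeta>) has_contour_integral (if k = -1 then c else 0)) g) \<Longrightarrow>
       ((\<lambda>\<zeta>. F (\<phi> \<zeta>) * \<psi> \<zeta>) has_contour_integral c * r) g"
proof -
  from assms obtain m p where F: "\<And>z. z \<noteq> 0 \<Longrightarrow> F z = poly p z / z ^ m"
    unfolding laurent_def by blast
  define r where "r = (\<Sum>k\<le>degree p. if int k - int m = -1 then coeff p k else 0)"
  show ?thesis
  proof (rule that)
    fix g \<phi> \<psi> c
    assume nz: "\<And>\<zeta>. \<zeta> \<in> path_image g \<Longrightarrow> \<phi> \<zeta> \<noteq> 0"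
      and int: "\<And>k::int. ((\<lambda>\<zeta>. \<phi> \<zeta> powi k * \<psi> \<zeta>) has_contour_integral (if k = -1 then c else 0)) g"
    have "((\<lambda>\<zeta>. \<Sum>k\<le>degree p. coeff p k * (\<phi> \<zeta> powi (int k - int m) * \<psi> \<zeta>)) has_contour_integral
        (\<Sum>k\<le>degree p. coeff p k * (if int k - int m = -1 then c else 0))) g"
      by (intro has_contour_integral_sum has_contour_integral_lmul int) auto
    moreover have "(\<Sum>k\<le>degree p. coeff p k * (if int k - int m = -1 then c else 0)) = c * r"
      unfolding r_def sum_distrib_left by (intro sum.cong) auto
    ultimately have "((\<lambda>\<zeta>. \<Sum>k\<le>degree p. coeff p k * (\<phi> \<zeta> powi (int k - int m) * \<psi> \<zeta>)) has_contour_integral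
        c * r) g" by simp
    then show "((\<lambda>\<zeta>. F (\<phi> \<zeta>) * \<psi> \<zeta>) has_contour_integral c * r) g"
    proof (rule has_contour_integral_eq)
      fix \<zeta> assume "\<zeta> \<in> path_image g"
      with nz have "\<phi> \<zeta> \<noteq> 0" by blast
      then show "(\<Sum>k\<le>degree p. coeff p k * (\<phi> \<zeta> powi (int k - int m) * \<psi> \<zeta>)) = F (\<phi> \<zeta>) * \<psi> \<zeta>"
        by (simp add: F poly_altdef power_int_diff sum_distrib_left sum_divide_distrib mult_ac)
    qed
  qed
qed

text \<open>For \<open>k \<noteq> -1\<close> the integrand has the primitive \<open>\<phi> powi (k + 1) / (k + 1)\<close>.\<close>

lemma loop_integral_powi_deriv:
  assumes g: "valid_path g" "pathfinish g = pathstart g"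
    and der: "\<And>\<zeta>. \<zeta> \<in> path_image g \<Longrightarrow> (\<phi> has_field_derivative \<phi>' \<zeta>) (at \<zeta>)"
    and nz: "\<And>\<zeta>. \<zeta> \<in> path_image g \<Longrightarrow> \<phi> \<zeta> \<noteq> 0" and "k \<noteq> -1"
  shows "((\<lambda>\<zeta>. \<phi> \<zeta> powi k * \<phi>' \<zeta>) has_contour_integral 0) g"
proof -
  have "((\<lambda>\<zeta>. \<phi> \<zeta> powi (k + 1) / of_int (k + 1)) has_field_derivative \<phi> \<zeta> powi k * \<phi>' \<zeta>)
          (at \<zeta> within path_image g)" if "\<zeta> \<in> path_image g" for \<zeta>
  proof -
    have "of_int (k + 1) \<noteq> (0::complex)"
      using \<open>k \<noteq> -1\<close> unfolding of_int_eq_0_iff by simp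
    then show ?thesis
      by (auto intro!: derivative_eq_intros has_field_derivative_at_within [OF der [OF that]] nz [OF that]
          simp del: of_int_add simp: field_simps)
  qed
  from contour_integral_primitive [OF this g(1)] g(2) show ?thesis by simp
qed

lemma unit_circle_integral_powi:
  "((\<lambda>z. z powi k) has_contour_integral (if k = -1 then 2 * of_real pi * \<i> else 0)) unit_circle"
proof (cases "k = -1")
  case True
  then show ?thesis
    using has_contour_integral_winding_number [of unit_circle 0]
    by (simp add: winding_number_circlepath_centre power_int_minus inverse_eq_divide
        path_image_circlepath)
next
  case False
  have "((\<lambda>z. z powi k * 1) has_contour_integral 0) unit_circle"
    by (rule loop_integral_powi_deriv) (use False in auto)
  with False show ?thesis by simp
qed

definition laurent_mat :: "(complex \<Rightarrow> complex^'n^'m) \<Rightarrow> bool"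
  where "laurent_mat X \<longleftrightarrow> (\<forall>i j. laurent (\<lambda>z. X z $ i $ j))"

lemma laurent_mat_mult: "laurent_mat X \<Longrightarrow> laurent_mat Y \<Longrightarrow> laurent_mat (\<lambda>z. X z ** Y z)"
  by (auto simp: laurent_mat_def matrix_mult_nth intro!: laurent_sum laurent_mult)

lemma laurent_mat_mscale: "laurent f \<Longrightarrow> laurent_mat X \<Longrightarrow> laurent_mat (\<lambda>z. f z *\<^sub>m X z)"
  by (auto simp: laurent_mat_def intro!: laurent_mult)

lemma laurent_mat_const: "laurent_mat (\<lambda>_. X)"
  by (simp add: laurent_mat_def laurent_const)

lemma laurent_mat_sum: "(\<And>i. i \<in> I \<Longrightarrow> laurent_mat (X i)) \<Longrightarrow> laurent_mat (\<lambda>z. \<Sum>i\<in>I. X i z)"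
  by (auto simp: laurent_mat_def intro!: laurent_sum)

lemma mpowi_of_nat: "mpowi X (int k) = (((**) X) ^^ k) (mat 1)"
  by (simp add: mpowi_def)

lemma laurent_mat_mpowi:
  assumes "laurent_mat X" "0 \<le> k"
  shows "laurent_mat (\<lambda>z. mpowi (X z) k)"
proof -
  obtain n where k: "k = int n" using assms(2) nonneg_int_cases by blast
  have "laurent_mat (\<lambda>z. (((**) (X z)) ^^ n) (mat 1))"
    by (induction n) (auto intro: laurent_mat_const laurent_mat_mult assms)
  then show ?thesis by (simp add: k mpowi_of_nat)
qed

lemma mpowi_eigenvector:
  assumes "X ** v = c *\<^sub>m v" "0 \<le> k"
  shows "mpowi X k ** v = (c powi k) *\<^sub>m v"
proof -
  obtain n where k: "k = int n" using assms(2) nonneg_int_cases by blast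
  show ?thesis unfolding k mpowi_of_nat
  proof (induction n)
    case (Suc n)
    have pow: "c powi int (Suc n) = c powi int n * c"
      by (simp only: power_int_of_nat power_Suc2)
    have "(((**) X) ^^ Suc n) (mat 1) ** v = X ** ((((**) X) ^^ n) (mat 1) ** v)"
      by (simp add: matrix_mul_assoc)
    also have "\<dots> = (c powi int (Suc n)) *\<^sub>m v"
      unfolding Suc pow by (simp add: mscale_mult_right assms mscale_mscale)
    finally show ?case .
  qed simp
qed

lemma mpowi_left_eigenvector:
  assumes "u ** X = c *\<^sub>m u" "0 \<le> k"
  shows "u ** mpowi X k = (c powi k) *\<^sub>m u"
proof -
  obtain n where k: "k = int n" using assms(2) nonneg_int_cases by blast
  show ?thesis unfolding k mpowi_of_nat
  proof (induction n)
    case (Suc n)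
    have pow: "c powi int (Suc n) = c powi int n * c"
      by (simp only: power_int_of_nat power_Suc2)
    have "u ** (((**) X) ^^ Suc n) (mat 1) = (u ** X) ** (((**) X) ^^ n) (mat 1)"
      by (simp add: matrix_mul_assoc)
    also have "\<dots> = (c powi int (Suc n)) *\<^sub>m u"
      unfolding pow by (simp add: assms mscale_mult_left Suc mscale_mscale mult.commute)
    finally show ?case .
  qed simp
qed

section \<open>Matrices of Laurent polynomials over a two-sheeted cover\<close>

definition has_mcontour_integral ::
    "(complex \<Rightarrow> complex^'n^'m) \<Rightarrow> complex^'n^'m \<Rightarrow> (real \<Rightarrow> complex) \<Rightarrow> bool"
  where "has_mcontour_integral F I g \<longleftrightarrow>
    (\<forall>i j. ((\<lambda>z. F z $ i $ j) has_contour_integral I $ i $ j) g)"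

lemma has_mcontour_integral_unique: "has_mcontour_integral F I g \<Longrightarrow> mcontour_integral g F = I"
  by (simp add: has_mcontour_integral_def mcontour_integral_def vec_eq_iff contour_integral_unique)

lemma has_mcontour_integral_mult_left:
  "has_mcontour_integral F I g \<Longrightarrow> has_mcontour_integral (\<lambda>z. K ** F z) (K ** I) g"
  unfolding has_mcontour_integral_def matrix_mult_nth
  by (auto intro!: has_contour_integral_sum has_contour_integral_lmul)

lemma has_mcontour_integral_spike_finite:
  assumes "has_mcontour_integral F I g" "valid_path g" "finite S"
    and "\<And>z. z \<in> path_image g \<Longrightarrow> z \<notin> S \<Longrightarrow> F' z = F z"
  shows "has_mcontour_integral F' I g"
  unfolding has_mcontour_integral_def
proof (intro allI)
  fix i j
  show "((\<lambda>z. F' z $ i $ j) has_contour_integral I $ i $ j) g"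
  proof (rule has_contour_integral_spike_finite [OF _ assms(2,3)])
    show "((\<lambda>z. F z $ i $ j) has_contour_integral I $ i $ j) g"
      using assms(1) by (simp add: has_mcontour_integral_def)
  qed (simp_all add: assms)
qed


definition eigenvalue2 :: "complex^2^2 \<Rightarrow> complex \<Rightarrow> complex"
  where "eigenvalue2 A y = (A $ 1 $ 1 + A $ 2 $ 2 + y) / 2"

text \<open>In this definition and the next, \<open>y\<close> stands for a square root of the discriminant of the
characteristic polynomial. The scaling of the two vectors is such that their product is a projection.\<close>

definition right_eigenvector2 :: "complex^2^2 \<Rightarrow> complex \<Rightarrow> complex^1^2"
  where "right_eigenvector2 A y =
    vector [vector [1], vector [(y - (A $ 1 $ 1 - A $ 2 $ 2)) / (2 * A $ 1 $ 2)]]"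

definition left_eigenvector2 :: "complex^2^2 \<Rightarrow> complex \<Rightarrow> complex^2^1"
  where "left_eigenvector2 A y =
    vector [vector [(A $ 1 $ 1 - A $ 2 $ 2 + y) / (2 * y), A $ 1 $ 2 / y]]"

text \<open>With eigenvalues \<open>(tr A \<plusminus> y) / 2\<close>, this is \<open>y\<close> times the difference of the two spectral projections.\<close>

definition traceless2 :: "complex^2^2 \<Rightarrow> complex^2^2"
  where "traceless2 A = 2 *\<^sub>m A - (A $ 1 $ 1 + A $ 2 $ 2) *\<^sub>m mat 1"

lemma right_eigenvector2:
  fixes A :: "complex^2^2"
  assumes disc: "y\<^sup>2 = (A $ 1 $ 1 - A $ 2 $ 2)\<^sup>2 + 4 * A $ 1 $ 2 * A $ 2 $ 1" and nz: "A $ 1 $ 2 \<noteq> 0"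
  shows "A ** right_eigenvector2 A y = eigenvalue2 A y *\<^sub>m right_eigenvector2 A y"
proof -
  have "A $ 1 $ 1 + A $ 1 $ 2 * ((y - (A $ 1 $ 1 - A $ 2 $ 2)) / (2 * A $ 1 $ 2)) =
        (A $ 1 $ 1 + A $ 2 $ 2 + y) / 2"
    using nz by (simp add: field_simps)
  moreover have "A $ 2 $ 1 + A $ 2 $ 2 * ((y - (A $ 1 $ 1 - A $ 2 $ 2)) / (2 * A $ 1 $ 2)) =
        (A $ 1 $ 1 + A $ 2 $ 2 + y) / 2 * ((y - (A $ 1 $ 1 - A $ 2 $ 2)) / (2 * A $ 1 $ 2))"
  proof -
    have "4 * A $ 1 $ 2 * A $ 2 $ 1 + 2 * A $ 2 $ 2 * (y - (A $ 1 $ 1 - A $ 2 $ 2)) =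
        (A $ 1 $ 1 + A $ 2 $ 2 + y) * (y - (A $ 1 $ 1 - A $ 2 $ 2))"
      using disc by algebra
    moreover have "A $ 2 $ 1 + A $ 2 $ 2 * ((y - (A $ 1 $ 1 - A $ 2 $ 2)) / (2 * A $ 1 $ 2)) =
        (4 * A $ 1 $ 2 * A $ 2 $ 1 + 2 * A $ 2 $ 2 * (y - (A $ 1 $ 1 - A $ 2 $ 2))) / (4 * A $ 1 $ 2)"
      using nz by (simp add: field_simps)
    ultimately show ?thesis by simp
  qed
  ultimately show ?thesis
    by (simp only: vec_eq_iff forall_1 forall_2 matrix_mult_nth sum_2 mscale_nth vector_1 vector_2
        right_eigenvector2_def eigenvalue2_def mult_1_right simp_thms)
qed

lemma left_eigenvector2:
  fixes A :: "complex^2^2"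
  assumes disc: "y\<^sup>2 = (A $ 1 $ 1 - A $ 2 $ 2)\<^sup>2 + 4 * A $ 1 $ 2 * A $ 2 $ 1" and nz: "y \<noteq> 0"
  shows "left_eigenvector2 A y ** A = eigenvalue2 A y *\<^sub>m left_eigenvector2 A y"
proof -
  have "(A $ 1 $ 1 - A $ 2 $ 2 + y) / (2 * y) * A $ 1 $ 1 + A $ 1 $ 2 / y * A $ 2 $ 1 =
        (A $ 1 $ 1 + A $ 2 $ 2 + y) / 2 * ((A $ 1 $ 1 - A $ 2 $ 2 + y) / (2 * y))"
  proof -
    have "2 * (A $ 1 $ 1 - A $ 2 $ 2 + y) * A $ 1 $ 1 + 4 * A $ 1 $ 2 * A $ 2 $ 1 =
        (A $ 1 $ 1 + A $ 2 $ 2 + y) * (A $ 1 $ 1 - A $ 2 $ 2 + y)"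
      using disc by algebra
    moreover have "(A $ 1 $ 1 - A $ 2 $ 2 + y) / (2 * y) * A $ 1 $ 1 + A $ 1 $ 2 / y * A $ 2 $ 1 =
        (2 * (A $ 1 $ 1 - A $ 2 $ 2 + y) * A $ 1 $ 1 + 4 * A $ 1 $ 2 * A $ 2 $ 1) / (4 * y)"
      using nz by (simp add: field_simps)
    ultimately show ?thesis by simp
  qed
  moreover have "(A $ 1 $ 1 - A $ 2 $ 2 + y) / (2 * y) * A $ 1 $ 2 + A $ 1 $ 2 / y * A $ 2 $ 2 =
        (A $ 1 $ 1 + A $ 2 $ 2 + y) / 2 * (A $ 1 $ 2 / y)"
    using nz by (simp add: field_simps)
  ultimately show ?thesis
    by (simp only: vec_eq_iff forall_1 forall_2 matrix_mult_nth sum_2 mscale_nth vector_1 vector_2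
        left_eigenvector2_def eigenvalue2_def simp_thms)
qed

text \<open>Since \<open>traceless2 A\<close> acts as \<open>y\<close> on one eigenspace and as \<open>-y\<close> on the other, the right-hand side is
the projection onto the first eigenspace along the second.\<close>

lemma eigenprojection2:
  fixes A :: "complex^2^2"
  assumes disc: "y\<^sup>2 = (A $ 1 $ 1 - A $ 2 $ 2)\<^sup>2 + 4 * A $ 1 $ 2 * A $ 2 $ 1"
    and nz: "A $ 1 $ 2 \<noteq> 0" "y \<noteq> 0"
  shows "right_eigenvector2 A y ** left_eigenvector2 A y = (1 / 2) *\<^sub>m (mat 1 + (1 / y) *\<^sub>m traceless2 A)"
proof -
  have "(y - (A $ 1 $ 1 - A $ 2 $ 2)) * (A $ 1 $ 1 - A $ 2 $ 2 + y) = 4 * A $ 1 $ 2 * A $ 2 $ 1"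
    using disc by algebra
  with nz have "(y - (A $ 1 $ 1 - A $ 2 $ 2)) / (2 * A $ 1 $ 2) * ((A $ 1 $ 1 - A $ 2 $ 2 + y) / (2 * y)) =
      1 / 2 * (0 + 1 / y * (2 * A $ 2 $ 1 - (A $ 1 $ 1 + A $ 2 $ 2) * 0))"
    by (simp add: field_simps)
  moreover have "(y - (A $ 1 $ 1 - A $ 2 $ 2)) / (2 * A $ 1 $ 2) * (A $ 1 $ 2 / y) =
      1 / 2 * (1 + 1 / y * (2 * A $ 2 $ 2 - (A $ 1 $ 1 + A $ 2 $ 2) * 1))"
    using nz by (simp add: field_simps)
  moreover have "1 * ((A $ 1 $ 1 - A $ 2 $ 2 + y) / (2 * y)) =
      1 / 2 * (1 + 1 / y * (2 * A $ 1 $ 1 - (A $ 1 $ 1 + A $ 2 $ 2) * 1))"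
    using nz by (simp add: field_simps)
  moreover have "1 * (A $ 1 $ 2 / y) = 1 / 2 * (0 + 1 / y * (2 * A $ 1 $ 2 - (A $ 1 $ 1 + A $ 2 $ 2) * 0))"
    using nz by (simp add: field_simps)
  moreover have "(mat 1 :: complex^2^2) $ 1 $ 1 = 1" "(mat 1 :: complex^2^2) $ 1 $ 2 = 0"
      "(mat 1 :: complex^2^2) $ 2 $ 1 = 0" "(mat 1 :: complex^2^2) $ 2 $ 2 = 1"
    by (simp_all add: mat_def)
  ultimately show ?thesis
    by (simp only: vec_eq_iff forall_2 matrix_mult_nth sum_1 mscale_nth vector_1 vector_2
        vector_add_component vector_minus_component
        right_eigenvector2_def left_eigenvector2_def traceless2_def simp_thms)
qed

text \<open>The functions \<open>\<phi>\<close> and \<open>\<eta>\<close> parametrise the curve of pairs of a point \<open>z\<close> and a square root of the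
discriminant of \<open>A(z)\<close>. The two families of moments are named after their behaviour under the exchange
of the sheets, which fixes \<open>\<phi>\<close> and changes the sign of \<open>\<eta>\<close>. The value \<open>4\<pi>\<i>\<close> is twice the one on
the unit circle, because the contour goes around both preimages of \<open>0\<close>; the factor \<open>1/2\<close> in the spectral
projection compensates for it. The set \<open>S\<close> collects points of the contour at which \<open>\<eta>\<close> may
vanish.\<close>

locale two_sheeted_cover =
  fixes A :: "complex \<Rightarrow> complex^2^2" and g :: "real \<Rightarrow> complex" and \<phi> \<eta> :: "complex \<Rightarrow> complex"
    and S :: "complex set"
  assumes A_laurent: "laurent_mat A"
    and valid: "valid_path g" and finite_S: "finite S"
    and phi_nonzero: "\<And>\<zeta>. \<zeta> \<in> path_image g \<Longrightarrow> \<phi> \<zeta> \<noteq> 0"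
    and eta_nonzero: "\<And>\<zeta>. \<zeta> \<in> path_image g - S \<Longrightarrow> \<eta> \<zeta> \<noteq> 0"
    and offdiag_nonzero: "\<And>\<zeta>. \<zeta> \<in> path_image g - S \<Longrightarrow> A (\<phi> \<zeta>) $ 1 $ 2 \<noteq> 0"
    and curve: "\<And>\<zeta>. \<zeta> \<in> path_image g - S \<Longrightarrow> (\<eta> \<zeta>)\<^sup>2 =
        (A (\<phi> \<zeta>) $ 1 $ 1 - A (\<phi> \<zeta>) $ 2 $ 2)\<^sup>2 + 4 * A (\<phi> \<zeta>) $ 1 $ 2 * A (\<phi> \<zeta>) $ 2 $ 1"
    and even_moments: "\<And>k. ((\<lambda>\<zeta>. \<phi> \<zeta> powi k * deriv \<phi> \<zeta>) has_contour_integral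
        (if k = -1 then 4 * of_real pi * \<i> else 0)) g"
    and odd_moments: "\<And>k. ((\<lambda>\<zeta>. \<phi> \<zeta> powi k * (deriv \<phi> \<zeta> / \<eta> \<zeta>)) has_contour_integral 0) g"
begin

definition "right_vec \<zeta> = right_eigenvector2 (A (\<phi> \<zeta>)) (\<eta> \<zeta>)"
definition "left_vec \<zeta> = left_eigenvector2 (A (\<phi> \<zeta>)) (\<eta> \<zeta>)"
definition "eigval \<zeta> = eigenvalue2 (A (\<phi> \<zeta>)) (\<eta> \<zeta>)"

lemma mpowi_right_vec: "\<zeta> \<in> path_image g - S \<Longrightarrow> 0 \<le> k \<Longrightarrow> mpowi (A (\<phi> \<zeta>)) k ** right_vec \<zeta> = eigval \<zeta> powi k *\<^sub>m right_vec \<zeta>"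
  unfolding right_vec_def eigval_def
  by (intro mpowi_eigenvector right_eigenvector2 curve offdiag_nonzero)

lemma left_vec_mpowi: "\<zeta> \<in> path_image g - S \<Longrightarrow> 0 \<le> k \<Longrightarrow> left_vec \<zeta> ** mpowi (A (\<phi> \<zeta>)) k = eigval \<zeta> powi k *\<^sub>m left_vec \<zeta>"
  unfolding left_vec_def eigval_def
  by (intro mpowi_left_eigenvector left_eigenvector2 curve eta_nonzero)

lemma laurent_traceless: "laurent_mat (\<lambda>z. traceless2 (A z))"
proof -
  have "laurent (\<lambda>z. A z $ i $ j)" for i j
    using A_laurent by (simp add: laurent_mat_def)
  then have "laurent (\<lambda>z. 2 * A z $ i $ j + (- 1) * ((A z $ 1 $ 1 + A z $ 2 $ 2) * mat 1 $ i $ j))" for i j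
    by (intro laurent_add laurent_mult laurent_const) auto
  then show ?thesis
    unfolding laurent_mat_def traceless2_def by simp
qed

text \<open>After inserting the formula for the spectral projection, the integrand on \<open>g\<close> is the average of
\<open>F(\<phi>) \<phi>'\<close> and \<open>G(\<phi>) \<phi>' / \<eta>\<close>, where \<open>F\<close> is an entry of \<open>X Y\<close> and \<open>G\<close> is a Laurent polynomial too.
The even moments turn the first part into the integral over the unit circle and the odd moments
annihilate the second.\<close>

lemma transfer_integral:
  fixes X :: "complex \<Rightarrow> complex^2^'p" and Y :: "complex \<Rightarrow> complex^'q^2"
  assumes X: "laurent_mat X" and Y: "laurent_mat Y"
  obtains I where "has_mcontour_integral (\<lambda>z. X z ** Y z) I unit_circle"
    "has_mcontour_integral (\<lambda>\<zeta>. deriv \<phi> \<zeta> *\<^sub>m (X (\<phi> \<zeta>) ** right_vec \<zeta> ** left_vec \<zeta> ** Y (\<phi> \<zeta>))) I g"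
proof -
  have "\<exists>I. ((\<lambda>z. (X z ** Y z) $ i $ j) has_contour_integral I) unit_circle \<and>
      ((\<lambda>\<zeta>. deriv \<phi> \<zeta> * (X (\<phi> \<zeta>) ** right_vec \<zeta> ** left_vec \<zeta> ** Y (\<phi> \<zeta>)) $ i $ j) has_contour_integral I) g" for i j
  proof -
    define F where "F z = (X z ** Y z) $ i $ j" for z
    define G where "G z = (X z ** traceless2 (A z) ** Y z) $ i $ j" for z
    have F: "laurent F"
      using laurent_mat_mult [OF X Y] by (simp add: F_def [abs_def] laurent_mat_def)
    have G: "laurent G"
      using laurent_mat_mult [OF laurent_mat_mult [OF X laurent_traceless] Y]
      by (simp add: G_def [abs_def] laurent_mat_def)
    obtain r where r: "\<And>g \<phi> \<psi> c. (\<And>\<zeta>. \<zeta> \<in> path_image g \<Longrightarrow> \<phi> \<zeta> \<noteq> 0) \<Longrightarrow>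
       (\<And>k::int. ((\<lambda>\<zeta>. \<phi> \<zeta> powi k * \<psi> \<zeta>) has_contour_integral (if k = -1 then c else 0)) g) \<Longrightarrow>
       ((\<lambda>\<zeta>. F (\<phi> \<zeta>) * \<psi> \<zeta>) has_contour_integral c * r) g"
      using laurent_residue [OF F] by blast
    obtain s where s: "\<And>g \<phi> \<psi> c. (\<And>\<zeta>. \<zeta> \<in> path_image g \<Longrightarrow> \<phi> \<zeta> \<noteq> 0) \<Longrightarrow>
       (\<And>k::int. ((\<lambda>\<zeta>. \<phi> \<zeta> powi k * \<psi> \<zeta>) has_contour_integral (if k = -1 then c else 0)) g) \<Longrightarrow>
       ((\<lambda>\<zeta>. G (\<phi> \<zeta>) * \<psi> \<zeta>) has_contour_integral c * s) g"
      using laurent_residue [OF G] by blast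
    have "((\<lambda>z. F z * 1) has_contour_integral (2 * of_real pi * \<i>) * r) unit_circle"
    proof (rule r)
      show "((\<lambda>z. z powi k * 1) has_contour_integral (if k = -1 then 2 * of_real pi * \<i> else 0)) unit_circle" for k
        using unit_circle_integral_powi by simp
    qed (auto simp: path_image_circlepath)
    then have unit: "(F has_contour_integral (2 * of_real pi * \<i>) * r) unit_circle"
      by simp
    have even: "((\<lambda>\<zeta>. F (\<phi> \<zeta>) * deriv \<phi> \<zeta>) has_contour_integral (4 * of_real pi * \<i>) * r) g"
      by (rule r [OF phi_nonzero even_moments])
    have "((\<lambda>\<zeta>. G (\<phi> \<zeta>) * (deriv \<phi> \<zeta> / \<eta> \<zeta>)) has_contour_integral 0 * s) g"
    proof (rule s [OF phi_nonzero])
      show "((\<lambda>\<zeta>. \<phi> \<zeta> powi k * (deriv \<phi> \<zeta> / \<eta> \<zeta>)) has_contour_integral (if k = -1 then 0 else 0)) g" for k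
        using odd_moments by simp
    qed
    from has_contour_integral_div [OF has_contour_integral_add [OF even this], of 2]
    have "((\<lambda>\<zeta>. (F (\<phi> \<zeta>) * deriv \<phi> \<zeta> + G (\<phi> \<zeta>) * (deriv \<phi> \<zeta> / \<eta> \<zeta>)) / 2) has_contour_integral
        ((4 * of_real pi * \<i>) * r + 0 * s) / 2) g" .
    moreover have "((4 * of_real pi * \<i>) * r + 0 * s) / 2 = (2 * of_real pi * \<i>) * r"
      by simp
    ultimately
    have "((\<lambda>\<zeta>. (F (\<phi> \<zeta>) * deriv \<phi> \<zeta> + G (\<phi> \<zeta>) * (deriv \<phi> \<zeta> / \<eta> \<zeta>)) / 2) has_contour_integral
        (2 * of_real pi * \<i>) * r) g"
      by (simp only:)
    then have "((\<lambda>\<zeta>. deriv \<phi> \<zeta> * (X (\<phi> \<zeta>) ** right_vec \<zeta> ** left_vec \<zeta> ** Y (\<phi> \<zeta>)) $ i $ j) has_contour_integral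
        (2 * of_real pi * \<i>) * r) g"
    proof (rule has_contour_integral_spike_finite [OF _ valid finite_S])
      fix \<zeta> assume "\<zeta> \<in> path_image g" "\<zeta> \<notin> S"
      then have *: "\<zeta> \<in> path_image g - S" by blast
      have "X (\<phi> \<zeta>) ** right_vec \<zeta> ** left_vec \<zeta> ** Y (\<phi> \<zeta>) = X (\<phi> \<zeta>) ** (right_vec \<zeta> ** left_vec \<zeta>) ** Y (\<phi> \<zeta>)"
        by (simp add: matrix_mul_assoc)
      also have "right_vec \<zeta> ** left_vec \<zeta> = (1 / 2) *\<^sub>m (mat 1 + (1 / \<eta> \<zeta>) *\<^sub>m traceless2 (A (\<phi> \<zeta>)))"
        unfolding right_vec_def left_vec_def
        by (intro eigenprojection2 curve offdiag_nonzero eta_nonzero *)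
      also have "X (\<phi> \<zeta>) ** \<dots> ** Y (\<phi> \<zeta>) = (1 / 2) *\<^sub>m (X (\<phi> \<zeta>) ** Y (\<phi> \<zeta>) +
          (1 / \<eta> \<zeta>) *\<^sub>m (X (\<phi> \<zeta>) ** traceless2 (A (\<phi> \<zeta>)) ** Y (\<phi> \<zeta>)))"
        by (simp add: mscale_mult_left mscale_mult_right matrix_add_ldistrib matrix_mult_add_left)
      finally show "deriv \<phi> \<zeta> * (X (\<phi> \<zeta>) ** right_vec \<zeta> ** left_vec \<zeta> ** Y (\<phi> \<zeta>)) $ i $ j =
          (F (\<phi> \<zeta>) * deriv \<phi> \<zeta> + G (\<phi> \<zeta>) * (deriv \<phi> \<zeta> / \<eta> \<zeta>)) / 2"
        by (simp add: F_def G_def algebra_simps)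
    qed
    then show ?thesis using unit unfolding F_def by blast
  qed
  then have "((\<lambda>z. (X z ** Y z) $ i $ j) has_contour_integral
        contour_integral unit_circle (\<lambda>z. (X z ** Y z) $ i $ j)) unit_circle \<and>
      ((\<lambda>\<zeta>. deriv \<phi> \<zeta> * (X (\<phi> \<zeta>) ** right_vec \<zeta> ** left_vec \<zeta> ** Y (\<phi> \<zeta>)) $ i $ j) has_contour_integral
        contour_integral unit_circle (\<lambda>z. (X z ** Y z) $ i $ j)) g" for i j
    using contour_integral_unique by blast
  then show ?thesis
    by (intro that [of "\<chi> i j. contour_integral unit_circle (\<lambda>z. (X z ** Y z) $ i $ j)"])
      (simp_all add: has_mcontour_integral_def)
qed

end

lemma laurent_contour_integrable:
  assumes "laurent F"
  shows "F contour_integrable_on unit_circle"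
proof -
  obtain r where r: "\<And>g \<phi> \<psi> c. (\<And>\<zeta>. \<zeta> \<in> path_image g \<Longrightarrow> \<phi> \<zeta> \<noteq> 0) \<Longrightarrow>
       (\<And>k::int. ((\<lambda>\<zeta>. \<phi> \<zeta> powi k * \<psi> \<zeta>) has_contour_integral (if k = -1 then c else 0)) g) \<Longrightarrow>
       ((\<lambda>\<zeta>. F (\<phi> \<zeta>) * \<psi> \<zeta>) has_contour_integral c * r) g"
    using laurent_residue [OF assms] by blast
  have "((\<lambda>z. F z * 1) has_contour_integral (2 * of_real pi * \<i>) * r) unit_circle"
  proof (rule r)
    show "((\<lambda>z. z powi k * 1) has_contour_integral (if k = -1 then 2 * of_real pi * \<i> else 0)) unit_circle" for k
      using unit_circle_integral_powi by simp
  qed (auto simp: path_image_circlepath)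
  then show ?thesis unfolding contour_integrable_on_def by auto
qed

section \<open>The scalar Christoffel--Darboux kernel\<close>

lemma poly_eq_sum_lessThan:
  fixes p :: "complex poly"
  assumes "degree p < N"
  shows "poly p z = (\<Sum>m<N. coeff p m * z ^ m)"
  unfolding poly_altdef using assms
  by (intro sum.mono_neutral_left) (auto simp: coeff_eq_0)

lemma matrix_mult_1x1: "(B :: complex^1^'p) ** (M :: complex^1^1) ** (C :: complex^'q^1) = M $ 1 $ 1 *\<^sub>m (B ** C)"
  by (simp add: vec_eq_iff matrix_mult_nth sum_1 mult_ac)

lemma laurent_trans_mat: "laurent_mat (trans_mat a b l)"
  unfolding laurent_mat_def forall_2 trans_mat_def
  by (auto intro: laurent_const laurent_mult laurent_id)

lemma laurent_period_mat: "laurent_mat (period_mat a b)"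
  unfolding period_mat_def [abs_def] by (intro laurent_mat_mult laurent_trans_mat)

lemma laurent_matrix_weight: "laurent_mat (matrix_weight a b L M N)"
  unfolding matrix_weight_def [abs_def]
  by (intro laurent_mat_mscale laurent_powi laurent_mat_mpowi laurent_period_mat) simp

lemma matrix_weight_moments_integrable:
  "(\<lambda>w. w ^ k * matrix_weight a b L M N w $ i $ j) contour_integrable_on unit_circle"
proof (intro laurent_contour_integrable laurent_mult laurent_power)
  show "laurent (\<lambda>w. matrix_weight a b L M N w $ i $ j)"
    using laurent_matrix_weight by (simp add: laurent_mat_def)
qed

text \<open>The functions \<open>ee\<close>, \<open>eh\<close>, \<open>lam\<close> need to agree with the eigenvectors and the eigenvalue only away from
\<open>S\<close>. The polynomials \<open>right_poly k i\<close> and \<open>left_poly k i\<close> are the images, after clearing poles by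
\<open>h\<close> and \<open>hh\<close>, of the row and of the column whose only nonzero entry is \<open>z\<^sup>k\<close> at position \<open>i\<close>. The bound
\<open>N\<close> on their degrees equals the number of pairs \<open>(k, i)\<close>.\<close>

locale scalar_reduction = two_sheeted_cover "period_mat a b" g \<phi> \<eta> S
  for a b :: weights and g \<phi> \<eta> S +
  fixes L M N :: nat and h hh :: "complex \<Rightarrow> complex"
    and ee :: "complex \<Rightarrow> complex^1^2" and eh :: "complex \<Rightarrow> complex^2^1" and lam :: "complex \<Rightarrow> complex"
    and right_poly left_poly :: "nat \<Rightarrow> 2 \<Rightarrow> complex poly"
  assumes N_even: "even N"
    and h_nonzero: "\<And>\<zeta>. \<zeta> \<in> path_image g - S \<Longrightarrow> h \<zeta> \<noteq> 0"
    and hh_nonzero: "\<And>\<zeta>. \<zeta> \<in> path_image g - S \<Longrightarrow> hh \<zeta> \<noteq> 0"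
    and ee: "\<And>\<zeta>. \<zeta> \<in> path_image g - S \<Longrightarrow> ee \<zeta> = right_eigenvector2 (period_mat a b (\<phi> \<zeta>)) (\<eta> \<zeta>)"
    and eh: "\<And>\<zeta>. \<zeta> \<in> path_image g - S \<Longrightarrow> eh \<zeta> = left_eigenvector2 (period_mat a b (\<phi> \<zeta>)) (\<eta> \<zeta>)"
    and lam: "\<And>\<zeta>. \<zeta> \<in> path_image g - S \<Longrightarrow> lam \<zeta> = eigenvalue2 (period_mat a b (\<phi> \<zeta>)) (\<eta> \<zeta>)"
    and degree_right_poly: "\<And>k i. k < N div 2 \<Longrightarrow> degree (right_poly k i) < N"
    and degree_left_poly: "\<And>k i. k < N div 2 \<Longrightarrow> degree (left_poly k i) < N"
    and poly_right_poly: "\<And>k i \<zeta>. k < N div 2 \<Longrightarrow> \<zeta> \<in> path_image g - S \<Longrightarrow>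
        poly (right_poly k i) \<zeta> = h \<zeta> * \<phi> \<zeta> ^ k * ee \<zeta> $ i $ 1"
    and poly_left_poly: "\<And>k i \<zeta>. k < N div 2 \<Longrightarrow> \<zeta> \<in> path_image g - S \<Longrightarrow>
        poly (left_poly k i) \<zeta> = hh \<zeta> * \<phi> \<zeta> ^ k * eh \<zeta> $ 1 $ i"
    and weight_integrable: "\<And>k. (\<lambda>\<omega>. \<omega> ^ k * scalar_weight L M N \<phi> h hh lam \<omega>) contour_integrable_on g"
    and CD_exists: "\<exists>R. is_CD_kernel unit_circle (matrix_weight a b L M N) (N div 2) R"
begin

abbreviation "n \<equiv> N div 2"
abbreviation "mweight \<equiv> matrix_weight a b L M N"
abbreviation "sweight \<equiv> scalar_weight L M N \<phi> h hh lam"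

definition "matrix_CD = CD_kernel unit_circle mweight n"

lemma is_CD_kernel_matrix_CD: "is_CD_kernel unit_circle mweight n matrix_CD"
proof -
  obtain R where R: "is_CD_kernel unit_circle mweight n R" using CD_exists by blast
  moreover have "R' = R" if "is_CD_kernel unit_circle mweight n R'" for R'
    using CD_kernel_unique [OF that R matrix_weight_moments_integrable] .
  ultimately show ?thesis
    unfolding matrix_CD_def CD_kernel_def by (rule theI)
qed

text \<open>A choice of coefficients, since the kernel is only known to be given by some coefficients.\<close>

definition "CD_coeff = (SOME C. \<forall>w z. matrix_CD w z = (\<Sum>k<n. \<Sum>l<n. (w ^ k * z ^ l) *\<^sub>m C k l))"

lemma matrix_CD_eq: "matrix_CD w z = (\<Sum>k<n. \<Sum>l<n. (w ^ k * z ^ l) *\<^sub>m CD_coeff k l)"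
proof -
  have "\<exists>C. \<forall>w z. matrix_CD w z = (\<Sum>k<n. \<Sum>l<n. (w ^ k * z ^ l) *\<^sub>m C k l)"
    using is_CD_kernel_matrix_CD unfolding is_CD_kernel_def bivariate_matrix_poly_def by blast
  from someI_ex [OF this] show ?thesis unfolding CD_coeff_def by blast
qed

text \<open>\<open>row_image x\<close> is the scalar polynomial belonging to the row with coefficients \<open>x\<close>, and
\<open>kernel_column l j\<close> the one belonging to the coefficient of \<open>z\<^sup>l\<close> in column \<open>j\<close> of the matrix kernel.\<close>

definition "row_image x \<omega> = (\<Sum>k<n. \<Sum>i\<in>UNIV. x k i * poly (right_poly k i) \<omega>)"
definition "kernel_column l j \<omega> = (\<Sum>m<n. \<Sum>s\<in>UNIV. CD_coeff m l $ s $ j * poly (left_poly m s) \<omega>)"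

text \<open>The pairing of \<open>p\<close> and \<open>q\<close> by the matrix weight on the unit circle is transferred to \<open>g\<close>. There the
weight, applied to the eigenvector, becomes the factor \<open>lam ^ (L/2) / \<phi> ^ ((M+N)/2)\<close>, and the product
\<open>p(\<phi>) e ehat q(\<phi>)\<close> splits into the two scalar polynomials divided by \<open>h hh\<close>.\<close>

lemma scalar_reproduction:
  assumes l: "l < n"
  shows "((\<lambda>\<omega>. row_image x \<omega> * sweight \<omega> * kernel_column l j \<omega>) has_contour_integral x l j) g"
proof -
  define p :: "complex \<Rightarrow> complex^2^1" where "p z = (\<chi> i' i. \<Sum>k<n. x k i * z ^ k)" for z
  define q :: "complex \<Rightarrow> complex^1^2" where "q z = (\<chi> s s'. \<Sum>m<n. z ^ m * CD_coeff m l $ s $ j)" for z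
  have p: "laurent_mat p"
    unfolding laurent_mat_def p_def by (auto intro!: laurent_sum laurent_mult laurent_const laurent_power)
  have q: "laurent_mat q"
    unfolding laurent_mat_def q_def by (auto intro!: laurent_sum laurent_mult laurent_const laurent_power)
  obtain I where I: "has_mcontour_integral (\<lambda>z. (p z ** mweight z) ** q z) I unit_circle"
    and I': "has_mcontour_integral (\<lambda>\<zeta>. deriv \<phi> \<zeta> *\<^sub>m ((p (\<phi> \<zeta>) ** mweight (\<phi> \<zeta>)) ** right_vec \<zeta> ** left_vec \<zeta> ** q (\<phi> \<zeta>))) I g"
    using transfer_integral [OF laurent_mat_mult [OF p laurent_matrix_weight] q] by blast
  have "((\<lambda>z. ((p z ** mweight z) ** q z) $ 1 $ 1) has_contour_integral x l j) unit_circle"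
  proof -
    have "((p z ** mweight z) ** q z) $ 1 $ 1 = (\<Sum>i\<in>UNIV. (\<Sum>k<n. x k i * z ^ k) *
             (\<Sum>s\<in>UNIV. mweight z $ i $ s * (\<Sum>m<n. z ^ m * CD_coeff m l $ s $ j)))" for z
      unfolding matrix_mul_assoc [symmetric] by (simp add: matrix_mult_nth p_def q_def)
    then show ?thesis
      using CD_kernel_reproduces_row [OF is_CD_kernel_matrix_CD matrix_CD_eq matrix_weight_moments_integrable l]
      by simp
  qed
  moreover have "((\<lambda>z. ((p z ** mweight z) ** q z) $ 1 $ 1) has_contour_integral I $ 1 $ 1) unit_circle"
    using I unfolding has_mcontour_integral_def by (elim allE)
  ultimately have "x l j = I $ 1 $ 1"
    by (rule has_contour_integral_unique)
  moreover have "((\<lambda>\<zeta>. deriv \<phi> \<zeta> * ((p (\<phi> \<zeta>) ** mweight (\<phi> \<zeta>)) ** right_vec \<zeta> ** left_vec \<zeta> ** q (\<phi> \<zeta>)) $ 1 $ 1)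
      has_contour_integral I $ 1 $ 1) g"
    using I' unfolding has_mcontour_integral_def mscale_nth by (elim allE)
  ultimately have "((\<lambda>\<zeta>. deriv \<phi> \<zeta> * ((p (\<phi> \<zeta>) ** mweight (\<phi> \<zeta>)) ** right_vec \<zeta> ** left_vec \<zeta> ** q (\<phi> \<zeta>)) $ 1 $ 1)
      has_contour_integral x l j) g"
    by simp
  then show ?thesis
  proof (rule has_contour_integral_spike_finite [OF _ valid finite_S])
    fix \<omega> assume "\<omega> \<in> path_image g" "\<omega> \<notin> S"
    then have \<omega>: "\<omega> \<in> path_image g - S" by blast
    have "row_image x \<omega> = (\<Sum>k<n. \<Sum>i\<in>UNIV. h \<omega> * (x k i * \<phi> \<omega> ^ k * right_vec \<omega> $ i $ 1))"
      unfolding row_image_def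
      by (intro sum.cong refl) (simp add: poly_right_poly [OF _ \<omega>] ee [OF \<omega>] right_vec_def mult_ac)
    also have "\<dots> = h \<omega> * (p (\<phi> \<omega>) ** right_vec \<omega>) $ 1 $ 1"
      by (subst sum.swap) (simp add: p_def matrix_mult_nth sum_distrib_left sum_distrib_right mult_ac)
    finally have row_image: "row_image x \<omega> = h \<omega> * (p (\<phi> \<omega>) ** right_vec \<omega>) $ 1 $ 1" .
    have "kernel_column l j \<omega> = (\<Sum>m<n. \<Sum>s\<in>UNIV. hh \<omega> * (left_vec \<omega> $ 1 $ s * (\<phi> \<omega> ^ m * CD_coeff m l $ s $ j)))"
      unfolding kernel_column_def
      by (intro sum.cong refl) (simp add: poly_left_poly [OF _ \<omega>] eh [OF \<omega>] left_vec_def mult_ac)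
    also have "\<dots> = hh \<omega> * (left_vec \<omega> ** q (\<phi> \<omega>)) $ 1 $ 1"
      by (subst sum.swap) (simp add: q_def matrix_mult_nth sum_distrib_left mult_ac)
    finally have kernel_column: "kernel_column l j \<omega> = hh \<omega> * (left_vec \<omega> ** q (\<phi> \<omega>)) $ 1 $ 1" .
    have "mweight (\<phi> \<omega>) ** right_vec \<omega> = (\<phi> \<omega> powi (- int ((M + N) div 2)) * lam \<omega> ^ (L div 2)) *\<^sub>m right_vec \<omega>"
      unfolding matrix_weight_def mscale_mult_left
      by (simp add: mpowi_right_vec [OF \<omega>] mscale_mscale lam [OF \<omega>] eigval_def)
    then have "(p (\<phi> \<omega>) ** mweight (\<phi> \<omega>)) ** right_vec \<omega> ** left_vec \<omega> ** q (\<phi> \<omega>) =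
        (\<phi> \<omega> powi (- int ((M + N) div 2)) * lam \<omega> ^ (L div 2)) *\<^sub>m
          ((p (\<phi> \<omega>) ** right_vec \<omega>) ** (left_vec \<omega> ** q (\<phi> \<omega>)))"
      by (simp add: matrix_mul_assoc [symmetric] mscale_mult_left mscale_mult_right)
    then show "row_image x \<omega> * sweight \<omega> * kernel_column l j \<omega> =
        deriv \<phi> \<omega> * ((p (\<phi> \<omega>) ** mweight (\<phi> \<omega>)) ** right_vec \<omega> ** left_vec \<omega> ** q (\<phi> \<omega>)) $ 1 $ 1"
      using h_nonzero [OF \<omega>] hh_nonzero [OF \<omega>] phi_nonzero [of \<omega>] \<omega>
      by (simp add: row_image kernel_column matrix_mult_nth [of "p (\<phi> \<omega>) ** right_vec \<omega>"] scalar_weight_def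
          power_int_minus field_simps)
  qed
qed

lemma row_image_eq_sum: "row_image x \<omega> = (\<Sum>m<N. (\<Sum>(k,i)\<in>{..<n}\<times>UNIV. coeff (right_poly k i) m * x k i) * \<omega> ^ m)"
proof -
  have "row_image x \<omega> = (\<Sum>(k,i)\<in>{..<n}\<times>UNIV. \<Sum>m<N. coeff (right_poly k i) m * x k i * \<omega> ^ m)"
    unfolding row_image_def sum.cartesian_product
    by (intro sum.cong refl)
      (auto simp: poly_eq_sum_lessThan [OF degree_right_poly] sum_distrib_left mult_ac)
  also have "\<dots> = (\<Sum>m<N. (\<Sum>(k,i)\<in>{..<n}\<times>UNIV. coeff (right_poly k i) m * x k i) * \<omega> ^ m)"
    unfolding case_prod_beta sum_distrib_right by (rule sum.swap)
  finally show ?thesis .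
qed

text \<open>If \<open>row_image x\<close> vanishes, so do all the pairings in \<open>scalar_reproduction\<close>, that is, all \<open>x l j\<close>.
Source and target of the injective map both have dimension \<open>N\<close>.\<close>

lemma row_image_surjective: "\<exists>x. \<forall>\<omega>. row_image x \<omega> = (\<Sum>m<N. c m * \<omega> ^ m)"
proof -
  have "\<exists>x. \<forall>m\<in>{..<N}. (\<Sum>q\<in>{..<n}\<times>UNIV. coeff (right_poly (fst q) (snd q)) m * x q) = c m"
  proof (rule square_system_solvable)
    show "card {..<N} = card ({..<n} \<times> (UNIV :: 2 set))"
      using N_even by (simp add: card_cartesian_product)
  next
    fix x :: "nat \<times> 2 \<Rightarrow> complex"
    assume x: "\<forall>m\<in>{..<N}. (\<Sum>q\<in>{..<n}\<times>UNIV. coeff (right_poly (fst q) (snd q)) m * x q) = 0"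
    define x' where "x' k i = x (k, i)" for k i
    have "row_image x' \<omega> = 0" for \<omega>
      unfolding row_image_eq_sum using x by (simp add: x'_def case_prod_beta)
    then have "((\<lambda>_. 0) has_contour_integral x' l j) g" if "l < n" for l j
      using scalar_reproduction [OF that, of x' j] by simp
    then have "x' l j = 0" if "l < n" for l j
      using that has_contour_integral_0 by (metis contour_integral_unique)
    then show "\<forall>q\<in>{..<n} \<times> UNIV. x q = 0"
      by (auto simp: x'_def)
  qed auto
  then obtain x where x: "\<And>m. m < N \<Longrightarrow> (\<Sum>q\<in>{..<n}\<times>UNIV. coeff (right_poly (fst q) (snd q)) m * x q) = c m"
    by auto
  have "row_image (\<lambda>k i. x (k, i)) \<omega> = (\<Sum>m<N. c m * \<omega> ^ m)" for \<omega>
    unfolding row_image_eq_sum using x by (simp add: case_prod_beta)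
  then show ?thesis by blast
qed

definition "scalar_CD \<omega> \<zeta> = (\<Sum>l<n. \<Sum>j\<in>UNIV. kernel_column l j \<omega> * poly (right_poly l j) \<zeta>)"

lemma bivariate_scalar_CD: "bivariate_matrix_poly N (\<lambda>\<omega> \<zeta>. mat (scalar_CD \<omega> \<zeta>) :: complex^1^1)"
  unfolding bivariate_matrix_poly_def
proof (intro exI allI)
  fix \<omega> \<zeta>
  define d where "d l j k = (\<Sum>m<n. \<Sum>s\<in>UNIV. CD_coeff m l $ s $ j * coeff (left_poly m s) k)" for l j k
  define D where "D k k' = (\<Sum>l<n. \<Sum>j\<in>UNIV. d l j k * coeff (right_poly l j) k')" for k k'
  have kernel_column: "kernel_column l j \<omega> = (\<Sum>k<N. d l j k * \<omega> ^ k)" for l j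
  proof -
    have "kernel_column l j \<omega> = (\<Sum>m<n. \<Sum>s\<in>UNIV. \<Sum>k<N. CD_coeff m l $ s $ j * coeff (left_poly m s) k * \<omega> ^ k)"
      unfolding kernel_column_def by (intro sum.cong refl)
        (simp add: poly_eq_sum_lessThan [OF degree_left_poly] sum_distrib_left mult_ac)
    also have "\<dots> = (\<Sum>m<n. \<Sum>k<N. \<Sum>s\<in>UNIV. CD_coeff m l $ s $ j * coeff (left_poly m s) k * \<omega> ^ k)"
      by (rule sum.cong [OF refl], rule sum.swap)
    also have "\<dots> = (\<Sum>k<N. d l j k * \<omega> ^ k)"
      unfolding d_def sum_distrib_right by (rule sum.swap)
    finally show ?thesis .
  qed
  have "scalar_CD \<omega> \<zeta> = (\<Sum>l<n. \<Sum>j\<in>UNIV. \<Sum>k<N. \<Sum>k'<N. d l j k * coeff (right_poly l j) k' * (\<omega> ^ k * \<zeta> ^ k'))"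
    unfolding scalar_CD_def kernel_column by (intro sum.cong refl)
      (simp add: poly_eq_sum_lessThan [OF degree_right_poly] sum_product mult_ac)
  also have "\<dots> = (\<Sum>l<n. \<Sum>k<N. \<Sum>k'<N. \<Sum>j\<in>UNIV. d l j k * coeff (right_poly l j) k' * (\<omega> ^ k * \<zeta> ^ k'))"
    by (rule sum.cong [OF refl], rule trans [OF sum.swap], rule sum.cong [OF refl], rule sum.swap)
  also have "\<dots> = (\<Sum>k<N. \<Sum>k'<N. \<Sum>l<n. \<Sum>j\<in>UNIV. d l j k * coeff (right_poly l j) k' * (\<omega> ^ k * \<zeta> ^ k'))"
    by (rule trans [OF sum.swap], rule sum.cong [OF refl], rule sum.swap)
  also have "\<dots> = (\<Sum>k<N. \<Sum>k'<N. (\<omega> ^ k * \<zeta> ^ k') * D k k')"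
    unfolding D_def by (simp add: sum_distrib_left mult_ac)
  finally have *: "scalar_CD \<omega> \<zeta> = (\<Sum>k<N. \<Sum>k'<N. (\<omega> ^ k * \<zeta> ^ k') * D k k')" .
  show "(mat (scalar_CD \<omega> \<zeta>) :: complex^1^1) = (\<Sum>k<N. \<Sum>k'<N. (\<omega> ^ k * \<zeta> ^ k') *\<^sub>m
      mat ((\<Sum>l<n. \<Sum>j\<in>UNIV. (\<Sum>m<n. \<Sum>s\<in>UNIV. CD_coeff m l $ s $ j * coeff (left_poly m s) k) * coeff (right_poly l j) k')))"
    unfolding * D_def d_def by (simp add: vec_eq_iff mat_def)
qed

text \<open>By \<open>row_image_surjective\<close> it suffices to reproduce polynomials of the form \<open>row_image x\<close>, and this is
the linear combination of the identities \<open>scalar_reproduction\<close> with coefficients \<open>right_poly l j\<close>.\<close>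

lemma is_scalar_CD_kernel_scalar_CD: "is_scalar_CD_kernel g sweight N scalar_CD"
  unfolding is_scalar_CD_kernel_def is_CD_kernel_def
proof (intro conjI bivariate_scalar_CD allI impI)
  fix P :: "complex \<Rightarrow> complex^1^1" and z and i j :: 1
  assume "matrix_poly N P"
  then obtain c where c: "\<And>z. P z = (\<Sum>k<N. z ^ k *\<^sub>m c k)"
    unfolding matrix_poly_def by blast
  obtain x where "\<And>\<omega>. row_image x \<omega> = (\<Sum>m<N. c m $ 1 $ 1 * \<omega> ^ m)"
    using row_image_surjective [of "\<lambda>m. c m $ 1 $ 1"] by blast
  then have P: "P \<omega> $ 1 $ 1 = row_image x \<omega>" for \<omega>
    by (simp add: c mult.commute)
  have "((\<lambda>\<omega>. \<Sum>l<n. \<Sum>j\<in>UNIV. (row_image x \<omega> * sweight \<omega> * kernel_column l j \<omega>) * poly (right_poly l j) z) has_contour_integral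
      (\<Sum>l<n. \<Sum>j\<in>UNIV. x l j * poly (right_poly l j) z)) g"
    by (intro has_contour_integral_sum has_contour_integral_rmul scalar_reproduction) auto
  moreover have "(\<Sum>l<n. \<Sum>j\<in>UNIV. x l j * poly (right_poly l j) z) = P z $ 1 $ 1"
    by (simp add: P row_image_def)
  moreover have "(\<Sum>l<n. \<Sum>j\<in>UNIV. (row_image x \<omega> * sweight \<omega> * kernel_column l j \<omega>) * poly (right_poly l j) z) =
      (P \<omega> ** mat (sweight \<omega>) ** (mat (scalar_CD \<omega> z) :: complex^1^1)) $ 1 $ 1" for \<omega>
    by (simp add: matrix_mult_nth sum_1 mat_def P scalar_CD_def sum_distrib_left mult.assoc)
  ultimately have "((\<lambda>\<omega>. (P \<omega> ** mat (sweight \<omega>) ** (mat (scalar_CD \<omega> z) :: complex^1^1)) $ 1 $ 1)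
      has_contour_integral P z $ 1 $ 1) g"
    by simp
  moreover have "i = 1" and "j = 1" by auto
  ultimately show "((\<lambda>w. (P w ** mat (sweight w) ** mat (scalar_CD w z)) $ i $ j) has_contour_integral P z $ i $ j) g"
    by (simp only:)
qed

lemma scalar_CD_kernel_unique:
  assumes "is_scalar_CD_kernel g sweight N R"
  shows "R = scalar_CD"
proof -
  have "(\<lambda>w z. mat (R w z) :: complex^1^1) = (\<lambda>w z. mat (scalar_CD w z))"
  proof (rule CD_kernel_unique)
    show "is_CD_kernel g (\<lambda>w. mat (sweight w) :: complex^1^1) N (\<lambda>w z. mat (R w z))"
      using assms by (simp add: is_scalar_CD_kernel_def)
    show "is_CD_kernel g (\<lambda>w. mat (sweight w) :: complex^1^1) N (\<lambda>w z. mat (scalar_CD w z))"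
      using is_scalar_CD_kernel_scalar_CD by (simp add: is_scalar_CD_kernel_def)
    show "(\<lambda>w. w ^ k * (mat (sweight w) :: complex^1^1) $ i $ j) contour_integrable_on g" for k i j
    proof -
      have "i = 1" and "j = 1" by auto
      then have "i = j" by (simp only:)
      then show ?thesis using weight_integrable by (simp add: mat_def)
    qed
  qed
  then have "(mat (R w z) :: complex^1^1) $ 1 $ 1 = (mat (scalar_CD w z) :: complex^1^1) $ 1 $ 1" for w z
    by (simp only: fun_eq_iff)
  then show ?thesis by (simp add: mat_def fun_eq_iff)
qed

lemma ex1_scalar_CD_kernel: "\<exists>!R. is_scalar_CD_kernel g sweight N R"
  using is_scalar_CD_kernel_scalar_CD scalar_CD_kernel_unique by blast

lemma scalar_CD_kernel_eq: "scalar_CD_kernel g sweight N = scalar_CD"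
  unfolding scalar_CD_kernel_def
  using is_scalar_CD_kernel_scalar_CD scalar_CD_kernel_unique by (rule the_equality)

text \<open>The closed form is available only away from \<open>S\<close>, where dividing by \<open>h\<close> and \<open>hh\<close> recovers the
eigenvectors; this is why \<open>scalar_CD\<close> itself is built from polynomials.\<close>

lemma scalar_CD_eq:
  assumes \<omega>: "\<omega> \<in> path_image g - S" and \<zeta>: "\<zeta> \<in> path_image g - S"
  shows "scalar_CD \<omega> \<zeta> = hh \<omega> * h \<zeta> * (left_vec \<omega> ** matrix_CD (\<phi> \<omega>) (\<phi> \<zeta>) ** right_vec \<zeta>) $ 1 $ 1"
proof -
  have "scalar_CD \<omega> \<zeta> = (\<Sum>l<n. \<Sum>j\<in>UNIV. \<Sum>m<n. \<Sum>s\<in>UNIV.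
      hh \<omega> * h \<zeta> * (left_vec \<omega> $ 1 $ s * (\<phi> \<omega> ^ m * \<phi> \<zeta> ^ l * CD_coeff m l $ s $ j) * right_vec \<zeta> $ j $ 1))"
    unfolding scalar_CD_def kernel_column_def sum_distrib_right
    by (intro sum.cong refl)
      (simp add: poly_right_poly [OF _ \<zeta>] poly_left_poly [OF _ \<omega>] ee [OF \<zeta>] eh [OF \<omega>] left_vec_def right_vec_def mult_ac)
  also have "\<dots> = (\<Sum>j\<in>UNIV. \<Sum>l<n. \<Sum>s\<in>UNIV. \<Sum>m<n.
      hh \<omega> * h \<zeta> * (left_vec \<omega> $ 1 $ s * (\<phi> \<omega> ^ m * \<phi> \<zeta> ^ l * CD_coeff m l $ s $ j) * right_vec \<zeta> $ j $ 1))"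
    by (rule trans [OF sum.swap], intro sum.cong [OF refl], rule sum.swap)
  also have "\<dots> = (\<Sum>j\<in>UNIV. \<Sum>s\<in>UNIV. \<Sum>m<n. \<Sum>l<n.
      hh \<omega> * h \<zeta> * (left_vec \<omega> $ 1 $ s * (\<phi> \<omega> ^ m * \<phi> \<zeta> ^ l * CD_coeff m l $ s $ j) * right_vec \<zeta> $ j $ 1))"
    by (rule sum.cong [OF refl], rule trans [OF sum.swap], rule sum.cong [OF refl], rule sum.swap)
  also have "\<dots> = hh \<omega> * h \<zeta> * (left_vec \<omega> ** matrix_CD (\<phi> \<omega>) (\<phi> \<zeta>) ** right_vec \<zeta>) $ 1 $ 1"
    by (simp add: matrix_mult_nth matrix_CD_eq sum_distrib_left sum_distrib_right)
  finally show ?thesis .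
qed

section \<open>The scalar form of the correlation kernel\<close>

lemma ee_right_vec: "\<zeta> \<in> path_image g - S \<Longrightarrow> ee \<zeta> = right_vec \<zeta>"
  and eh_left_vec: "\<zeta> \<in> path_image g - S \<Longrightarrow> eh \<zeta> = left_vec \<zeta>"
  and lam_eigval: "\<zeta> \<in> path_image g - S \<Longrightarrow> lam \<zeta> = eigval \<zeta>"
  by (simp_all only: ee eh lam right_vec_def left_vec_def eigval_def)

text \<open>The power of \<open>A\<close> is absorbed by the eigenvector next to it, so that the left-hand side is the
transferred form of the right-hand side.\<close>

lemma single_integral_eq:
  assumes "0 \<le> e1" "0 \<le> e2" "0 \<le> m"
  shows "mcontour_integral g (\<lambda>\<zeta>. (lam \<zeta> powi m * \<phi> \<zeta> powi k * deriv \<phi> \<zeta>) *\<^sub>m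
           (mpowi (trans_mat a b 1 (\<phi> \<zeta>)) e2 ** ee \<zeta> ** eh \<zeta> ** mpowi (trans_mat a b 0 (\<phi> \<zeta>)) e1)) =
         mcontour_integral unit_circle (\<lambda>z. z powi k *\<^sub>m
           (mpowi (trans_mat a b 1 z) e2 ** mpowi (period_mat a b z) m ** mpowi (trans_mat a b 0 z) e1))"
    (is "mcontour_integral g ?F = mcontour_integral _ ?G")
proof -
  define X where "X z = z powi k *\<^sub>m (mpowi (trans_mat a b 1 z) e2 ** mpowi (period_mat a b z) m)" for z
  define Y where "Y z = mpowi (trans_mat a b 0 z) e1" for z
  have X: "laurent_mat X"
    unfolding X_def using assms
    by (intro laurent_mat_mscale laurent_powi laurent_mat_mult laurent_mat_mpowi laurent_trans_mat
        laurent_period_mat)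
  have Y: "laurent_mat Y"
    unfolding Y_def using assms by (intro laurent_mat_mpowi laurent_trans_mat)
  obtain I where unit: "has_mcontour_integral (\<lambda>z. X z ** Y z) I unit_circle"
    and g: "has_mcontour_integral (\<lambda>\<zeta>. deriv \<phi> \<zeta> *\<^sub>m (X (\<phi> \<zeta>) ** right_vec \<zeta> ** left_vec \<zeta> ** Y (\<phi> \<zeta>))) I g"
    using transfer_integral [OF X Y] by blast
  have "has_mcontour_integral ?F I g"
  proof (rule has_mcontour_integral_spike_finite [OF g valid finite_S])
    fix \<zeta> assume "\<zeta> \<in> path_image g" "\<zeta> \<notin> S"
    then have \<zeta>: "\<zeta> \<in> path_image g - S" by blast
    have "X (\<phi> \<zeta>) ** right_vec \<zeta> = (\<phi> \<zeta> powi k * lam \<zeta> powi m) *\<^sub>m (mpowi (trans_mat a b 1 (\<phi> \<zeta>)) e2 ** right_vec \<zeta>)"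
      unfolding X_def mscale_mult_left matrix_mul_assoc [symmetric] mpowi_right_vec [OF \<zeta> assms(3)]
      by (simp only: mscale_mult_right mscale_mscale lam_eigval [OF \<zeta>])
    then show "?F \<zeta> = deriv \<phi> \<zeta> *\<^sub>m (X (\<phi> \<zeta>) ** right_vec \<zeta> ** left_vec \<zeta> ** Y (\<phi> \<zeta>))"
      by (simp add: mscale_mult_left mscale_mscale ee_right_vec [OF \<zeta>] eh_left_vec [OF \<zeta>] Y_def mult_ac)
  qed
  moreover have "?G = (\<lambda>z. X z ** Y z)"
    by (simp add: X_def Y_def mscale_mult_left)
  ultimately show ?thesis
    using has_mcontour_integral_unique [OF unit] has_mcontour_integral_unique [of ?F I g] by simp
qed

lemma laurent_matrix_CD: "laurent_mat (matrix_CD w)"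
proof -
  have "laurent_mat (\<lambda>z. \<Sum>k<n. \<Sum>l<n. (w ^ k * z ^ l) *\<^sub>m CD_coeff k l)"
    by (intro laurent_mat_sum laurent_mat_mscale laurent_mat_const laurent_mult laurent_power laurent_const)
  then show ?thesis unfolding matrix_CD_eq [abs_def] .
qed

text \<open>Integrating out the second variable of the matrix kernel leaves a polynomial \<open>G\<close> in the first one,
so that the outer integral can be transferred as well.\<close>

lemma matrix_CD_integral_laurent:
  fixes Y :: "complex \<Rightarrow> complex^'q^2"
  assumes Y: "laurent_mat Y"
  obtains G where "laurent_mat G"
    "\<And>w. has_mcontour_integral (\<lambda>z. matrix_CD w z ** Y z) (G w) unit_circle"
    "\<And>w. has_mcontour_integral (\<lambda>\<zeta>. deriv \<phi> \<zeta> *\<^sub>m (matrix_CD w (\<phi> \<zeta>) ** right_vec \<zeta> ** left_vec \<zeta> ** Y (\<phi> \<zeta>))) (G w) g"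
proof (rule that)
  define G where "G w = mcontour_integral unit_circle (\<lambda>z. matrix_CD w z ** Y z)" for w
  have "has_mcontour_integral (\<lambda>z. matrix_CD w z ** Y z) (G w) unit_circle \<and>
      has_mcontour_integral (\<lambda>\<zeta>. deriv \<phi> \<zeta> *\<^sub>m (matrix_CD w (\<phi> \<zeta>) ** right_vec \<zeta> ** left_vec \<zeta> ** Y (\<phi> \<zeta>))) (G w) g" for w
  proof -
    obtain I where I: "has_mcontour_integral (\<lambda>z. matrix_CD w z ** Y z) I unit_circle"
      "has_mcontour_integral (\<lambda>\<zeta>. deriv \<phi> \<zeta> *\<^sub>m (matrix_CD w (\<phi> \<zeta>) ** right_vec \<zeta> ** left_vec \<zeta> ** Y (\<phi> \<zeta>))) I g"
      using transfer_integral [OF laurent_matrix_CD Y] by blast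
    then have "G w = I"
      unfolding G_def by (intro has_mcontour_integral_unique)
    with I show ?thesis by simp
  qed
  then show unit: "has_mcontour_integral (\<lambda>z. matrix_CD w z ** Y z) (G w) unit_circle"
    and "has_mcontour_integral (\<lambda>\<zeta>. deriv \<phi> \<zeta> *\<^sub>m (matrix_CD w (\<phi> \<zeta>) ** right_vec \<zeta> ** left_vec \<zeta> ** Y (\<phi> \<zeta>))) (G w) g" for w
    by blast+
  show "laurent_mat G"
    unfolding laurent_mat_def
  proof (intro allI)
    fix i j
    define c where "c k = (\<Sum>l<n. \<Sum>s\<in>UNIV. CD_coeff k l $ i $ s *
        contour_integral unit_circle (\<lambda>z. z ^ l * Y z $ s $ j))" for k
    have "G w $ i $ j = (\<Sum>k<n. w ^ k * c k)" for w
    proof -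
      have Yint: "(\<lambda>z. z ^ l * Y z $ s $ j) contour_integrable_on unit_circle" for l s
        using Y by (intro laurent_contour_integrable laurent_mult laurent_power) (simp add: laurent_mat_def)
      have "((\<lambda>z. \<Sum>k<n. w ^ k * (\<Sum>l<n. \<Sum>s\<in>UNIV. CD_coeff k l $ i $ s * (z ^ l * Y z $ s $ j)))
          has_contour_integral (\<Sum>k<n. w ^ k * c k)) unit_circle"
        unfolding c_def
        by (intro has_contour_integral_sum has_contour_integral_lmul has_contour_integral_integral Yint)
          auto
      moreover have "(\<Sum>k<n. w ^ k * (\<Sum>l<n. \<Sum>s\<in>UNIV. CD_coeff k l $ i $ s * (z ^ l * Y z $ s $ j))) =
          (matrix_CD w z ** Y z) $ i $ j" for z
      proof -
        have "(matrix_CD w z ** Y z) $ i $ j =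
            (\<Sum>s\<in>UNIV. \<Sum>k<n. \<Sum>l<n. w ^ k * (CD_coeff k l $ i $ s * (z ^ l * Y z $ s $ j)))"
          by (simp add: matrix_mult_nth matrix_CD_eq sum_distrib_left sum_distrib_right mult_ac)
        also have "\<dots> = (\<Sum>k<n. \<Sum>l<n. \<Sum>s\<in>UNIV. w ^ k * (CD_coeff k l $ i $ s * (z ^ l * Y z $ s $ j)))"
          by (rule trans [OF sum.swap], rule sum.cong [OF refl], rule sum.swap)
        finally show ?thesis by (simp add: sum_distrib_left)
      qed
      ultimately have "((\<lambda>z. (matrix_CD w z ** Y z) $ i $ j) has_contour_integral (\<Sum>k<n. w ^ k * c k)) unit_circle"
        by simp
      moreover have "((\<lambda>z. (matrix_CD w z ** Y z) $ i $ j) has_contour_integral G w $ i $ j) unit_circle"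
        using unit [of w] unfolding has_mcontour_integral_def by (elim allE)
      ultimately show ?thesis by (rule has_contour_integral_unique [symmetric])
    qed
    then show "laurent (\<lambda>w. G w $ i $ j)"
      by (simp only:) (intro laurent_sum laurent_mult laurent_power laurent_const)
  qed
qed

text \<open>The factor \<open>ehat(\<omega>) R(\<phi>(\<omega>), \<phi>(\<zeta>)) e(\<zeta>)\<close> coming from the scalar kernel sits exactly between \<open>e(\<omega>)\<close>
and \<open>ehat(\<zeta>)\<close>, which completes the spectral projections at both points. The transfer identity is then
applied first in \<open>\<zeta>\<close> and then in \<open>\<omega>\<close>.\<close>

lemma double_integral_eq:
  assumes nonneg: "0 \<le> e1" "0 \<le> e2" "0 \<le> m" "0 \<le> x"
  shows "mcontour_integral g (\<lambda>\<omega>. mcontour_integral g (\<lambda>\<zeta>.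
            (scalar_CD \<omega> \<zeta> / (hh \<omega> * h \<zeta>) * (lam \<omega> powi m / \<phi> \<omega> powi p) *
             (lam \<zeta> powi x / \<phi> \<zeta> powi q) * deriv \<phi> \<omega> * deriv \<phi> \<zeta>) *\<^sub>m
              (mpowi (trans_mat a b 1 (\<phi> \<omega>)) e2 ** ee \<omega> ** eh \<zeta> ** mpowi (trans_mat a b 0 (\<phi> \<zeta>)) e1))) =
         mcontour_integral unit_circle (\<lambda>w. mcontour_integral unit_circle (\<lambda>z.
            (1 / (w powi p * z powi q)) *\<^sub>m
              (mpowi (trans_mat a b 1 w) e2 ** mpowi (period_mat a b w) m ** matrix_CD w z **
               mpowi (period_mat a b z) x ** mpowi (trans_mat a b 0 z) e1)))"
    (is "mcontour_integral g (\<lambda>\<omega>. mcontour_integral g (?F \<omega>)) =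
         mcontour_integral _ (\<lambda>w. mcontour_integral _ (?G w))")
proof -
  define X where "X w = w powi (- p) *\<^sub>m (mpowi (trans_mat a b 1 w) e2 ** mpowi (period_mat a b w) m)" for w
  define Y where "Y z = z powi (- q) *\<^sub>m (mpowi (period_mat a b z) x ** mpowi (trans_mat a b 0 z) e1)" for z
  have X: "laurent_mat X"
    unfolding X_def using nonneg
    by (intro laurent_mat_mscale laurent_powi laurent_mat_mult laurent_mat_mpowi laurent_trans_mat
        laurent_period_mat)
  have Y: "laurent_mat Y"
    unfolding Y_def using nonneg
    by (intro laurent_mat_mscale laurent_powi laurent_mat_mult laurent_mat_mpowi laurent_trans_mat
        laurent_period_mat)
  obtain G where G: "laurent_mat G"
    and G_unit: "\<And>w. has_mcontour_integral (\<lambda>z. matrix_CD w z ** Y z) (G w) unit_circle"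
    and G_g: "\<And>w. has_mcontour_integral (\<lambda>\<zeta>. deriv \<phi> \<zeta> *\<^sub>m (matrix_CD w (\<phi> \<zeta>) ** right_vec \<zeta> ** left_vec \<zeta> ** Y (\<phi> \<zeta>))) (G w) g"
    using matrix_CD_integral_laurent [OF Y] by blast
  obtain I where unit: "has_mcontour_integral (\<lambda>w. X w ** G w) I unit_circle"
    and g: "has_mcontour_integral (\<lambda>\<omega>. deriv \<phi> \<omega> *\<^sub>m (X (\<phi> \<omega>) ** right_vec \<omega> ** left_vec \<omega> ** G (\<phi> \<omega>))) I g"
    using transfer_integral [OF X G] by blast
  have inner_unit: "mcontour_integral unit_circle (?G w) = X w ** G w" for w
  proof (rule has_mcontour_integral_unique)
    have "?G w = (\<lambda>z. X w ** (matrix_CD w z ** Y z))"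
      by (simp add: X_def Y_def mscale_mult_left mscale_mult_right mscale_mscale matrix_mul_assoc
          power_int_minus field_simps)
    with has_mcontour_integral_mult_left [OF G_unit [of w]]
    show "has_mcontour_integral (?G w) (X w ** G w) unit_circle" by simp
  qed
  have X_right_vec: "X (\<phi> \<omega>) ** right_vec \<omega> =
      (\<phi> \<omega> powi (- p) * lam \<omega> powi m) *\<^sub>m (mpowi (trans_mat a b 1 (\<phi> \<omega>)) e2 ** right_vec \<omega>)"
    if "\<omega> \<in> path_image g - S" for \<omega>
    unfolding X_def mscale_mult_left matrix_mul_assoc [symmetric] mpowi_right_vec [OF that nonneg(3)]
    by (simp only: mscale_mult_right mscale_mscale lam_eigval [OF that])
  have left_vec_Y: "left_vec \<zeta> ** Y (\<phi> \<zeta>) =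
      (\<phi> \<zeta> powi (- q) * lam \<zeta> powi x) *\<^sub>m (left_vec \<zeta> ** mpowi (trans_mat a b 0 (\<phi> \<zeta>)) e1)"
    if "\<zeta> \<in> path_image g - S" for \<zeta>
    unfolding Y_def mscale_mult_right matrix_mul_assoc left_vec_mpowi [OF that nonneg(4)]
    by (simp only: mscale_mult_left mscale_mscale lam_eigval [OF that])
  have inner_g: "mcontour_integral g (?F \<omega>) =
      deriv \<phi> \<omega> *\<^sub>m (X (\<phi> \<omega>) ** right_vec \<omega> ** left_vec \<omega> ** G (\<phi> \<omega>))"
    if \<omega>: "\<omega> \<in> path_image g - S" for \<omega>
  proof (rule has_mcontour_integral_unique)
    define K where "K = deriv \<phi> \<omega> *\<^sub>m (X (\<phi> \<omega>) ** right_vec \<omega> ** left_vec \<omega>)"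
    have "has_mcontour_integral (?F \<omega>) (K ** G (\<phi> \<omega>)) g"
    proof (rule has_mcontour_integral_spike_finite
        [OF has_mcontour_integral_mult_left [OF G_g] valid finite_S])
      fix \<zeta> assume "\<zeta> \<in> path_image g" "\<zeta> \<notin> S"
      then have \<zeta>: "\<zeta> \<in> path_image g - S" by blast
      \<comment> \<open>The middle factor is a matrix of size one and can be pulled out as a scalar.\<close>
      define r where "r = (left_vec \<omega> ** matrix_CD (\<phi> \<omega>) (\<phi> \<zeta>) ** right_vec \<zeta>) $ 1 $ 1"
      have ratio: "scalar_CD \<omega> \<zeta> / (hh \<omega> * h \<zeta>) = r"
        using hh_nonzero [OF \<omega>] h_nonzero [OF \<zeta>] by (simp add: scalar_CD_eq [OF \<omega> \<zeta>] r_def)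
      have "K ** (deriv \<phi> \<zeta> *\<^sub>m (matrix_CD (\<phi> \<omega>) (\<phi> \<zeta>) ** right_vec \<zeta> ** left_vec \<zeta> ** Y (\<phi> \<zeta>))) =
          (deriv \<phi> \<omega> * deriv \<phi> \<zeta>) *\<^sub>m
            ((X (\<phi> \<omega>) ** right_vec \<omega>) ** (left_vec \<omega> ** matrix_CD (\<phi> \<omega>) (\<phi> \<zeta>) ** right_vec \<zeta>) ** (left_vec \<zeta> ** Y (\<phi> \<zeta>)))"
        unfolding K_def by (simp add: mscale_mult_left mscale_mult_right mscale_mscale matrix_mul_assoc mult.commute)
      also have "\<dots> = (deriv \<phi> \<omega> * deriv \<phi> \<zeta> * r) *\<^sub>m ((X (\<phi> \<omega>) ** right_vec \<omega>) ** (left_vec \<zeta> ** Y (\<phi> \<zeta>)))"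
        unfolding matrix_mult_1x1 r_def by (simp only: mscale_mscale)
      also have "\<dots> = ?F \<omega> \<zeta>"
        unfolding X_right_vec [OF \<omega>] left_vec_Y [OF \<zeta>] ratio
        by (simp add: mscale_mult_left mscale_mult_right mscale_mscale matrix_mul_assoc
            ee_right_vec [OF \<omega>] eh_left_vec [OF \<zeta>] power_int_minus divide_inverse mult_ac)
      finally show "?F \<omega> \<zeta> = K ** (deriv \<phi> \<zeta> *\<^sub>m (matrix_CD (\<phi> \<omega>) (\<phi> \<zeta>) ** right_vec \<zeta> ** left_vec \<zeta> ** Y (\<phi> \<zeta>)))" ..
    qed
    then show "has_mcontour_integral (?F \<omega>) (deriv \<phi> \<omega> *\<^sub>m (X (\<phi> \<omega>) ** right_vec \<omega> ** left_vec \<omega> ** G (\<phi> \<omega>))) g"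
      by (simp add: K_def mscale_mult_left)
  qed
  have "has_mcontour_integral (\<lambda>\<omega>. mcontour_integral g (?F \<omega>)) I g"
    by (rule has_mcontour_integral_spike_finite [OF g valid finite_S]) (rule inner_g, blast)
  then have "mcontour_integral g (\<lambda>\<omega>. mcontour_integral g (?F \<omega>)) = I"
    by (rule has_mcontour_integral_unique)
  also have "I = mcontour_integral unit_circle (\<lambda>w. mcontour_integral unit_circle (?G w))"
    unfolding inner_unit using has_mcontour_integral_unique [OF unit] ..
  finally show ?thesis .
qed

text \<open>When the indicator is nonzero, the last assumption makes the exponent \<open>x1 - x2\<close> nonnegative; otherwise
the single integrals are multiplied by \<open>0\<close>.\<close>

lemma DK_formula_eq_scalar_formula:
  assumes "0 \<le> e1" "0 \<le> e2" "0 \<le> x1" "x2 \<le> int (L div 2)"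
    and "2 * x1 + e1 > 2 * x2 - e2 \<Longrightarrow> x2 \<le> x1"
  shows "DK_formula a b L M N e1 e2 x1 x2 y1 y2 =
    scalar_formula a b L M N g \<phi> h hh ee eh lam e1 e2 x1 x2 y1 y2"
proof -
  have "- (chi_gt (2 * x1 + e1) (2 * x2 - e2) / (2 * of_real pi * \<i>)) *\<^sub>m
      mcontour_integral g (\<lambda>\<zeta>. (lam \<zeta> powi (x1 - x2) * \<phi> \<zeta> powi (y2 - y1 - 1) * deriv \<phi> \<zeta>) *\<^sub>m
           (mpowi (trans_mat a b 1 (\<phi> \<zeta>)) e2 ** ee \<zeta> ** eh \<zeta> ** mpowi (trans_mat a b 0 (\<phi> \<zeta>)) e1)) =
    - (chi_gt (2 * x1 + e1) (2 * x2 - e2) / (2 * of_real pi * \<i>)) *\<^sub>m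
      mcontour_integral unit_circle (\<lambda>z. z powi (y2 - y1 - 1) *\<^sub>m
           (mpowi (trans_mat a b 1 z) e2 ** mpowi (period_mat a b z) (x1 - x2) ** mpowi (trans_mat a b 0 z) e1))"
  proof (cases "2 * x1 + e1 > 2 * x2 - e2")
    case True
    with assms have "0 \<le> x1 - x2" by simp
    then show ?thesis using assms(1,2) by (simp only: single_integral_eq)
  next
    case False
    then show ?thesis by (simp add: chi_gt_def vec_eq_iff)
  qed
  moreover have "0 \<le> int (L div 2) - x2" using assms by simp
  ultimately show ?thesis
    unfolding DK_formula_def scalar_formula_def Let_def scalar_CD_kernel_eq matrix_CD_def [symmetric]
    using assms(1-3) by (simp only: double_integral_eq)
qed

lemma corr_kernel_block_eq_scalar_formula:
  assumes "e1 \<in> {0, 1}" "e2 \<in> {0, 1}"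
    and "2 * x1 + e1 \<in> {1..int L - 1}" "2 * x2 - e2 \<in> {1..int L - 1}" "even L"
  shows "corr_kernel_block a b L M N e1 e2 x1 x2 y1 y2 =
    scalar_formula a b L M N g \<phi> h hh ee eh lam e1 e2 x1 x2 y1 y2"
proof -
  have "corr_kernel_block a b L M N e1 e2 x1 x2 y1 y2 = DK_formula a b L M N e1 e2 x1 x2 y1 y2"
  proof -
    have "(2 * x1 + e1) mod 2 = e1" "(2 * x1 + e1) div 2 = x1"
      "(2 * x2 - e2) mod 2 = e2" "(2 * x2 - e2 + 1) div 2 = x2"
      using assms(1,2) by (auto; presburger)+
    moreover have "(2 * y + 0) div 2 = y" "(2 * y + 1) div 2 = y" "even (2 * y + 0)" "odd (2 * y + 1)" for y :: int
      by auto
    ultimately show ?thesis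
      unfolding corr_kernel_block_def corr_kernel_def Let_def
      by (simp add: vec_eq_iff forall_2)
  qed
  also have "\<dots> = scalar_formula a b L M N g \<phi> h hh ee eh lam e1 e2 x1 x2 y1 y2"
    using assms by (intro DK_formula_eq_scalar_formula) (auto elim!: evenE)
  finally show ?thesis .
qed

end

section \<open>Integrals around two poles\<close>

text \<open>By the residue theorem the integral over \<open>g\<close> equals the one over every large circle around \<open>0\<close>, and
the decay of \<open>f\<close> makes the latter arbitrarily small.\<close>

lemma loop_integral_two_poles:
  assumes g: "valid_path g" "pathfinish g = pathstart g"
    and off: "\<alpha> \<notin> path_image g" "\<beta> \<notin> path_image g"
    and wind: "winding_number g \<alpha> = 1" "winding_number g \<beta> = 1"
    and holo: "f holomorphic_on - {\<alpha>, \<beta>}"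
    and decay: "((\<lambda>z. z * f z) \<longlongrightarrow> 0) at_infinity"
  shows "(f has_contour_integral 0) g"
proof -
  have op: "open (- {\<alpha>, \<beta>})" by (intro open_Compl finite_imp_closed) auto
  have integrable: "f contour_integrable_on g"
    by (rule contour_integrable_holomorphic_simple [OF holo op g(1)]) (use off in auto)
  define \<rho> where "\<rho> = 2 * pi * \<i> * (\<Sum>p\<in>{\<alpha>, \<beta>}. residue f p)"
  have "contour_integral g f = 2 * pi * \<i> * (\<Sum>p\<in>{\<alpha>, \<beta>}. winding_number g p * residue f p)"
    by (rule Residue_theorem [where S = UNIV]) (use g off holo in \<open>auto simp: Compl_eq_Diff_UNIV\<close>)
  also have "(\<Sum>p\<in>{\<alpha>, \<beta>}. winding_number g p * residue f p) = (\<Sum>p\<in>{\<alpha>, \<beta>}. residue f p)"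
    using wind by (intro sum.cong) auto
  finally have int_g: "contour_integral g f = \<rho>" by (simp add: \<rho>_def)
  have bound: "norm \<rho> \<le> e * (2 * pi)" if "e > 0" for e
  proof -
    have "\<forall>\<^sub>F z in at_infinity. dist (z * f z) 0 < e"
      using decay \<open>e > 0\<close> by (rule tendstoD)
    then obtain b where b: "\<And>z. b \<le> norm z \<Longrightarrow> norm (z * f z) < e"
      unfolding eventually_at_infinity by auto
    \<comment> \<open>The circle of radius \<open>r\<close> surrounds both poles and lies where \<open>norm (z * f z) < e\<close>.\<close>
    define r where "r = max b (max (norm \<alpha>) (norm \<beta>) + 1)"
    have r: "b \<le> r" "norm \<alpha> < r" "norm \<beta> < r" "0 < r"
      unfolding r_def using norm_ge_zero [of \<alpha>] by linarith+
    have "contour_integral (circlepath 0 r) f =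
        2 * pi * \<i> * (\<Sum>p\<in>{\<alpha>, \<beta>}. winding_number (circlepath 0 r) p * residue f p)"
      by (rule Residue_theorem [where S = UNIV])
        (use r holo in \<open>auto simp: Compl_eq_Diff_UNIV path_image_circlepath\<close>)
    also have "(\<Sum>p\<in>{\<alpha>, \<beta>}. winding_number (circlepath 0 r) p * residue f p) = (\<Sum>p\<in>{\<alpha>, \<beta>}. residue f p)"
      using r by (intro sum.cong) (auto simp: winding_number_circlepath)
    finally have "contour_integral (circlepath 0 r) f = \<rho>" by (simp add: \<rho>_def)
    moreover have "f contour_integrable_on circlepath 0 r"
      by (rule contour_integrable_holomorphic_simple [OF holo op])
        (use r in \<open>auto simp: path_image_circlepath\<close>)
    ultimately have "(f has_contour_integral \<rho>) (circlepath 0 r)"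
      using has_contour_integral_integral by blast
    then have "norm \<rho> \<le> e / r * (2 * pi * r)"
    proof (rule has_contour_integral_bound_circlepath)
      show "norm (f z) \<le> e / r" if "norm (z - 0) = r" for z
        using b [of z] r that by (simp add: norm_mult field_simps)
    qed (use r \<open>e > 0\<close> in auto)
    then show ?thesis using r by (simp add: field_simps)
  qed
  have "norm \<rho> \<le> 0"
  proof (rule field_le_epsilon)
    fix e :: real assume "e > 0"
    then show "norm \<rho> \<le> 0 + e" using bound [of "e / (2 * pi)"] by simp
  qed
  then show ?thesis
    using has_contour_integral_integral [OF integrable] int_g by simp
qed

lemma tendsto_two_poles_at_infinity:
  fixes \<alpha> \<beta> :: complex
  shows "((\<lambda>z. 1 / ((z - \<alpha>) * (z - \<beta>))) \<longlongrightarrow> 0) at_infinity"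
    and "((\<lambda>z. z / ((z - \<alpha>) * (z - \<beta>))) \<longlongrightarrow> 0) at_infinity"
proof -
  have inv: "((\<lambda>z. inverse (z - \<gamma>)) \<longlongrightarrow> 0) at_infinity" for \<gamma> :: complex
  proof -
    have "filterlim (\<lambda>z. - \<gamma> + z) at_infinity at_infinity"
      by (rule tendsto_add_filterlim_at_infinity [OF tendsto_const filterlim_ident])
    then show ?thesis
      using filterlim_compose [OF tendsto_inverse_0] by force
  qed
  from tendsto_mult [OF inv inv]
  show "((\<lambda>z. 1 / ((z - \<alpha>) * (z - \<beta>))) \<longlongrightarrow> 0) at_infinity"
    by (simp add: divide_inverse)
  have "((\<lambda>z. inverse (z - \<alpha>) * (1 + \<beta> * inverse (z - \<beta>))) \<longlongrightarrow> 0 * (1 + \<beta> * 0)) at_infinity"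
    by (intro tendsto_intros inv)
  then have "((\<lambda>z. inverse (z - \<alpha>) * (1 + \<beta> * inverse (z - \<beta>))) \<longlongrightarrow> 0) at_infinity"
    by simp
  then show "((\<lambda>z. z / ((z - \<alpha>) * (z - \<beta>))) \<longlongrightarrow> 0) at_infinity"
  proof (rule Lim_transform_eventually)
    have "inverse (z - \<alpha>) * (1 + \<beta> * inverse (z - \<beta>)) = z / ((z - \<alpha>) * (z - \<beta>))"
      if "norm \<beta> + 1 \<le> norm z" for z
    proof -
      have "z - \<beta> \<noteq> 0" using that by auto
      then have "1 + \<beta> * inverse (z - \<beta>) = z / (z - \<beta>)" by (simp add: field_simps)
      then show ?thesis by (simp add: divide_inverse)
    qed
    then show "\<forall>\<^sub>F z in at_infinity. inverse (z - \<alpha>) * (1 + \<beta> * inverse (z - \<beta>)) = z / ((z - \<alpha>) * (z - \<beta>))"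
      unfolding eventually_at_infinity by blast
  qed
qed

text \<open>For \<open>j < m\<close> the integrand decays at infinity: \<open>z ^ Suc j / ((z - \<alpha>) * (z - \<beta>)) ^ m\<close> is a product of
\<open>m\<close> factors, each of which tends to \<open>0\<close>.\<close>

lemma loop_integral_two_pole_power:
  assumes g: "valid_path g" "pathfinish g = pathstart g"
    and off: "\<alpha> \<notin> path_image g" "\<beta> \<notin> path_image g"
    and wind: "winding_number g \<alpha> = 1" "winding_number g \<beta> = 1"
    and "j < m"
  shows "((\<lambda>z. z ^ j / ((z - \<alpha>) * (z - \<beta>)) ^ m) has_contour_integral 0) g"
proof (rule loop_integral_two_poles [OF g off wind])
  show "(\<lambda>z. z ^ j / ((z - \<alpha>) * (z - \<beta>)) ^ m) holomorphic_on - {\<alpha>, \<beta>}"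
    by (intro holomorphic_intros) auto
  have "((\<lambda>z. (z / ((z - \<alpha>) * (z - \<beta>))) ^ Suc j * (1 / ((z - \<alpha>) * (z - \<beta>))) ^ (m - Suc j))
      \<longlongrightarrow> 0 ^ Suc j * 0 ^ (m - Suc j)) at_infinity"
    by (intro tendsto_mult tendsto_power tendsto_two_poles_at_infinity)
  moreover have "(z / q) ^ Suc j * (1 / q) ^ (m - Suc j) = z * (z ^ j / q ^ m)" for z q :: complex
  proof -
    have "q ^ m = q ^ Suc j * q ^ (m - Suc j)"
      using \<open>j < m\<close> unfolding power_add [symmetric] by simp
    then show ?thesis by (simp add: power_divide)
  qed
  ultimately show "((\<lambda>z. z * (z ^ j / ((z - \<alpha>) * (z - \<beta>)) ^ m)) \<longlongrightarrow> 0) at_infinity"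
    by simp
qed

section \<open>The period matrix\<close>

lemma period_mat_entries:
  "period_mat a b z $ 1 $ 1 = of_real (b 0 0 * b 1 0) + of_real (a 0 0 * a 1 1) * z"
  "period_mat a b z $ 1 $ 2 = of_real (d_const a b)"
  "period_mat a b z $ 2 $ 1 = of_real (a 0 1 * b 1 0 + b 0 1 * a 1 1) * z"
  "period_mat a b z $ 2 $ 2 = of_real (a 0 1 * a 1 0) * z + of_real (b 0 1 * b 1 1)"
  by (simp_all add: period_mat_def trans_mat_def matrix_mult_nth sum_2 d_const_def algebra_simps)

lemma period_mat_diff:
  "period_mat a b z $ 1 $ 1 - period_mat a b z $ 2 $ 2 =
     of_real (a_minus a) * z - of_real (b_minus b)"
  by (simp add: period_mat_entries a_minus_def b_minus_def algebra_simps)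

lemma period_mat_trace:
  "period_mat a b z $ 1 $ 1 + period_mat a b z $ 2 $ 2 =
     of_real (a_plus a) * z + of_real (b_plus b)"
  by (simp add: period_mat_entries a_plus_def b_plus_def algebra_simps)

lemma c0_minus_c1: "c0_const a b - c1_const a b = a_minus a * b_minus b"
  unfolding c0_const_def c1_const_def a_minus_def b_minus_def by algebra

text \<open>The relation \<open>c0 - c1 = a_minus b_minus\<close> is what brings the discriminant into a form that is symmetric
in \<open>c0\<close> and \<open>c1\<close>.\<close>

lemma period_mat_discriminant:
  "(period_mat a b z $ 1 $ 1 - period_mat a b z $ 2 $ 2)\<^sup>2 +
     4 * period_mat a b z $ 1 $ 2 * period_mat a b z $ 2 $ 1 =
   of_real ((a_minus a)\<^sup>2) * z\<^sup>2 + of_real (2 * (c0_const a b + c1_const a b)) * z + of_real ((b_minus b)\<^sup>2)"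
proof -
  have "4 * period_mat a b z $ 1 $ 2 * period_mat a b z $ 2 $ 1 = of_real (4 * c0_const a b) * z"
    by (simp add: period_mat_entries c0_const_def d_const_def algebra_simps)
  moreover have "4 * c0_const a b = 2 * (c0_const a b + c1_const a b) + 2 * (a_minus a * b_minus b)"
    using c0_minus_c1 [of a b] by simp
  ultimately have "4 * period_mat a b z $ 1 $ 2 * period_mat a b z $ 2 $ 1 =
      of_real (2 * (c0_const a b + c1_const a b)) * z + 2 * of_real (a_minus a) * of_real (b_minus b) * z"
    by (simp only:) (simp add: algebra_simps)
  then show ?thesis
    unfolding period_mat_diff by (simp add: power2_eq_square algebra_simps)
qed

lemma positive_weights:
  fixes a b :: weights
  assumes a: "\<forall>l\<in>{0, 1}. \<forall>j\<in>{0, 1}. a l j > 0"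
    and b: "\<forall>l\<in>{0, 1}. \<forall>j\<in>{0, 1}. b l j > 0"
  shows "a 0 0 > 0" "a 0 1 > 0" "a 1 0 > 0" "a 1 1 > 0"
    "b 0 0 > 0" "b 0 1 > 0" "b 1 0 > 0" "b 1 1 > 0"
    "a_plus a > 0" "d_const a b > 0" "c0_const a b > 0" "c1_const a b > 0"
proof -
  have *: "a 0 0 > 0" "a 0 1 > 0" "a 1 0 > 0" "a 1 1 > 0"
    "b 0 0 > 0" "b 0 1 > 0" "b 1 0 > 0" "b 1 1 > 0"
    using a b by auto
  show "a 0 0 > 0" "a 0 1 > 0" "a 1 0 > 0" "a 1 1 > 0"
    "b 0 0 > 0" "b 0 1 > 0" "b 1 0 > 0" "b 1 1 > 0" by (fact *)+
  show "a_plus a > 0" unfolding a_plus_def using * by (intro add_pos_pos mult_pos_pos)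
  show "d_const a b > 0" unfolding d_const_def using * by (intro add_pos_pos mult_pos_pos)
  show "c0_const a b > 0" unfolding c0_const_def using * by (intro add_pos_pos mult_pos_pos)
  show "c1_const a b > 0" unfolding c1_const_def using * by (intro add_pos_pos mult_pos_pos)
qed

section \<open>The curve for vanishing \<open>a_minus\<close>\<close>

lemma phiA_altdef:
  "phiA a b \<zeta> = (\<zeta> - of_real (b_minus b)) * (\<zeta> + of_real (b_minus b)) / of_real (2 * (c0_const a b + c1_const a b))"
  unfolding phiA_def by (simp add: power2_eq_square algebra_simps)

lemma phiA_has_derivative:
  "(phiA a b has_field_derivative 2 * \<zeta> / of_real (2 * (c0_const a b + c1_const a b))) (at \<zeta>)"
  unfolding phiA_def [abs_def] by (auto intro!: derivative_eq_intros simp: divide_inverse)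

lemmas deriv_phiA = DERIV_imp_deriv [OF phiA_has_derivative]

text \<open>The factorised form used for the definition agrees with the eigenvalue formula because \<open>zeta1\<close> and
\<open>zeta2\<close> have the right sum and product. Both are checked after multiplication by \<open>a 0 0 * a 1 0\<close>; the
condition \<open>a_minus a = 0\<close> eliminates \<open>a 1 1\<close>.\<close>

lemma lambdaA_altdef:
  assumes a: "\<forall>l\<in>{0, 1}. \<forall>j\<in>{0, 1}. a l j > 0"
    and b: "\<forall>l\<in>{0, 1}. \<forall>j\<in>{0, 1}. b l j > 0"
    and deg: "a_minus a = 0"
  shows "lambdaA a b \<zeta> = (of_real (a_plus a) * phiA a b \<zeta> + of_real (b_plus b) + \<zeta>) / 2"
proof -
  note pos = positive_weights [OF a b]
  define s where "s = c0_const a b + c1_const a b"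
  have s0: "s > 0" using pos by (simp add: s_def)
  have s: "s = 2 * c0_const a b"
    using c0_minus_c1 [of a b] deg by (simp add: s_def)
  have deg': "a 1 1 * a 0 0 = a 0 1 * a 1 0"
    using deg by (simp add: a_minus_def)
  have zz: "a 0 0 * zeta1 a b = - a 0 0 * b_plus b - 2 * a 1 0 * b 0 0 * b 0 1"
    "a 1 0 * zeta2 a b = - a 1 0 * b_plus b - 2 * a 0 0 * b 1 0 * b 1 1"
    using pos by (simp_all add: zeta1_def zeta2_def field_simps)
  have ap: "a_plus a = 2 * (a 0 1 * a 1 0)" using deg' by (simp add: a_plus_def)
  have c0: "a 0 0 * c0_const a b = d_const a b * a 0 1 * (a 1 0 * b 0 1 + a 0 0 * b 1 0)"
  proof -
    have "a 0 0 * c0_const a b = d_const a b * ((a 1 1 * a 0 0) * b 0 1 + a 0 0 * a 0 1 * b 1 0)"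
      by (simp add: c0_const_def d_const_def algebra_simps)
    then show ?thesis unfolding deg' by (simp add: algebra_simps)
  qed
  have nz: "a 0 0 * a 1 0 \<noteq> 0" using pos by simp
  have "(a 0 0 * a 1 0) * (a_plus a * (zeta1 a b + zeta2 a b)) = (a 0 0 * a 1 0) * (- 2 * s)"
  proof -
    have "(a 0 0 * a 1 0) * (a_plus a * (zeta1 a b + zeta2 a b)) =
        a_plus a * (a 1 0 * (a 0 0 * zeta1 a b) + a 0 0 * (a 1 0 * zeta2 a b))"
      by (simp add: algebra_simps)
    also have "\<dots> = - 4 * a 1 0 * (d_const a b * a 0 1 * (a 1 0 * b 0 1 + a 0 0 * b 1 0))"
      unfolding zz ap by (simp add: b_plus_def d_const_def algebra_simps)
    also have "\<dots> = - 4 * a 1 0 * (a 0 0 * c0_const a b)" unfolding c0 ..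
    finally show ?thesis by (simp add: s)
  qed
  then have sum: "a_plus a * (zeta1 a b + zeta2 a b) = - 2 * s"
    by (rule mult_left_cancel [OF nz, THEN iffD1])
  have "(a 0 0 * a 1 0) * (a_plus a * (zeta1 a b * zeta2 a b)) =
      (a 0 0 * a 1 0) * (- a_plus a * (b_minus b)\<^sup>2 + 2 * s * b_plus b)"
  proof -
    have "(a 0 0 * a 1 0) * (a_plus a * (zeta1 a b * zeta2 a b)) =
        a_plus a * ((a 0 0 * zeta1 a b) * (a 1 0 * zeta2 a b))"
      by (simp add: algebra_simps)
    also have "\<dots> = (a 0 0 * a 1 0) * (- a_plus a * (b_minus b)\<^sup>2) +
        4 * a 1 0 * (d_const a b * a 0 1 * (a 1 0 * b 0 1 + a 0 0 * b 1 0)) * b_plus b"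
      unfolding zz ap by (simp add: b_plus_def b_minus_def d_const_def power2_eq_square algebra_simps)
    also have "\<dots> = (a 0 0 * a 1 0) * (- a_plus a * (b_minus b)\<^sup>2) + 4 * a 1 0 * (a 0 0 * c0_const a b) * b_plus b"
      unfolding c0 ..
    finally show ?thesis by (simp add: s algebra_simps)
  qed
  then have prod: "a_plus a * (zeta1 a b * zeta2 a b) = - a_plus a * (b_minus b)\<^sup>2 + 2 * s * b_plus b"
    by (rule mult_left_cancel [OF nz, THEN iffD1])
  have "of_real (a_plus a) * (\<zeta> - of_real (zeta1 a b)) * (\<zeta> - of_real (zeta2 a b)) =
      of_real (a_plus a) * \<zeta>\<^sup>2 - of_real (a_plus a * (zeta1 a b + zeta2 a b)) * \<zeta> +
      of_real (a_plus a * (zeta1 a b * zeta2 a b))"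
    by (simp add: power2_eq_square algebra_simps)
  also have "\<dots> = of_real (a_plus a) * (\<zeta>\<^sup>2 - of_real ((b_minus b)\<^sup>2)) + of_real (2 * s) * (of_real (b_plus b) + \<zeta>)"
    unfolding sum prod by (simp add: algebra_simps)
  finally have num: "of_real (a_plus a) * (\<zeta> - of_real (zeta1 a b)) * (\<zeta> - of_real (zeta2 a b)) =
      of_real (a_plus a) * (\<zeta>\<^sup>2 - of_real ((b_minus b)\<^sup>2)) + of_real (2 * s) * (of_real (b_plus b) + \<zeta>)" .
  have "complex_of_real s \<noteq> 0" using s0 by simp
  then show ?thesis
    unfolding lambdaA_def phiA_def s_def [symmetric] num
    by (simp add: add_divide_distrib diff_divide_distrib distrib_left right_diff_distrib)
qed

text \<open>These are \<open>\<phi>\<^sup>k e\<^sub>i\<close> and \<open>\<zeta> \<phi>\<^sup>k ehat\<^sub>i\<close>, written as polynomials in \<open>\<zeta>\<close>.\<close>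

definition right_polyA :: "weights \<Rightarrow> weights \<Rightarrow> nat \<Rightarrow> 2 \<Rightarrow> complex poly"
  where "right_polyA a b k i = smult (1 / of_real (2 * (c0_const a b + c1_const a b)))
      ([:- of_real (b_minus b), 1:] * [:of_real (b_minus b), 1:]) ^ k *
    (if i = 1 then 1 else smult (1 / of_real (2 * d_const a b)) [:of_real (b_minus b), 1:])"

definition left_polyA :: "weights \<Rightarrow> weights \<Rightarrow> nat \<Rightarrow> 2 \<Rightarrow> complex poly"
  where "left_polyA a b k i = smult (1 / of_real (2 * (c0_const a b + c1_const a b)))
      ([:- of_real (b_minus b), 1:] * [:of_real (b_minus b), 1:]) ^ k *
    (if i = 1 then smult (1 / 2) [:- of_real (b_minus b), 1:] else [:of_real (d_const a b):])"

lemma degree_power_mult_le: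
  fixes p q :: "complex poly"
  assumes "degree p \<le> r" "degree q \<le> s"
  shows "degree (p ^ k * q) \<le> r * k + s"
proof -
  have "degree (p ^ k * q) \<le> degree p * k + degree q"
    by (rule order_trans [OF degree_mult_le]) (simp add: degree_power_le)
  also have "\<dots> \<le> r * k + s" using assms by (intro add_mono mult_le_mono1)
  finally show ?thesis .
qed

lemma degree_polyA: "degree (right_polyA a b k i) \<le> 2 * k + 1" "degree (left_polyA a b k i) \<le> 2 * k + 1"
proof -
  have quadratic: "degree (smult c ([:- \<beta>, 1:] * [:\<beta>, 1:])) \<le> 2" for c \<beta> :: complex
    by (rule order_trans [OF degree_smult_le]) (simp add: degree_mult_eq)
  show "degree (right_polyA a b k i) \<le> 2 * k + 1"
    unfolding right_polyA_def by (intro degree_power_mult_le quadratic) (auto intro: order_trans [OF degree_smult_le])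
  show "degree (left_polyA a b k i) \<le> 2 * k + 1"
    unfolding left_polyA_def by (intro degree_power_mult_le quadratic) (auto intro: order_trans [OF degree_smult_le])
qed

lemma poly_quadratic_phiA:
  "poly (smult (1 / of_real (2 * (c0_const a b + c1_const a b)))
      ([:- of_real (b_minus b), 1:] * [:of_real (b_minus b), 1:])) \<zeta> = phiA a b \<zeta>"
  unfolding phiA_altdef poly_smult poly_mult by (simp del: of_real_add of_real_mult add: add.commute)

lemma poly_right_polyA: "poly (right_polyA a b k i) \<zeta> = hA \<zeta> * phiA a b \<zeta> ^ k * eA a b \<zeta> $ i $ 1"
  unfolding right_polyA_def poly_mult poly_power poly_quadratic_phiA
  using exhaust_2 [of i] by (auto simp: hA_def eA_def add.commute add_divide_distrib)

lemma poly_left_polyA: "\<zeta> \<noteq> 0 \<Longrightarrow> poly (left_polyA a b k i) \<zeta> = hhatA \<zeta> * phiA a b \<zeta> ^ k * ehatA a b \<zeta> $ 1 $ i"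
  unfolding left_polyA_def poly_mult poly_power poly_quadratic_phiA
  using exhaust_2 [of i] by (auto simp: hhatA_def ehatA_def diff_divide_distrib right_diff_distrib)

text \<open>For \<open>k = -1\<close> the logarithmic derivative of \<open>\<phi>\<close> is the sum of two simple poles at its zeros
\<open>\<plusminus> b_minus\<close>, around each of which the path winds once.\<close>

lemma phiA_even_moments:
  assumes g: "valid_path g" "pathfinish g = pathstart g"
    and off: "complex_of_real (b_minus b) \<notin> path_image g" "- complex_of_real (b_minus b) \<notin> path_image g"
    and wind: "winding_number g (of_real (b_minus b)) = 1" "winding_number g (- of_real (b_minus b)) = 1"
    and pos: "c0_const a b + c1_const a b > 0"
  shows "((\<lambda>\<zeta>. phiA a b \<zeta> powi k * deriv (phiA a b) \<zeta>) has_contour_integral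
      (if k = -1 then 4 * of_real pi * \<i> else 0)) g"
proof -
  define \<beta> where "\<beta> = complex_of_real (b_minus b)"
  define c where "c = complex_of_real (2 * (c0_const a b + c1_const a b))"
  have c: "c \<noteq> 0" using pos by (simp add: c_def del: of_real_add of_real_mult)
  have phi: "phiA a b \<zeta> = (\<zeta> - \<beta>) * (\<zeta> + \<beta>) / c" for \<zeta>
    by (simp add: phiA_altdef \<beta>_def c_def)
  have d: "deriv (phiA a b) \<zeta> = 2 * \<zeta> / c" for \<zeta>
    unfolding deriv_phiA c_def ..
  have nz: "\<zeta> - \<beta> \<noteq> 0" "\<zeta> + \<beta> \<noteq> 0" if "\<zeta> \<in> path_image g" for \<zeta>
    using that off by (auto simp: \<beta>_def add_eq_0_iff2)
  show ?thesis
  proof (cases "k = -1")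
    case True
    have "((\<lambda>\<zeta>. 1 / (\<zeta> - \<beta>) + 1 / (\<zeta> - - \<beta>)) has_contour_integral
        2 * of_real pi * \<i> * winding_number g \<beta> + 2 * of_real pi * \<i> * winding_number g (- \<beta>)) g"
      using has_contour_integral_add [OF has_contour_integral_winding_number [OF g(1) off(1)]
          has_contour_integral_winding_number [OF g(1) off(2)]]
      unfolding \<beta>_def by (simp only: of_real_mult of_real_numeral)
    then have "((\<lambda>\<zeta>. 1 / (\<zeta> - \<beta>) + 1 / (\<zeta> - - \<beta>)) has_contour_integral 4 * of_real pi * \<i>) g"
      using wind by (simp add: \<beta>_def mult_ac)
    then have "((\<lambda>\<zeta>. phiA a b \<zeta> powi k * deriv (phiA a b) \<zeta>) has_contour_integral 4 * of_real pi * \<i>) g"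
    proof (rule has_contour_integral_eq)
      fix \<zeta> assume "\<zeta> \<in> path_image g"
      from nz [OF this] c show "1 / (\<zeta> - \<beta>) + 1 / (\<zeta> - - \<beta>) = phiA a b \<zeta> powi k * deriv (phiA a b) \<zeta>"
        by (simp add: True power_int_minus phi d) (simp add: divide_simps)
    qed
    with True show ?thesis by simp
  next
    case False
    have "((\<lambda>\<zeta>. phiA a b \<zeta> powi k * (2 * \<zeta> / c)) has_contour_integral 0) g"
    proof (rule loop_integral_powi_deriv [OF g _ _ False])
      show "(phiA a b has_field_derivative 2 * \<zeta> / c) (at \<zeta>)" for \<zeta>
        unfolding c_def by (rule phiA_has_derivative)
      show "phiA a b \<zeta> \<noteq> 0" if "\<zeta> \<in> path_image g" for \<zeta>
        using nz [OF that] c by (simp add: phi)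
    qed
    with False show ?thesis by (simp add: d)
  qed
qed

text \<open>Here \<open>\<phi>' / \<eta>\<close> is constant, and \<open>\<phi> powi k\<close> is either a polynomial or decays like \<open>\<zeta> powi (2 k)\<close>.\<close>

lemma phiA_odd_moments:
  assumes g: "valid_path g" "pathfinish g = pathstart g"
    and off: "complex_of_real (b_minus b) \<notin> path_image g" "- complex_of_real (b_minus b) \<notin> path_image g"
      "0 \<notin> path_image g"
    and wind: "winding_number g (of_real (b_minus b)) = 1" "winding_number g (- of_real (b_minus b)) = 1"
    and pos: "c0_const a b + c1_const a b > 0"
  shows "((\<lambda>\<zeta>. phiA a b \<zeta> powi k * (deriv (phiA a b) \<zeta> / \<zeta>)) has_contour_integral 0) g"
proof -
  define \<beta> where "\<beta> = complex_of_real (b_minus b)"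
  define c where "c = complex_of_real (2 * (c0_const a b + c1_const a b))"
  have c: "c \<noteq> 0" using pos by (simp add: c_def del: of_real_add of_real_mult)
  have phi: "phiA a b \<zeta> = (\<zeta> - \<beta>) * (\<zeta> - - \<beta>) / c" for \<zeta>
    by (simp add: phiA_altdef \<beta>_def c_def)
  have d: "deriv (phiA a b) \<zeta> = 2 * \<zeta> / c" for \<zeta>
    unfolding deriv_phiA c_def ..
  have "((\<lambda>\<zeta>. phiA a b \<zeta> powi k) has_contour_integral 0) g"
  proof (cases "k \<ge> 0")
    case True
    then have "(\<lambda>\<zeta>. phiA a b \<zeta> powi k) holomorphic_on UNIV"
      unfolding phi power_int_def by (auto intro!: holomorphic_intros simp: c)
    then show ?thesis
      by (intro Cauchy_theorem_global [where S = UNIV] g) auto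
  next
    case False
    define m where "m = nat (- k)"
    have "((\<lambda>\<zeta>. \<zeta> ^ 0 / ((\<zeta> - \<beta>) * (\<zeta> - - \<beta>)) ^ m) has_contour_integral 0) g"
      by (rule loop_integral_two_pole_power) (use g off wind False in \<open>auto simp: \<beta>_def m_def\<close>)
    from has_contour_integral_lmul [OF this, of "c ^ m"]
    have "((\<lambda>\<zeta>. c ^ m * (\<zeta> ^ 0 / ((\<zeta> - \<beta>) * (\<zeta> - - \<beta>)) ^ m)) has_contour_integral 0) g"
      by simp
    moreover have "c ^ m * (\<zeta> ^ 0 / ((\<zeta> - \<beta>) * (\<zeta> - - \<beta>)) ^ m) = phiA a b \<zeta> powi k" for \<zeta>
      using False unfolding phi power_int_def m_def by (simp add: power_divide power_mult_distrib power_inverse)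
    ultimately show ?thesis by simp
  qed
  from has_contour_integral_rmul [OF this, of "2 / c"]
  have "((\<lambda>\<zeta>. phiA a b \<zeta> powi k * (2 / c)) has_contour_integral 0) g" by simp
  then show ?thesis
    by (rule has_contour_integral_eq) (use off(3) in \<open>auto simp: d\<close>)
qed

lemma scalar_reduction_A:
  assumes a: "\<forall>l\<in>{0, 1}. \<forall>j\<in>{0, 1}. a l j > 0"
    and b: "\<forall>l\<in>{0, 1}. \<forall>j\<in>{0, 1}. b l j > 0"
    and deg: "a_minus a = 0" and N: "even N"
    and CD: "\<exists>R. is_CD_kernel unit_circle (matrix_weight a b L M N) (N div 2) R"
    and g: "valid_path g" "pathfinish g = pathstart g"
    and off: "complex_of_real (b_minus b) \<notin> path_image g" "- complex_of_real (b_minus b) \<notin> path_image g"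
      "0 \<notin> path_image g"
    and wind: "winding_number g (of_real (b_minus b)) = 1" "winding_number g (- of_real (b_minus b)) = 1"
  shows "scalar_reduction a b g (phiA a b) (\<lambda>\<zeta>. \<zeta>) {} L M N hA hhatA (eA a b) (ehatA a b) (lambdaA a b)
    (right_polyA a b) (left_polyA a b)"
proof
  note pos = positive_weights [OF a b]
  define s where "s = complex_of_real (2 * (c0_const a b + c1_const a b))"
  have s: "s \<noteq> 0" using pos by (simp add: s_def del: of_real_add of_real_mult)
  have sum_pos: "c0_const a b + c1_const a b > 0" using pos by simp
  show "laurent_mat (period_mat a b)" by (rule laurent_period_mat)
  show "valid_path g" by (rule g)
  have phi_nz: "phiA a b \<zeta> \<noteq> 0" if "\<zeta> \<in> path_image g" for \<zeta>
    using that off s unfolding phiA_altdef s_def by (auto simp: add_eq_0_iff2)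
  then show "phiA a b \<zeta> \<noteq> 0" if "\<zeta> \<in> path_image g" for \<zeta> using that .
  have nz: "\<zeta> \<noteq> 0" if "\<zeta> \<in> path_image g - {}" for \<zeta> using that off by auto
  then show "\<zeta> \<noteq> 0" if "\<zeta> \<in> path_image g - {}" for \<zeta> using that .
  show "period_mat a b (phiA a b \<zeta>) $ 1 $ 2 \<noteq> 0" for \<zeta>
    using pos by (simp add: period_mat_entries)
  show "\<zeta>\<^sup>2 = (period_mat a b (phiA a b \<zeta>) $ 1 $ 1 - period_mat a b (phiA a b \<zeta>) $ 2 $ 2)\<^sup>2 +
      4 * period_mat a b (phiA a b \<zeta>) $ 1 $ 2 * period_mat a b (phiA a b \<zeta>) $ 2 $ 1" for \<zeta>
    unfolding period_mat_discriminant phiA_def s_def [symmetric] using s deg by simp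
  show "((\<lambda>\<zeta>. phiA a b \<zeta> powi k * deriv (phiA a b) \<zeta>) has_contour_integral
      (if k = -1 then 4 * of_real pi * \<i> else 0)) g" for k
    by (rule phiA_even_moments [OF g off(1,2) wind sum_pos])
  show "((\<lambda>\<zeta>. phiA a b \<zeta> powi k * (deriv (phiA a b) \<zeta> / \<zeta>)) has_contour_integral 0) g" for k
    by (rule phiA_odd_moments [OF g off wind sum_pos])
  show "even N" by (rule N)
  show "hA \<zeta> \<noteq> 0" for \<zeta> by (simp add: hA_def)
  show "hhatA \<zeta> \<noteq> 0" if "\<zeta> \<in> path_image g - {}" for \<zeta> using nz [OF that] by (simp add: hhatA_def)
  show "eA a b \<zeta> = right_eigenvector2 (period_mat a b (phiA a b \<zeta>)) \<zeta>" for \<zeta>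
    unfolding eA_def right_eigenvector2_def period_mat_diff deg by (simp add: period_mat_entries)
  show "ehatA a b \<zeta> = left_eigenvector2 (period_mat a b (phiA a b \<zeta>)) \<zeta>" for \<zeta>
    unfolding ehatA_def left_eigenvector2_def period_mat_diff deg by (simp add: period_mat_entries)
  show "lambdaA a b \<zeta> = eigenvalue2 (period_mat a b (phiA a b \<zeta>)) \<zeta>" for \<zeta>
    unfolding lambdaA_altdef [OF a b deg] eigenvalue2_def period_mat_trace by (rule refl)
  show "degree (right_polyA a b k i) < N" "degree (left_polyA a b k i) < N" if "k < N div 2" for k i
    using le_less_trans [OF degree_polyA(1) [of a b k i]] le_less_trans [OF degree_polyA(2) [of a b k i]] that
    by simp_all
  show "poly (right_polyA a b k i) \<zeta> = hA \<zeta> * phiA a b \<zeta> ^ k * eA a b \<zeta> $ i $ 1" for k i \<zeta>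
    by (rule poly_right_polyA)
  show "poly (left_polyA a b k i) \<zeta> = hhatA \<zeta> * phiA a b \<zeta> ^ k * ehatA a b \<zeta> $ 1 $ i"
    if "\<zeta> \<in> path_image g - {}" for k i \<zeta>
    by (rule poly_left_polyA [OF nz [OF that]])
  show "(\<lambda>\<omega>. \<omega> ^ k * scalar_weight L M N (phiA a b) hA hhatA (lambdaA a b) \<omega>) contour_integrable_on g" for k
  proof (rule contour_integrable_holomorphic_simple)
    let ?U = "- {0, complex_of_real (b_minus b), - complex_of_real (b_minus b)}"
    show "open ?U" by (intro open_Compl finite_imp_closed) auto
    show "path_image g \<subseteq> ?U" using off by auto
    show "(\<lambda>\<omega>. \<omega> ^ k * scalar_weight L M N (phiA a b) hA hhatA (lambdaA a b) \<omega>) holomorphic_on ?U"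
      unfolding scalar_weight_def hA_def hhatA_def deriv_phiA lambdaA_def phiA_altdef s_def [symmetric]
      using pos s by (intro holomorphic_intros) (auto simp: add_eq_0_iff2)
  qed (rule g)
  show "\<exists>R. is_CD_kernel unit_circle (matrix_weight a b L M N) (N div 2) R" by (rule CD)
qed simp

section \<open>The curve for nonzero \<open>a_minus\<close>\<close>

locale nondegenerate_weights =
  fixes a b :: weights
  assumes a_pos: "\<forall>l\<in>{0, 1}. \<forall>j\<in>{0, 1}. a l j > 0"
    and b_pos: "\<forall>l\<in>{0, 1}. \<forall>j\<in>{0, 1}. b l j > 0"
    and nondegenerate: "a_minus a \<noteq> 0"
begin

lemmas pos = positive_weights [OF a_pos b_pos]

abbreviation "c \<equiv> c_const a b"
definition "s = c0_const a b + c1_const a b"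
definition "\<kappa> = (z_plus a b - z_minus a b) / 4"

lemma z_diff: "z_plus a b - z_minus a b = 4 * \<kappa>"
  by (simp add: \<kappa>_def)

lemma discriminant_pos: "(a_minus a)\<^sup>2 * (b_minus b)\<^sup>2 < s\<^sup>2"
proof -
  have "(a_minus a)\<^sup>2 * (b_minus b)\<^sup>2 = (c0_const a b - c1_const a b)\<^sup>2"
    by (simp add: c0_minus_c1 power_mult_distrib)
  also have "\<dots> = s\<^sup>2 - 4 * (c0_const a b * c1_const a b)"
    by (simp add: s_def power2_eq_square algebra_simps)
  also have "\<dots> < s\<^sup>2"
    using pos by simp
  finally show ?thesis .
qed

lemma z_sum: "z_plus a b + z_minus a b = - 2 * s / (a_minus a)\<^sup>2"
  unfolding z_plus_def z_minus_def s_def by (simp add: add_divide_distrib diff_divide_distrib)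

text \<open>With \<open>D\<close> the square root in the definition of \<open>z_plus\<close> and \<open>z_minus\<close>, these two points differ by
\<open>2 D / a_minus\<^sup>2\<close>.\<close>

lemma kappa_pos: "\<kappa> > 0"
  and kappa_square: "4 * (a_minus a)\<^sup>2 * \<kappa>\<^sup>2 = s\<^sup>2 / (a_minus a)\<^sup>2 - (b_minus b)\<^sup>2"
proof -
  define D where "D = sqrt (s\<^sup>2 - (a_minus a)\<^sup>2 * (b_minus b)\<^sup>2)"
  have D: "D > 0" "D\<^sup>2 = s\<^sup>2 - (a_minus a)\<^sup>2 * (b_minus b)\<^sup>2"
    using discriminant_pos by (simp_all add: D_def)
  have k: "\<kappa> = D / (2 * (a_minus a)\<^sup>2)"
    unfolding \<kappa>_def z_plus_def z_minus_def s_def [symmetric] D_def [symmetric] using nondegenerate by (simp add: field_simps)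
  show "\<kappa> > 0" unfolding k using D nondegenerate by simp
  have "4 * (a_minus a)\<^sup>2 * \<kappa>\<^sup>2 = D\<^sup>2 / (a_minus a)\<^sup>2"
    unfolding k using nondegenerate by (simp add: power_divide power_mult_distrib field_simps power4_eq_xxxx power2_eq_square)
  also have "\<dots> = s\<^sup>2 / (a_minus a)\<^sup>2 - (b_minus b)\<^sup>2"
    unfolding D using nondegenerate by (simp add: field_simps)
  finally show "4 * (a_minus a)\<^sup>2 * \<kappa>\<^sup>2 = s\<^sup>2 / (a_minus a)\<^sup>2 - (b_minus b)\<^sup>2" .
qed

lemma z_plus_times_z_minus: "z_plus a b * z_minus a b = (b_minus b)\<^sup>2 / (a_minus a)\<^sup>2"
proof -
  have "4 * (z_plus a b * z_minus a b) = (z_plus a b + z_minus a b)\<^sup>2 - (4 * \<kappa>)\<^sup>2"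
    unfolding z_diff [symmetric] by (simp add: power2_eq_square algebra_simps)
  also have "(4 * \<kappa>)\<^sup>2 = 4 * (s\<^sup>2 / (a_minus a)\<^sup>2 - (b_minus b)\<^sup>2) / (a_minus a)\<^sup>2"
    unfolding kappa_square [symmetric] using nondegenerate by (simp add: power_mult_distrib)
  also have "(z_plus a b + z_minus a b)\<^sup>2 = 4 * (s\<^sup>2 / (a_minus a)\<^sup>2) / (a_minus a)\<^sup>2"
    unfolding z_sum by (simp add: power_divide power_mult_distrib power2_eq_square)
  finally show ?thesis
    by (simp add: right_diff_distrib diff_divide_distrib)
qed

lemma z_less: "z_minus a b < z_plus a b"
  using kappa_pos z_diff by linarith

lemma z_sum_neg: "z_plus a b + z_minus a b < 0"
  unfolding z_sum s_def using pos nondegenerate by (simp add: divide_neg_pos)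

lemma z_plus_nonpos: "z_plus a b \<le> 0"
proof (rule ccontr)
  assume "\<not> z_plus a b \<le> 0"
  with z_sum_neg have "z_plus a b * z_minus a b < 0" by (intro mult_pos_neg) auto
  moreover have "z_plus a b * z_minus a b \<ge> 0"
    unfolding z_plus_times_z_minus by simp
  ultimately show False by simp
qed

lemma z_plus_neg: "b_minus b \<noteq> 0 \<Longrightarrow> z_plus a b < 0"
proof -
  assume "b_minus b \<noteq> 0"
  then have "z_plus a b * z_minus a b \<noteq> 0"
    unfolding z_plus_times_z_minus using nondegenerate by simp
  then show ?thesis using z_plus_nonpos by (cases "z_plus a b = 0") auto
qed

text \<open>Writing \<open>c = (u - v) / (u + v)\<close> with \<open>u\<^sup>2 = - z_minus\<close> and \<open>v\<^sup>2 = - z_plus\<close> gives all four claims. The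
last one says that \<open>\<phi>\<close> equals \<open>\<kappa> (\<zeta> + 1/\<zeta>) + (z_plus + z_minus) / 2\<close>.\<close>

lemma c_pos: "0 < c" and c_le_1: "c \<le> 1" and c_less_1: "b_minus b \<noteq> 0 \<Longrightarrow> c < 1"
  and kappa_c: "\<kappa> * (c + inverse c) = s / (a_minus a)\<^sup>2"
proof -
  define u where "u = sqrt \<bar>z_minus a b\<bar>"
  define v where "v = sqrt \<bar>z_plus a b\<bar>"
  have uv: "v < u" "0 \<le> v" using z_less z_plus_nonpos by (simp_all add: u_def v_def)
  have c: "c = (u - v) / (u + v)" by (simp add: c_const_def u_def v_def)
  show "0 < c" "c \<le> 1" using uv unfolding c by simp_all
  show "c < 1" if "b_minus b \<noteq> 0"
  proof -
    have "v > 0" using z_plus_neg [OF that] by (simp add: v_def)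
    then show ?thesis using uv unfolding c by simp
  qed
  have sq: "u\<^sup>2 = - z_minus a b" "v\<^sup>2 = - z_plus a b"
    using z_less z_plus_nonpos by (simp_all add: u_def v_def)
  have "c + inverse c = ((u - v)\<^sup>2 + (u + v)\<^sup>2) / ((u - v) * (u + v))"
    using uv unfolding c by (simp add: add_frac_eq power2_eq_square)
  also have "(u - v)\<^sup>2 + (u + v)\<^sup>2 = 2 * (u\<^sup>2 + v\<^sup>2)"
    by (simp add: power2_eq_square algebra_simps)
  also have "(u - v) * (u + v) = u\<^sup>2 - v\<^sup>2"
    by (simp add: power2_eq_square algebra_simps)
  finally have "c + inverse c = - 2 * (z_plus a b + z_minus a b) / (z_plus a b - z_minus a b)"
    by (simp add: sq algebra_simps)
  then have "\<kappa> * (c + inverse c) = - (z_plus a b + z_minus a b) / 2"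
    using kappa_pos unfolding z_diff by simp
  then show "\<kappa> * (c + inverse c) = s / (a_minus a)\<^sup>2"
    unfolding z_sum by simp
qed

lemma phiB_altdef: "phiB a b \<zeta> = of_real \<kappa> * ((\<zeta> - of_real c) * (\<zeta> - of_real (inverse c))) / \<zeta>"
  unfolding phiB_def z_diff by simp

lemma zeta_phiB:
  assumes "\<zeta> \<noteq> 0"
  shows "\<zeta> * phiB a b \<zeta> = of_real \<kappa> * (\<zeta>\<^sup>2 + 1) - of_real (s / (a_minus a)\<^sup>2) * \<zeta>"
proof -
  have "\<zeta> * phiB a b \<zeta> = of_real \<kappa> * ((\<zeta> - of_real c) * (\<zeta> - of_real (inverse c)))"
    using assms by (simp add: phiB_altdef)
  also have "(\<zeta> - of_real c) * (\<zeta> - of_real (inverse c)) = \<zeta>\<^sup>2 + of_real (c * inverse c) - of_real (c + inverse c) * \<zeta>"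
    by (simp add: power2_eq_square algebra_simps)
  also have "c * inverse c = 1" using c_pos by simp
  also have "of_real \<kappa> * (\<zeta>\<^sup>2 + of_real 1 - of_real (c + inverse c) * \<zeta>) =
      of_real \<kappa> * (\<zeta>\<^sup>2 + 1) - of_real (\<kappa> * (c + inverse c)) * \<zeta>"
    unfolding of_real_mult [of \<kappa>] by (simp add: algebra_simps)
  finally show ?thesis unfolding kappa_c .
qed

lemma zeta_etaB: "\<zeta> \<noteq> 0 \<Longrightarrow> \<zeta> * etaB a b \<zeta> = of_real (a_minus a * \<kappa>) * (\<zeta>\<^sup>2 - 1)"
  unfolding etaB_def z_diff by (simp add: right_diff_distrib power2_eq_square)

text \<open>Completing the square, the quadratic in \<open>\<phi>\<close> is \<open>a_minus\<^sup>2 (\<phi> + s / a_minus\<^sup>2)\<^sup>2 - 4 a_minus\<^sup>2 \<kappa>\<^sup>2\<close>, that is,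
\<open>a_minus\<^sup>2 \<kappa>\<^sup>2 ((\<zeta> + 1/\<zeta>)\<^sup>2 - 4)\<close>, which is the square of \<open>a_minus \<kappa> (\<zeta> - 1/\<zeta>)\<close>.\<close>

lemma etaB_square:
  assumes "\<zeta> \<noteq> 0"
  shows "(etaB a b \<zeta>)\<^sup>2 = of_real ((a_minus a)\<^sup>2) * (phiB a b \<zeta>)\<^sup>2 + of_real (2 * s) * phiB a b \<zeta> +
    of_real ((b_minus b)\<^sup>2)"
proof -
  define A where "A = complex_of_real (a_minus a)"
  define K where "K = complex_of_real \<kappa>"
  define B where "B = complex_of_real (b_minus b)"
  define t where "t = complex_of_real s"
  have A: "A \<noteq> 0" using nondegenerate by (simp add: A_def)
  have K: "4 * A\<^sup>2 * K\<^sup>2 = t\<^sup>2 / A\<^sup>2 - B\<^sup>2"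
    using arg_cong [OF kappa_square, of complex_of_real] unfolding A_def K_def B_def t_def by simp
  have phi: "\<zeta> * phiB a b \<zeta> = K * (\<zeta>\<^sup>2 + 1) - t / A\<^sup>2 * \<zeta>"
    using zeta_phiB [OF assms] unfolding A_def K_def t_def by simp
  have eta: "\<zeta> * etaB a b \<zeta> = A * K * (\<zeta>\<^sup>2 - 1)"
    using zeta_etaB [OF assms] unfolding A_def K_def by simp
  have "\<zeta>\<^sup>2 * (A\<^sup>2 * (phiB a b \<zeta>)\<^sup>2 + 2 * t * phiB a b \<zeta> + B\<^sup>2) =
      A\<^sup>2 * (\<zeta> * phiB a b \<zeta> + t / A\<^sup>2 * \<zeta>)\<^sup>2 - (t\<^sup>2 / A\<^sup>2 - B\<^sup>2) * \<zeta>\<^sup>2"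
    using A by (simp add: power2_eq_square field_simps)
  also have "\<zeta> * phiB a b \<zeta> + t / A\<^sup>2 * \<zeta> = K * (\<zeta>\<^sup>2 + 1)" unfolding phi by simp
  also have "A\<^sup>2 * (K * (\<zeta>\<^sup>2 + 1))\<^sup>2 - (t\<^sup>2 / A\<^sup>2 - B\<^sup>2) * \<zeta>\<^sup>2 = (A * K * (\<zeta>\<^sup>2 - 1))\<^sup>2"
    unfolding K [symmetric] by (simp add: power2_eq_square algebra_simps)
  also have "\<dots> = \<zeta>\<^sup>2 * (etaB a b \<zeta>)\<^sup>2" unfolding eta [symmetric] by (simp add: power_mult_distrib)
  finally show ?thesis
    using assms unfolding A_def B_def t_def by simp
qed

lemma phiB_has_derivative:
  assumes "\<zeta> \<noteq> 0"
  shows "(phiB a b has_field_derivative of_real \<kappa> * (1 - 1 / \<zeta>\<^sup>2)) (at \<zeta>)"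
proof -
  define F where "F z = of_real \<kappa> * (z + inverse z) - of_real (s / (a_minus a)\<^sup>2)" for z :: complex
  have F: "(F has_field_derivative of_real \<kappa> * (1 - 1 / \<zeta>\<^sup>2)) (at \<zeta>)"
    unfolding F_def using assms
    by (auto intro!: derivative_eq_intros simp: power2_eq_square divide_inverse)
  have eq: "F z = phiB a b z" if "z \<in> - {0}" for z
  proof -
    have "z * F z = z * phiB a b z"
      using that nondegenerate by (simp add: zeta_phiB F_def power2_eq_square field_simps)
    then show ?thesis using that by simp
  qed
  show ?thesis
    by (rule has_field_derivative_transform_within_open [OF F open_Compl [OF closed_singleton] _ eq])
      (use assms in auto)
qed

lemma deriv_phiB: "\<zeta> \<noteq> 0 \<Longrightarrow> deriv (phiB a b) \<zeta> = of_real \<kappa> * (1 - 1 / \<zeta>\<^sup>2)"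
  by (rule DERIV_imp_deriv [OF phiB_has_derivative])

lemma etaB_nonzero:
  assumes "\<zeta> \<noteq> 0" "\<zeta> \<noteq> 1" "\<zeta> \<noteq> -1"
  shows "etaB a b \<zeta> \<noteq> 0"
proof -
  have "\<zeta>\<^sup>2 \<noteq> 1" using assms by (simp add: power2_eq_1_iff)
  then have "\<zeta> * etaB a b \<zeta> \<noteq> 0"
    unfolding zeta_etaB [OF assms(1)] using nondegenerate kappa_pos by simp
  then show ?thesis by auto
qed

text \<open>The numerator \<open>\<zeta> \<phi>(\<zeta>)\<close>.\<close>

definition "\<Phi> = smult (of_real \<kappa>) ([:- of_real c, 1:] * [:- of_real (inverse c), 1:])"

lemma poly_Phi: "\<zeta> \<noteq> 0 \<Longrightarrow> poly \<Phi> \<zeta> = \<zeta> * phiB a b \<zeta>"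
proof -
  assume "\<zeta> \<noteq> 0"
  have "poly \<Phi> \<zeta> = of_real \<kappa> * ((\<zeta> - of_real c) * (\<zeta> - of_real (inverse c)))"
    by (simp add: \<Phi>_def algebra_simps)
  with \<open>\<zeta> \<noteq> 0\<close> show ?thesis by (simp add: phiB_altdef)
qed

text \<open>These are \<open>\<zeta>\<^sup>n \<phi>\<^sup>k e\<^sub>i\<close> and \<open>hhat \<phi>\<^sup>k ehat\<^sub>i\<close> with \<open>n = N/2\<close>. Of the \<open>n\<close> factors \<open>\<zeta>\<close>, \<open>k\<close> clear the poles of
\<open>\<phi>\<^sup>k\<close> and one clears that of \<open>e\<^sub>i\<close>. The leading terms of \<open>- a_minus \<phi>\<close> and \<open>\<eta>\<close> cancel, so \<open>\<zeta> e\<^sub>2\<close> has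
degree one only; in \<open>ehat\<^sub>1\<close> the poles of \<open>a_minus \<phi>\<close> and \<open>\<eta>\<close> cancel instead. This keeps the degree
below \<open>N\<close>.\<close>

definition right_polyB :: "nat \<Rightarrow> nat \<Rightarrow> 2 \<Rightarrow> complex poly"
  where "right_polyB N k i = monom 1 (N div 2 - Suc k) * (\<Phi> ^ k *
    (if i = 1 then [:0, 1:]
     else smult (1 / of_real (2 * d_const a b))
       [:- of_real (2 * a_minus a * \<kappa>), of_real (b_minus b + s / a_minus a):]))"

definition left_polyB :: "nat \<Rightarrow> nat \<Rightarrow> 2 \<Rightarrow> complex poly"
  where "left_polyB N k i = smult (1 / of_real (a_minus a * \<kappa>)) (monom 1 (N div 2 - Suc k) * (\<Phi> ^ k *
    (if i = 1 then [:- of_real ((b_minus b + s / a_minus a) / 2), of_real (a_minus a * \<kappa>):]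
     else [:of_real (d_const a b):])))"

lemma degree_polyB:
  assumes "k < N div 2"
  shows "degree (right_polyB N k i) < N" "degree (left_polyB N k i) < N"
proof -
  have quadratic: "degree \<Phi> \<le> 2"
    unfolding \<Phi>_def by (rule order_trans [OF degree_smult_le]) (simp add: degree_mult_eq)
  have "degree (right_polyB N k i) \<le> (N div 2 - Suc k) + (2 * k + 1)"
    unfolding right_polyB_def
    by (rule order_trans [OF degree_mult_le], intro add_mono degree_power_mult_le quadratic degree_monom_le)
      (auto intro: order_trans [OF degree_smult_le])
  also have "\<dots> < N" using assms by linarith
  finally show "degree (right_polyB N k i) < N" .
  have "degree (left_polyB N k i) \<le> (N div 2 - Suc k) + (2 * k + 1)"
    unfolding left_polyB_def
    by (rule order_trans [OF degree_smult_le], rule order_trans [OF degree_mult_le],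
        intro add_mono degree_power_mult_le quadratic degree_monom_le)
      (auto intro: order_trans [OF degree_smult_le])
  also have "\<dots> < N" using assms by linarith
  finally show "degree (left_polyB N k i) < N" .
qed

lemma power_split:
  assumes "k < n"
  shows "(\<zeta>::complex) ^ n = \<zeta> ^ (n - Suc k) * \<zeta> ^ k * \<zeta>"
  using assms by (simp flip: power_add power_Suc2)

lemma poly_right_polyB:
  assumes "k < N div 2" "\<zeta> \<noteq> 0"
  shows "poly (right_polyB N k i) \<zeta> = hB N \<zeta> * phiB a b \<zeta> ^ k * eB a b \<zeta> $ i $ 1"
proof -
  have e: "poly (if i = 1 then [:0, 1:]
     else smult (1 / of_real (2 * d_const a b))
       [:- of_real (2 * a_minus a * \<kappa>), of_real (b_minus b + s / a_minus a):]) \<zeta> = \<zeta> * eB a b \<zeta> $ i $ 1"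
  proof (cases "i = 1")
    case False
    then have i: "i = 2" using exhaust_2 [of i] by simp
    have "of_real (a_minus a) * (\<zeta> * phiB a b \<zeta>) =
        of_real (a_minus a * \<kappa>) * (\<zeta>\<^sup>2 + 1) - of_real (s / a_minus a) * \<zeta>"
      unfolding zeta_phiB [OF assms(2)] using nondegenerate
      by (simp add: right_diff_distrib power2_eq_square)
    then have "\<zeta> * (of_real (b_minus b) - of_real (a_minus a) * phiB a b \<zeta> + etaB a b \<zeta>) =
        of_real (b_minus b) * \<zeta> - (of_real (a_minus a * \<kappa>) * (\<zeta>\<^sup>2 + 1) - of_real (s / a_minus a) * \<zeta>) +
        of_real (a_minus a * \<kappa>) * (\<zeta>\<^sup>2 - 1)"
      unfolding zeta_etaB [OF assms(2), symmetric] by (simp add: algebra_simps)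
    also have "\<dots> = - of_real (2 * a_minus a * \<kappa>) + \<zeta> * of_real (b_minus b + s / a_minus a)"
      by (simp add: algebra_simps)
    finally show ?thesis
      by (simp add: i eB_def diff_divide_distrib)
  qed (simp add: eB_def)
  show ?thesis
    unfolding right_polyB_def poly_mult poly_power e poly_Phi [OF assms(2)] poly_monom hB_def
      power_split [OF assms(1), of \<zeta>]
    by (simp add: power_mult_distrib mult_ac)
qed

text \<open>The factor \<open>\<zeta>\<^sup>2 - 1\<close> of \<open>hhat\<close> serves to cancel the denominator \<open>\<eta>\<close> of \<open>ehat\<close>.\<close>

lemma hhatB_eq:
  assumes "0 < N div 2" "\<zeta> \<noteq> 0"
  shows "hhatB N \<zeta> = \<zeta> ^ (N div 2 - 1) * etaB a b \<zeta> / of_real (a_minus a * \<kappa>)"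
proof -
  have nz: "complex_of_real (a_minus a * \<kappa>) \<noteq> 0"
    using nondegenerate kappa_pos by simp
  have "\<zeta> * hhatB N \<zeta> = \<zeta> powi (int (N div 2) - 1) * (\<zeta>\<^sup>2 - 1)"
  proof -
    have "\<zeta> powi (int (N div 2) - 1) = \<zeta> powi (1 + (int (N div 2) - 2))" by simp
    also have "\<dots> = \<zeta> * \<zeta> powi (int (N div 2) - 2)"
      using assms(2) by (subst power_int_add) auto
    finally show ?thesis by (simp add: hhatB_def power2_eq_square algebra_simps)
  qed
  also have "\<zeta> powi (int (N div 2) - 1) = \<zeta> ^ (N div 2 - 1)"
    using assms(1) by (simp add: power_int_def nat_diff_distrib)
  also have "\<zeta>\<^sup>2 - 1 = \<zeta> * etaB a b \<zeta> / of_real (a_minus a * \<kappa>)"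
    unfolding zeta_etaB [OF assms(2)] using nz by simp
  finally have "\<zeta> * hhatB N \<zeta> = \<zeta> * (\<zeta> ^ (N div 2 - 1) * etaB a b \<zeta> / of_real (a_minus a * \<kappa>))"
    by (simp only: times_divide_eq_right mult.left_commute)
  then show ?thesis
    by (rule mult_left_cancel [OF assms(2), THEN iffD1])
qed

lemma poly_left_polyB:
  assumes "k < N div 2" "\<zeta> \<noteq> 0" "\<zeta> \<noteq> 1" "\<zeta> \<noteq> -1"
  shows "poly (left_polyB N k i) \<zeta> = hhatB N \<zeta> * phiB a b \<zeta> ^ k * ehatB a b \<zeta> $ 1 $ i"
proof -
  have eta: "etaB a b \<zeta> \<noteq> 0" by (rule etaB_nonzero [OF assms(2-4)])
  have e: "poly (if i = 1 then [:- of_real ((b_minus b + s / a_minus a) / 2), of_real (a_minus a * \<kappa>):]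
     else [:of_real (d_const a b):]) \<zeta> = etaB a b \<zeta> * ehatB a b \<zeta> $ 1 $ i"
  proof (cases "i = 1")
    case True
    have "of_real (a_minus a) * (\<zeta> * phiB a b \<zeta>) =
        of_real (a_minus a * \<kappa>) * (\<zeta>\<^sup>2 + 1) - of_real (s / a_minus a) * \<zeta>"
      unfolding zeta_phiB [OF assms(2)] using nondegenerate
      by (simp add: right_diff_distrib power2_eq_square)
    then have "\<zeta> * (of_real (a_minus a) * phiB a b \<zeta> + etaB a b \<zeta> - of_real (b_minus b)) =
        (of_real (a_minus a * \<kappa>) * (\<zeta>\<^sup>2 + 1) - of_real (s / a_minus a) * \<zeta>) +
        of_real (a_minus a * \<kappa>) * (\<zeta>\<^sup>2 - 1) - of_real (b_minus b) * \<zeta>"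
      unfolding zeta_etaB [OF assms(2), symmetric] by (simp add: algebra_simps)
    also have "\<dots> = \<zeta> * (2 * of_real (a_minus a * \<kappa>) * \<zeta> - of_real (b_minus b + s / a_minus a))"
      by (simp add: algebra_simps power2_eq_square)
    finally have "of_real (a_minus a) * phiB a b \<zeta> + etaB a b \<zeta> - of_real (b_minus b) =
        2 * of_real (a_minus a * \<kappa>) * \<zeta> - of_real (b_minus b + s / a_minus a)"
      using assms(2) by simp
    moreover have "etaB a b \<zeta> * ehatB a b \<zeta> $ 1 $ 1 =
        (of_real (a_minus a) * phiB a b \<zeta> + etaB a b \<zeta> - of_real (b_minus b)) / 2"
      using eta by (simp add: ehatB_def)
    ultimately have "etaB a b \<zeta> * ehatB a b \<zeta> $ 1 $ 1 =
        (2 * of_real (a_minus a * \<kappa>) * \<zeta> - of_real (b_minus b + s / a_minus a)) / 2"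
      by simp
    also have "\<dots> = - of_real ((b_minus b + s / a_minus a) / 2) + \<zeta> * of_real (a_minus a * \<kappa>)"
      unfolding of_real_divide [of _ 2] of_real_numeral by (simp add: diff_divide_distrib)
    finally show ?thesis using True by simp
  next
    case False
    then have i: "i = 2" using exhaust_2 [of i] by simp
    show ?thesis using eta by (simp add: i ehatB_def)
  qed
  have split: "\<zeta> ^ (N div 2 - 1) = \<zeta> ^ (N div 2 - Suc k) * \<zeta> ^ k"
    using assms(1) by (simp flip: power_add)
  have n: "0 < N div 2" using assms(1) by simp
  show ?thesis
    unfolding left_polyB_def poly_smult poly_mult poly_power e poly_Phi [OF assms(2)] poly_monom
      hhatB_eq [OF n assms(2)] split
    by (simp add: power_mult_distrib mult_ac)
qed

end

section \<open>Moments for nonzero \<open>a_minus\<close>\<close>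

context nondegenerate_weights
begin

context
  fixes g :: "real \<Rightarrow> complex"
  assumes g: "valid_path g" "pathfinish g = pathstart g"
    and off0: "0 \<notin> path_image g"
    and off: "complex_of_real c \<notin> path_image g" "complex_of_real (inverse c) \<notin> path_image g"
    and wind: "winding_number g (complex_of_real c) = 1" "winding_number g (complex_of_real (inverse c)) = 1"
    and wind0: "winding_number g 0 = 0"
begin

lemma on_path_nonzero:
  assumes "\<zeta> \<in> path_image g"
  shows "\<zeta> \<noteq> 0" "\<zeta> - of_real c \<noteq> 0" "\<zeta> - of_real (inverse c) \<noteq> 0" "phiB a b \<zeta> \<noteq> 0"
proof -
  show *: "\<zeta> \<noteq> 0" "\<zeta> - of_real c \<noteq> 0" "\<zeta> - of_real (inverse c) \<noteq> 0"
    using assms off0 off by (auto simp del: of_real_inverse)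
  show "phiB a b \<zeta> \<noteq> 0"
    unfolding phiB_altdef using * kappa_pos by (simp del: of_real_inverse)
qed

text \<open>For \<open>k = -1\<close> the logarithmic derivative of \<open>\<phi>\<close> has simple poles with residue \<open>1\<close> at \<open>c\<close> and \<open>1/c\<close>, which
merge if \<open>c = 1\<close>, and with residue \<open>-1\<close> at \<open>0\<close>; the path winds around the first two only.\<close>

lemma phiB_even_moments:
  "((\<lambda>\<zeta>. phiB a b \<zeta> powi k * deriv (phiB a b) \<zeta>) has_contour_integral
      (if k = -1 then 4 * of_real pi * \<i> else 0)) g"
proof (cases "k = -1")
  case True
  have "((\<lambda>\<zeta>. 1 / (\<zeta> - of_real c) + 1 / (\<zeta> - of_real (inverse c)) - 1 / (\<zeta> - 0)) has_contour_integral 4 * of_real pi * \<i>) g"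
    using has_contour_integral_diff [OF has_contour_integral_add
        [OF has_contour_integral_winding_number [OF g(1) off(1)]
            has_contour_integral_winding_number [OF g(1) off(2)]]
          has_contour_integral_winding_number [OF g(1) off0]]
    unfolding wind wind0 by (simp add: mult_ac)
  then have "((\<lambda>\<zeta>. phiB a b \<zeta> powi k * deriv (phiB a b) \<zeta>) has_contour_integral 4 * of_real pi * \<i>) g"
  proof (rule has_contour_integral_eq)
    fix \<zeta> assume \<zeta>: "\<zeta> \<in> path_image g"
    note nz = on_path_nonzero [OF \<zeta>]
    define p where "p = complex_of_real c"
    define q where "q = complex_of_real (inverse c)"
    define K where "K = complex_of_real \<kappa>"
    have K: "K \<noteq> 0" using kappa_pos by (simp add: K_def)
    have pq: "p * q = 1"
      unfolding p_def q_def of_real_mult [symmetric] using c_pos by simp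
    have nz': "\<zeta> \<noteq> 0" "\<zeta> - p \<noteq> 0" "\<zeta> - q \<noteq> 0" using nz by (simp_all add: p_def q_def)
    have "deriv (phiB a b) \<zeta> = K * (\<zeta>\<^sup>2 - p * q) / \<zeta>\<^sup>2"
      unfolding deriv_phiB [OF nz(1)] pq K_def using nz(1) by (simp add: field_simps)
    moreover have "phiB a b \<zeta> = K * ((\<zeta> - p) * (\<zeta> - q)) / \<zeta>"
      unfolding phiB_altdef p_def q_def K_def ..
    ultimately have "phiB a b \<zeta> powi k * deriv (phiB a b) \<zeta> = (\<zeta>\<^sup>2 - p * q) / (\<zeta> * ((\<zeta> - p) * (\<zeta> - q)))"
      using K nz' by (simp add: True power_int_minus power2_eq_square)
    also have "\<dots> = 1 / (\<zeta> - p) + 1 / (\<zeta> - q) - 1 / (\<zeta> - 0)"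
      using nz' by (simp add: divide_simps) (simp add: power2_eq_square algebra_simps)
    finally show "1 / (\<zeta> - of_real c) + 1 / (\<zeta> - of_real (inverse c)) - 1 / (\<zeta> - 0) =
        phiB a b \<zeta> powi k * deriv (phiB a b) \<zeta>"
      by (simp only: p_def q_def)
  qed
  with True show ?thesis by simp
next
  case False
  have "((\<lambda>\<zeta>. phiB a b \<zeta> powi k * (of_real \<kappa> * (1 - 1 / \<zeta>\<^sup>2))) has_contour_integral 0) g"
    by (rule loop_integral_powi_deriv [OF g phiB_has_derivative on_path_nonzero(4) False])
      (rule on_path_nonzero(1))
  then have "((\<lambda>\<zeta>. phiB a b \<zeta> powi k * deriv (phiB a b) \<zeta>) has_contour_integral 0) g"
    by (rule has_contour_integral_eq) (simp add: deriv_phiB on_path_nonzero(1))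
  with False show ?thesis by simp
qed

text \<open>For \<open>k \<ge> 0\<close> the only pole is \<open>0\<close>, around which the path does not wind. For \<open>k = -m < 0\<close> the integrand is a
multiple of \<open>\<zeta>\<^bsup>m-1\<^esup> / ((\<zeta> - c) (\<zeta> - 1/c))\<^sup>m\<close>.\<close>

lemma phiB_integral_div_zeta: "((\<lambda>\<zeta>. phiB a b \<zeta> powi k / \<zeta>) has_contour_integral 0) g"
proof (cases "k \<ge> 0")
  case True
  show ?thesis
  proof (rule Cauchy_theorem_global [where S = "- {0}"])
    show "(\<lambda>\<zeta>. phiB a b \<zeta> powi k / \<zeta>) holomorphic_on - {0}"
      using True unfolding phiB_altdef power_int_def by (auto intro!: holomorphic_intros)
  qed (use g off0 wind0 in auto)
next
  case False
  define m where "m = nat (- k)"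
  define K where "K = complex_of_real \<kappa>"
  have K: "K \<noteq> 0" using kappa_pos by (simp add: K_def)
  have m: "m > 0" using False by (simp add: m_def)
  let ?q = "\<lambda>\<zeta>. (\<zeta> - of_real c) * (\<zeta> - of_real (inverse c))"
  have "((\<lambda>\<zeta>. \<zeta> ^ (m - 1) / ?q \<zeta> ^ m) has_contour_integral 0) g"
    by (rule loop_integral_two_pole_power [OF g off wind]) (use m in simp)
  from has_contour_integral_rmul [OF this, of "1 / K ^ m"]
  have "((\<lambda>\<zeta>. \<zeta> ^ (m - 1) / ?q \<zeta> ^ m * (1 / K ^ m)) has_contour_integral 0) g" by simp
  then show ?thesis
  proof (rule has_contour_integral_eq)
    fix \<zeta> assume "\<zeta> \<in> path_image g"
    then have \<zeta>: "\<zeta> \<noteq> 0" by (rule on_path_nonzero)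
    have "phiB a b \<zeta> powi k = inverse (phiB a b \<zeta>) ^ m"
      using False by (simp only: power_int_def m_def if_False)
    also have "\<dots> = 1 / (K * ?q \<zeta> / \<zeta>) ^ m"
      unfolding phiB_altdef K_def power_inverse by (simp only: inverse_eq_divide)
    also have "\<dots> = \<zeta> ^ m / ?q \<zeta> ^ m * (1 / K ^ m)"
      by (simp add: power_divide power_mult_distrib)
    also have "\<zeta> ^ m = \<zeta> * \<zeta> ^ (m - 1)"
      using m by (simp flip: power_Suc)
    finally show "\<zeta> ^ (m - 1) / ?q \<zeta> ^ m * (1 / K ^ m) = phiB a b \<zeta> powi k / \<zeta>"
      using \<zeta> by simp
  qed
qed

lemma deriv_phiB_div_etaB:
  assumes "\<zeta> \<noteq> 0" "\<zeta> \<noteq> 1" "\<zeta> \<noteq> -1"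
  shows "deriv (phiB a b) \<zeta> / etaB a b \<zeta> = 1 / \<zeta> * (1 / of_real (a_minus a))"
proof -
  have sq: "\<zeta>\<^sup>2 - 1 \<noteq> 0" using assms by (simp add: power2_eq_1_iff)
  have k: "complex_of_real \<kappa> \<noteq> 0" "complex_of_real (a_minus a) \<noteq> 0" using kappa_pos nondegenerate by simp_all
  have "etaB a b \<zeta> = of_real (a_minus a) * of_real \<kappa> * (\<zeta>\<^sup>2 - 1) / \<zeta>"
    using zeta_etaB [OF assms(1)] assms(1) by (simp add: field_simps)
  moreover have "deriv (phiB a b) \<zeta> = of_real \<kappa> * (\<zeta>\<^sup>2 - 1) / \<zeta>\<^sup>2"
    unfolding deriv_phiB [OF assms(1)] using assms(1) by (simp add: field_simps)
  ultimately show ?thesis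
    using sq k assms(1) by (simp add: power2_eq_square)
qed

text \<open>Up to a constant \<open>\<phi>' / \<eta>\<close> is \<open>1 / \<zeta>\<close>, except at \<open>\<plusminus>1\<close>, where \<open>\<eta>\<close> vanishes and the quotient is \<open>0\<close> by
convention.\<close>

lemma phiB_odd_moments:
  "((\<lambda>\<zeta>. phiB a b \<zeta> powi k * (deriv (phiB a b) \<zeta> / etaB a b \<zeta>)) has_contour_integral 0) g"
proof -
  from has_contour_integral_rmul [OF phiB_integral_div_zeta, of k "1 / of_real (a_minus a)"]
  have "((\<lambda>\<zeta>. phiB a b \<zeta> powi k / \<zeta> * (1 / of_real (a_minus a))) has_contour_integral 0) g" by simp
  then show ?thesis
  proof (rule has_contour_integral_spike_finite [OF _ g(1), of _ _ "{1, -1}"])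
    fix \<zeta> assume "\<zeta> \<in> path_image g" "\<zeta> \<notin> {1, -1}"
    then have \<zeta>: "\<zeta> \<noteq> 0" "\<zeta> \<noteq> 1" "\<zeta> \<noteq> -1" using on_path_nonzero(1) by auto
    show "phiB a b \<zeta> powi k * (deriv (phiB a b) \<zeta> / etaB a b \<zeta>) = phiB a b \<zeta> powi k / \<zeta> * (1 / of_real (a_minus a))"
      unfolding deriv_phiB_div_etaB [OF \<zeta>] by simp
  qed simp
qed

lemma scalar_reduction_B:
  assumes N: "even N" "N > 0"
    and CD: "\<exists>R. is_CD_kernel unit_circle (matrix_weight a b L M N) (N div 2) R"
  shows "scalar_reduction a b g (phiB a b) (etaB a b) {1, -1} L M N (hB N) (hhatB N)
    (eB a b) (ehatB a b) (lambdaB a b) (right_polyB N) (left_polyB N)"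
proof
  have n: "0 < N div 2" using N by (auto elim!: evenE)
  have D: "\<zeta> \<noteq> 0" "\<zeta> \<noteq> 1" "\<zeta> \<noteq> -1" if "\<zeta> \<in> path_image g - {1, -1}" for \<zeta>
    using that off0 by auto
  show "laurent_mat (period_mat a b)" by (rule laurent_period_mat)
  show "valid_path g" by (rule g)
  show "phiB a b \<zeta> \<noteq> 0" if "\<zeta> \<in> path_image g" for \<zeta>
    using that by (rule on_path_nonzero)
  show "etaB a b \<zeta> \<noteq> 0" if "\<zeta> \<in> path_image g - {1, -1}" for \<zeta>
    by (rule etaB_nonzero [OF D [OF that]])
  show "period_mat a b (phiB a b \<zeta>) $ 1 $ 2 \<noteq> 0" for \<zeta>
    using pos by (simp add: period_mat_entries)
  show "(etaB a b \<zeta>)\<^sup>2 = (period_mat a b (phiB a b \<zeta>) $ 1 $ 1 - period_mat a b (phiB a b \<zeta>) $ 2 $ 2)\<^sup>2 +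
      4 * period_mat a b (phiB a b \<zeta>) $ 1 $ 2 * period_mat a b (phiB a b \<zeta>) $ 2 $ 1"
    if "\<zeta> \<in> path_image g - {1, -1}" for \<zeta>
    unfolding period_mat_discriminant s_def [symmetric] by (rule etaB_square [OF D(1) [OF that]])
  show "((\<lambda>\<zeta>. phiB a b \<zeta> powi k * deriv (phiB a b) \<zeta>) has_contour_integral
      (if k = -1 then 4 * of_real pi * \<i> else 0)) g" for k
    by (rule phiB_even_moments)
  show "((\<lambda>\<zeta>. phiB a b \<zeta> powi k * (deriv (phiB a b) \<zeta> / etaB a b \<zeta>)) has_contour_integral 0) g" for k
    by (rule phiB_odd_moments)
  show "even N" by (rule N)
  show "hB N \<zeta> \<noteq> 0" if "\<zeta> \<in> path_image g - {1, -1}" for \<zeta>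
    using D(1) [OF that] by (simp add: hB_def)
  show "hhatB N \<zeta> \<noteq> 0" if "\<zeta> \<in> path_image g - {1, -1}" for \<zeta>
    using D [OF that] by (simp add: hhatB_def add_eq_0_iff2)
  show "eB a b \<zeta> = right_eigenvector2 (period_mat a b (phiB a b \<zeta>)) (etaB a b \<zeta>)" for \<zeta>
    unfolding eB_def right_eigenvector2_def period_mat_diff by (simp add: period_mat_entries algebra_simps)
  show "ehatB a b \<zeta> = left_eigenvector2 (period_mat a b (phiB a b \<zeta>)) (etaB a b \<zeta>)" for \<zeta>
    unfolding ehatB_def left_eigenvector2_def period_mat_diff by (simp add: period_mat_entries algebra_simps)
  show "lambdaB a b \<zeta> = eigenvalue2 (period_mat a b (phiB a b \<zeta>)) (etaB a b \<zeta>)" for \<zeta>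
    unfolding lambdaB_def eigenvalue2_def period_mat_trace by (rule refl)
  show "degree (right_polyB N k i) < N" "degree (left_polyB N k i) < N" if "k < N div 2" for k i
    by (rule degree_polyB [OF that])+
  show "poly (right_polyB N k i) \<zeta> = hB N \<zeta> * phiB a b \<zeta> ^ k * eB a b \<zeta> $ i $ 1"
    if "k < N div 2" "\<zeta> \<in> path_image g - {1, -1}" for k i \<zeta>
    by (rule poly_right_polyB [OF that(1) D(1) [OF that(2)]])
  show "poly (left_polyB N k i) \<zeta> = hhatB N \<zeta> * phiB a b \<zeta> ^ k * ehatB a b \<zeta> $ 1 $ i"
    if "k < N div 2" "\<zeta> \<in> path_image g - {1, -1}" for k i \<zeta>
    by (rule poly_left_polyB [OF that(1) D [OF that(2)]])
  show "(\<lambda>\<omega>. \<omega> ^ k * scalar_weight L M N (phiB a b) (hB N) (hhatB N) (lambdaB a b) \<omega>) contour_integrable_on g" for k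
  proof -
    let ?U = "- {0, complex_of_real c, complex_of_real (inverse c)}"
    \<comment> \<open>The zeros of \<open>\<phi>'\<close> at \<open>\<plusminus>1\<close> cancel those of \<open>hhat\<close>, so the weight continues to the holomorphic function \<open>F\<close>.\<close>
    define F where "F \<omega> = \<omega> ^ k * (lambdaB a b \<omega> ^ (L div 2) * of_real \<kappa> /
        (phiB a b \<omega> ^ ((M + N) div 2) * hB N \<omega> * \<omega> ^ (N div 2)))" for \<omega>
    have "F contour_integrable_on g"
    proof (rule contour_integrable_holomorphic_simple)
      show "open ?U" by (intro open_Compl finite_imp_closed) auto
      show "path_image g \<subseteq> ?U" using off0 off by auto
      show "F holomorphic_on ?U"
        unfolding F_def [abs_def] lambdaB_def etaB_def hB_def phiB_altdef
        using kappa_pos by (intro holomorphic_intros) (auto simp del: of_real_inverse)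
    qed (rule g)
    then obtain I where "(F has_contour_integral I) g"
      unfolding contour_integrable_on_def by blast
    then have "((\<lambda>\<omega>. \<omega> ^ k * scalar_weight L M N (phiB a b) (hB N) (hhatB N) (lambdaB a b) \<omega>)
        has_contour_integral I) g"
    proof (rule has_contour_integral_spike_finite [OF _ g(1), of _ _ "{1, -1}"])
      fix \<omega> assume "\<omega> \<in> path_image g" "\<omega> \<notin> {1, -1}"
      then have \<omega>: "\<omega> \<noteq> 0" "\<omega> \<noteq> 1" "\<omega> \<noteq> -1" using on_path_nonzero(1) by auto
      have eta: "etaB a b \<omega> \<noteq> 0" by (rule etaB_nonzero [OF \<omega>])
      have k: "complex_of_real \<kappa> \<noteq> 0" "complex_of_real (a_minus a) \<noteq> 0" using kappa_pos nondegenerate by simp_all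
      have d: "deriv (phiB a b) \<omega> = etaB a b \<omega> * (1 / \<omega> * (1 / of_real (a_minus a)))"
        unfolding deriv_phiB_div_etaB [OF \<omega>, symmetric] using eta by simp
      have pw: "\<omega> ^ (N div 2) = \<omega> * \<omega> ^ (N div 2 - 1)"
        using n by (simp flip: power_Suc)
      have "deriv (phiB a b) \<omega> / hhatB N \<omega> = of_real \<kappa> / \<omega> ^ (N div 2)"
        unfolding hhatB_eq [OF n \<omega>(1)] d pw using eta k \<omega>(1) by simp
      then have "lambdaB a b \<omega> ^ (L div 2) / (phiB a b \<omega> ^ ((M + N) div 2) * hB N \<omega>) *
            (deriv (phiB a b) \<omega> / hhatB N \<omega>) =
          lambdaB a b \<omega> ^ (L div 2) / (phiB a b \<omega> ^ ((M + N) div 2) * hB N \<omega>) * (of_real \<kappa> / \<omega> ^ (N div 2))"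
        by (rule arg_cong)
      then show "\<omega> ^ k * scalar_weight L M N (phiB a b) (hB N) (hhatB N) (lambdaB a b) \<omega> = F \<omega>"
        unfolding F_def scalar_weight_def by simp
    qed simp
    then show ?thesis unfolding contour_integrable_on_def by blast
  qed
  show "\<exists>R. is_CD_kernel unit_circle (matrix_weight a b L M N) (N div 2) R" by (rule CD)
qed simp

end

end

section \<open>The scalar formula\<close>

theorem theorem2p8:
  fixes a b :: "nat \<Rightarrow> nat \<Rightarrow> real" and L M N :: nat
  assumes a_pos: "\<And>l j. l \<in> {0, 1} \<Longrightarrow> j \<in> {0, 1} \<Longrightarrow> a l j > 0"
    and b_pos: "\<And>l j. l \<in> {0, 1} \<Longrightarrow> j \<in> {0, 1} \<Longrightarrow> b l j > 0"
    and L: "L > 0" "even L"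
    and M: "M > 0" "even M"
    and N: "N > 0" "even N"
    and CD_exists: "\<exists>R. is_CD_kernel unit_circle (matrix_weight a b L M N) (N div 2) R"
  shows
    "(a_minus a = 0 \<longrightarrow>
       (\<forall>z0 r.
          complex_of_real (b_minus b) \<in> ball z0 r \<and> - complex_of_real (b_minus b) \<in> ball z0 r \<longrightarrow>
          (\<exists>!R. is_scalar_CD_kernel (circlepath z0 r)
                  (scalar_weight L M N (phiA a b) hA hhatA (lambdaA a b)) N R) \<and>
          (\<forall>\<epsilon>1\<in>{0, 1}. \<forall>\<epsilon>2\<in>{0, 1}. \<forall>x1 x2 y1 y2 :: int.
             2 * x1 + \<epsilon>1 \<in> {1..int L - 1} \<and> 2 * x2 - \<epsilon>2 \<in> {1..int L - 1} \<longrightarrow>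
             corr_kernel_block a b L M N \<epsilon>1 \<epsilon>2 x1 x2 y1 y2 =
             scalar_formula a b L M N (circlepath z0 r)
               (phiA a b) hA hhatA (eA a b) (ehatA a b) (lambdaA a b) \<epsilon>1 \<epsilon>2 x1 x2 y1 y2))) \<and>
     (a_minus a \<noteq> 0 \<longrightarrow>
       z_minus a b < z_plus a b \<and> z_plus a b \<le> 0 \<and> 0 < c_const a b \<and> c_const a b \<le> 1 \<and>
       (b_minus b \<noteq> 0 \<longrightarrow> z_plus a b < 0 \<and> c_const a b < 1) \<and>
       (\<forall>g.
          valid_path g \<and> pathfinish g = pathstart g \<and>
          0 \<notin> path_image g \<and>
          complex_of_real (c_const a b) \<notin> path_image g \<and>
          complex_of_real (inverse (c_const a b)) \<notin> path_image g \<and>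
          winding_number g (complex_of_real (c_const a b)) = 1 \<and>
          winding_number g (complex_of_real (inverse (c_const a b))) = 1 \<and>
          winding_number g 0 = 0 \<longrightarrow>
          (\<exists>!R. is_scalar_CD_kernel g
                  (scalar_weight L M N (phiB a b) (hB N) (hhatB N) (lambdaB a b)) N R) \<and>
          (\<forall>\<epsilon>1\<in>{0, 1}. \<forall>\<epsilon>2\<in>{0, 1}. \<forall>x1 x2 y1 y2 :: int.
             2 * x1 + \<epsilon>1 \<in> {1..int L - 1} \<and> 2 * x2 - \<epsilon>2 \<in> {1..int L - 1} \<longrightarrow>
             corr_kernel_block a b L M N \<epsilon>1 \<epsilon>2 x1 x2 y1 y2 =
             scalar_formula a b L M N g
               (phiB a b) (hB N) (hhatB N) (eB a b) (ehatB a b) (lambdaB a b)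
               \<epsilon>1 \<epsilon>2 x1 x2 y1 y2)))"
proof (intro conjI impI)
  have a': "\<forall>l\<in>{0, 1}. \<forall>j\<in>{0, 1}. a l j > 0" and b': "\<forall>l\<in>{0, 1}. \<forall>j\<in>{0, 1}. b l j > 0"
    using a_pos b_pos by blast+
  {
    assume deg: "a_minus a = 0"
    show "\<forall>z0 r.
          complex_of_real (b_minus b) \<in> ball z0 r \<and> - complex_of_real (b_minus b) \<in> ball z0 r \<longrightarrow>
          (\<exists>!R. is_scalar_CD_kernel (circlepath z0 r)
                  (scalar_weight L M N (phiA a b) hA hhatA (lambdaA a b)) N R) \<and>
          (\<forall>\<epsilon>1\<in>{0, 1}. \<forall>\<epsilon>2\<in>{0, 1}. \<forall>x1 x2 y1 y2 :: int.
             2 * x1 + \<epsilon>1 \<in> {1..int L - 1} \<and> 2 * x2 - \<epsilon>2 \<in> {1..int L - 1} \<longrightarrow>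
             corr_kernel_block a b L M N \<epsilon>1 \<epsilon>2 x1 x2 y1 y2 =
             scalar_formula a b L M N (circlepath z0 r)
               (phiA a b) hA hhatA (eA a b) (ehatA a b) (lambdaA a b) \<epsilon>1 \<epsilon>2 x1 x2 y1 y2)"
    proof (intro allI impI)
      fix z0 r
      define \<beta> where "\<beta> = complex_of_real (b_minus b)"
      assume "complex_of_real (b_minus b) \<in> ball z0 r \<and> - complex_of_real (b_minus b) \<in> ball z0 r"
      then have in_ball: "\<beta> \<in> ball z0 r" "- \<beta> \<in> ball z0 r" by (simp_all add: \<beta>_def)
      \<comment> \<open>The point \<open>0\<close> is the midpoint of two points of the disc, so the circle also avoids the zero of \<open>\<eta>\<close>.\<close>
      have "0 \<in> closed_segment \<beta> (- \<beta>)"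
        unfolding in_segment by (intro exI [of _ "1 / 2"]) auto
      then have zero: "0 \<in> ball z0 r"
        using in_ball closed_segment_subset [OF in_ball convex_ball] by blast
      have off: "w \<notin> path_image (circlepath z0 r)" if "w \<in> ball z0 r" for w
      proof -
        from that have "dist z0 w < r" by simp
        then have "r > 0" using zero_le_dist [of z0 w] by linarith
        then show ?thesis using that by (simp add: path_image_circlepath)
      qed
      have wind: "winding_number (circlepath z0 r) w = 1" if "w \<in> ball z0 r" for w
        using that by (intro winding_number_circlepath) (simp add: dist_norm norm_minus_commute)
      interpret scalar_reduction a b "circlepath z0 r" "phiA a b" "\<lambda>\<zeta>. \<zeta>" "{}" L M N hA hhatA
        "eA a b" "ehatA a b" "lambdaA a b" "right_polyA a b" "left_polyA a b"
        by (rule scalar_reduction_A [OF a' b' deg N(2) CD_exists])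
          (use off wind in_ball zero in \<open>simp_all add: \<beta>_def\<close>)
      show "(\<exists>!R. is_scalar_CD_kernel (circlepath z0 r)
                  (scalar_weight L M N (phiA a b) hA hhatA (lambdaA a b)) N R) \<and>
          (\<forall>\<epsilon>1\<in>{0, 1}. \<forall>\<epsilon>2\<in>{0, 1}. \<forall>x1 x2 y1 y2 :: int.
             2 * x1 + \<epsilon>1 \<in> {1..int L - 1} \<and> 2 * x2 - \<epsilon>2 \<in> {1..int L - 1} \<longrightarrow>
             corr_kernel_block a b L M N \<epsilon>1 \<epsilon>2 x1 x2 y1 y2 =
             scalar_formula a b L M N (circlepath z0 r)
               (phiA a b) hA hhatA (eA a b) (ehatA a b) (lambdaA a b) \<epsilon>1 \<epsilon>2 x1 x2 y1 y2)"
        using ex1_scalar_CD_kernel corr_kernel_block_eq_scalar_formula L(2) by blast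
    qed
  }
  assume "a_minus a \<noteq> 0"
  then interpret nondegenerate_weights a b
    using a' b' by unfold_locales
  show "z_minus a b < z_plus a b" by (rule z_less)
  show "z_plus a b \<le> 0" by (rule z_plus_nonpos)
  show "0 < c_const a b" by (rule c_pos)
  show "c_const a b \<le> 1" by (rule c_le_1)
  show "z_plus a b < 0" if "b_minus b \<noteq> 0" using that by (rule z_plus_neg)
  show "c_const a b < 1" if "b_minus b \<noteq> 0" using that by (rule c_less_1)
  show "\<forall>g.
          valid_path g \<and> pathfinish g = pathstart g \<and>
          0 \<notin> path_image g \<and>
          complex_of_real (c_const a b) \<notin> path_image g \<and>
          complex_of_real (inverse (c_const a b)) \<notin> path_image g \<and>
          winding_number g (complex_of_real (c_const a b)) = 1 \<and>
          winding_number g (complex_of_real (inverse (c_const a b))) = 1 \<and>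
          winding_number g 0 = 0 \<longrightarrow>
          (\<exists>!R. is_scalar_CD_kernel g
                  (scalar_weight L M N (phiB a b) (hB N) (hhatB N) (lambdaB a b)) N R) \<and>
          (\<forall>\<epsilon>1\<in>{0, 1}. \<forall>\<epsilon>2\<in>{0, 1}. \<forall>x1 x2 y1 y2 :: int.
             2 * x1 + \<epsilon>1 \<in> {1..int L - 1} \<and> 2 * x2 - \<epsilon>2 \<in> {1..int L - 1} \<longrightarrow>
             corr_kernel_block a b L M N \<epsilon>1 \<epsilon>2 x1 x2 y1 y2 =
             scalar_formula a b L M N g
               (phiB a b) (hB N) (hhatB N) (eB a b) (ehatB a b) (lambdaB a b)
               \<epsilon>1 \<epsilon>2 x1 x2 y1 y2)"
  proof (intro allI impI, elim conjE)
    fix g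
    assume g: "valid_path g" "pathfinish g = pathstart g" "0 \<notin> path_image g"
      "complex_of_real (c_const a b) \<notin> path_image g"
      "complex_of_real (inverse (c_const a b)) \<notin> path_image g"
      "winding_number g (complex_of_real (c_const a b)) = 1"
      "winding_number g (complex_of_real (inverse (c_const a b))) = 1"
      "winding_number g 0 = 0"
    interpret scalar_reduction a b g "phiB a b" "etaB a b" "{1, -1}" L M N "hB N" "hhatB N"
      "eB a b" "ehatB a b" "lambdaB a b" "right_polyB N" "left_polyB N"
      by (rule scalar_reduction_B [OF g N(2,1) CD_exists])
    show "(\<exists>!R. is_scalar_CD_kernel g
                  (scalar_weight L M N (phiB a b) (hB N) (hhatB N) (lambdaB a b)) N R) \<and>
          (\<forall>\<epsilon>1\<in>{0, 1}. \<forall>\<epsilon>2\<in>{0, 1}. \<forall>x1 x2 y1 y2 :: int.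
             2 * x1 + \<epsilon>1 \<in> {1..int L - 1} \<and> 2 * x2 - \<epsilon>2 \<in> {1..int L - 1} \<longrightarrow>
             corr_kernel_block a b L M N \<epsilon>1 \<epsilon>2 x1 x2 y1 y2 =
             scalar_formula a b L M N g
               (phiB a b) (hB N) (hhatB N) (eB a b) (ehatB a b) (lambdaB a b)
               \<epsilon>1 \<epsilon>2 x1 x2 y1 y2)"
      using ex1_scalar_CD_kernel corr_kernel_block_eq_scalar_formula L(2) by blast
  qed
qed

end
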